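(* Let $n\ge 1$. Let $q\in[1,\infty)$, $c\in(0,\infty]$, $\mathbf{B}=(\beta_0,\beta_\infty)\in\mathbb{R}^2$ be such that either $q=c=1$ and $\mathbf{B}=(0,0)$, or $1<q<\infty$ and $0<c\le\infty$ (with $\mathbf{B}\in\mathbb{R}^2$ arbitrary). Let $p,b\in(0,\infty]$ and $\mathbf{A}=(\alpha_0,\alpha_\infty)\in\mathbb{R}^2$ be such that either $q<p<\infty$ and $0<b\le\infty$, or $p=b=\infty$ and $\mathbf{A}=(0,0)$. Then there is a constant $C>0$, independent of $R$ and $f$, such that for all $R>0$ and all $f\in L^R_{q,c;\mathbf{B}}$ $$\|f\|_{p,b;\mathbf{A}}\le C\,R^{n\left(\frac1q-\frac1p\right)}\,l^{(\overleftarrow{\mathbf{A}}-\overleftarrow{\mathbf{B}})}(R)\,\|f\|_{q,c;\mathbf{B}}.$$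
   Context: Convention: $1/\infty=0$. For a pair $\mathbf{A}=(\alpha_0,\alpha_\infty)\in\mathbb{R}^2$ put $\overleftarrow{\mathbf{A}}=(\alpha_\infty,\alpha_0)$; pairs are added and subtracted componentwise. The broken-logarithmic function is $l^{\mathbf{A}}(t)=(1+|\ln t|)^{\alpha_0}$ for $0<t\le 1$ and $l^{\mathbf{A}}(t)=(1+|\ln t|)^{\alpha_\infty}$ for $t>1$. Functions are complex-valued, measurable on $\mathbb{R}^n$ with Lebesgue measure; $f^*$ is the non-increasing rearrangement of $f$. For $0<p,b\le\infty$, the Lorentz–Zygmund space $L_{p,b;\mathbf{A}}=L_{p,b;\mathbf{A}}(\mathbb{R}^n)$ consists of all measurable $f$ with $$\|f\|_{p,b;\mathbf{A}}:=\left\|t^{\frac1p-\frac1b}\,l^{\mathbf{A}}(t)\,f^*(t)\right\|_{L_b(0,\infty)}<\infty,$$ where $\|\cdot\|_{L_b(0,\infty)}$ is the usual Lebesgue (quasi-)norm in $t$. $S'$ is the space of tempered distributions on $\mathbb{R}^n$ and $\hat f$ is the Fourier transform of $f\in S'$, extending $\hat f(\xi)=\int e^{-2\pi i x\xi}f(x)\,dx$. For $0<R<\infty$, $B_R=\{\xi\in\mathbb{R}^n:|\xi|\le R\}$ and $L^R_{q,c;\mathbf{B}}=\{f\in L_{q,c;\mathbf{B}}\cap S':\operatorname{supp}\hat f\subset B_R\}$. The constant $C$ may depend on $p,b,\mathbf{A},q,c,\mathbf{B}$ and the fixed dimension $n$. *)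

theory Defs
  imports "HOL-Analysis.Analysis" "HOL-Probability.Essential_Supremum"
begin

section \<open>Lorentz--Zygmund spaces\<close>

text \<open>Exponents range over the extended nonnegative reals; in particular
  \<open>recip \<infinity> = 0\<close>.\<close>

definition recip :: "ennreal \<Rightarrow> real" where
  "recip p = enn2real (1 / p)"

definition broken_log :: "real \<times> real \<Rightarrow> real \<Rightarrow> real" where
  "broken_log A t = (if t \<le> 1 then (1 + \<bar>ln t\<bar>) powr fst A else (1 + \<bar>ln t\<bar>) powr snd A)"

definition rearrangement :: "('a::euclidean_space \<Rightarrow> complex) \<Rightarrow> real \<Rightarrow> ennreal" where
  "rearrangement f t =
     Inf {ennreal s | s. 0 \<le> s \<and> emeasure lebesgue {x. s < norm (f x)} \<le> ennreal t}"

text \<open>Only used for exponents \<open>a > 0\<close>, for which \<open>\<infinity>\<close> raised to the power \<open>a\<close> is \<open>\<infinity>\<close>.\<close>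

definition epowr :: "ennreal \<Rightarrow> real \<Rightarrow> ennreal" where
  "epowr x a = (if x = \<infinity> then \<infinity> else ennreal (enn2real x powr a))"

definition Lb_norm :: "ennreal \<Rightarrow> (real \<Rightarrow> ennreal) \<Rightarrow> ennreal" where
  "Lb_norm b g =
     (if b = \<infinity> then esssup (lebesgue_on {0<..}) g
      else epowr (\<integral>\<^sup>+ t. epowr (g t) (enn2real b) \<partial>lebesgue_on {0<..}) (recip b))"

definition LZ_norm ::
    "ennreal \<Rightarrow> ennreal \<Rightarrow> real \<times> real \<Rightarrow> ('a::euclidean_space \<Rightarrow> complex) \<Rightarrow> ennreal" where
  "LZ_norm p b A f =
     Lb_norm b (\<lambda>t. ennreal (t powr (recip p - recip b) * broken_log A t) * rearrangement f t)"

definition LZ_space ::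
    "ennreal \<Rightarrow> ennreal \<Rightarrow> real \<times> real \<Rightarrow> ('a::euclidean_space \<Rightarrow> complex) set" where
  "LZ_space p b A = {f \<in> borel_measurable lebesgue. LZ_norm p b A f < \<infinity>}"

section \<open>Tempered distributions\<close>

text \<open>Iterated partial derivatives are indexed by lists of basis vectors instead of
  multi-indices; for smooth functions the order of differentiation is immaterial.\<close>

fun partials :: "'a::euclidean_space list \<Rightarrow> ('a \<Rightarrow> complex) \<Rightarrow> 'a \<Rightarrow> complex" where
  "partials [] \<phi> = \<phi>"
| "partials (e # es) \<phi> = (\<lambda>x. frechet_derivative (partials es \<phi>) (at x) e)"

definition smooth :: "('a::euclidean_space \<Rightarrow> complex) \<Rightarrow> bool" where
  "smooth \<phi> \<longleftrightarrow> (\<forall>es. set es \<subseteq> Basis \<longrightarrow> (\<forall>x. partials es \<phi> differentiable (at x)))"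

definition schwartz :: "('a::euclidean_space \<Rightarrow> complex) set" where
  "schwartz = {\<phi>. smooth \<phi> \<and>
     (\<forall>k es. set es \<subseteq> Basis \<longrightarrow> bounded (range (\<lambda>x. (1 + norm x) ^ k *\<^sub>R partials es \<phi> x)))}"

definition schwartz_seminorm ::
    "nat \<Rightarrow> 'a::euclidean_space list \<Rightarrow> ('a \<Rightarrow> complex) \<Rightarrow> real" where
  "schwartz_seminorm k es \<phi> = (SUP x. (1 + norm x) ^ k * norm (partials es \<phi> x))"

definition schwartz_topology :: "('a::euclidean_space \<Rightarrow> complex) topology" where
  "schwartz_topology = topology_generated_by
     {{\<psi> \<in> schwartz. schwartz_seminorm k es (\<lambda>x. \<psi> x - \<phi> x) < r} | k es \<phi> r.
        set es \<subseteq> Basis \<and> \<phi> \<in> schwartz \<and> 0 < r}"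

definition tempered_distribution :: "(('a::euclidean_space \<Rightarrow> complex) \<Rightarrow> complex) \<Rightarrow> bool" where
  "tempered_distribution T \<longleftrightarrow>
     (\<forall>\<phi>\<in>schwartz. \<forall>\<psi>\<in>schwartz. \<forall>a b. T (\<lambda>x. a * \<phi> x + b * \<psi> x) = a * T \<phi> + b * T \<psi>) \<and>
     continuous_map schwartz_topology euclidean T"

definition fourier :: "('a::euclidean_space \<Rightarrow> complex) \<Rightarrow> 'a \<Rightarrow> complex" where
  "fourier \<phi> \<xi> = (\<integral>x. exp (- 2 * complex_of_real pi * \<i> * complex_of_real (x \<bullet> \<xi>)) * \<phi> x \<partial>lebesgue)"

definition fourier_distr ::
    "(('a::euclidean_space \<Rightarrow> complex) \<Rightarrow> complex) \<Rightarrow> ('a \<Rightarrow> complex) \<Rightarrow> complex" where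
  "fourier_distr T \<phi> = T (fourier \<phi>)"

definition test_functions :: "'a::euclidean_space set \<Rightarrow> ('a \<Rightarrow> complex) set" where
  "test_functions U =
     {\<phi>. smooth \<phi> \<and> compact (closure {x. \<phi> x \<noteq> 0}) \<and> closure {x. \<phi> x \<noteq> 0} \<subseteq> U}"

definition distr_support :: "(('a::euclidean_space \<Rightarrow> complex) \<Rightarrow> complex) \<Rightarrow> 'a set" where
  "distr_support T = - \<Union>{U. open U \<and> (\<forall>\<phi>\<in>test_functions U. T \<phi> = 0)}"

definition distr_of :: "('a::euclidean_space \<Rightarrow> complex) \<Rightarrow> ('a \<Rightarrow> complex) \<Rightarrow> complex" where
  "distr_of f \<phi> = (\<integral>x. f x * \<phi> x \<partial>lebesgue)"

text \<open>The functions that are tempered distributions through the pairing \<open>distr_of\<close>. The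
  integrability requirement is needed because the library integral of a non-integrable
  function is \<open>0\<close>.\<close>

definition tempered_functions :: "('a::euclidean_space \<Rightarrow> complex) set" where
  "tempered_functions = {f.
     (\<forall>\<phi>\<in>schwartz. integrable lebesgue (\<lambda>x. f x * \<phi> x)) \<and> tempered_distribution (distr_of f)}"

definition LZ_bandlimited ::
    "real \<Rightarrow> ennreal \<Rightarrow> ennreal \<Rightarrow> real \<times> real \<Rightarrow> ('a::euclidean_space \<Rightarrow> complex) set" where
  "LZ_bandlimited R q c B = {f \<in> LZ_space q c B \<inter> tempered_functions.
     distr_support (fourier_distr (distr_of f)) \<subseteq> cball 0 R}"

end

theory Submission
  imports Defs "HOL-Probability.Probability" "HOL-Computational_Algebra.Polynomial"
begin

text \<open>Let \<open>H\<close> be the Fourier transform of a product cutoff that equals \<open>1\<close> near the unit cube. If the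
  spectrum of \<open>f\<close> lies in the ball of radius \<open>R\<close>, then the smoothing of \<open>f\<close> with the kernel
  \<open>r\<^sup>n H(r x)\<close> does not depend on \<open>r \<ge> R\<close>; letting \<open>r\<close> tend to infinity, Lebesgue differentiation
  identifies it with \<open>(\<integral>H) f\<close>. As \<open>H\<close> is integrable and bounded, splitting \<open>f\<close> at height \<open>f*(R\<^sup>-\<^sup>n)\<close>
  bounds \<open>|f|\<close> by a multiple of \<open>R\<^sup>n\<close> times the integral of \<open>f*\<close> over \<open>(0, R\<^sup>-\<^sup>n)\<close>.
  Together with the weak-type bound \<open>f*(t) \<le> C t\<^bsup>-1/q\<^esup> l\<^bsup>-B\<^esup>(t) \<parallel>f\<parallel>\<close> this controls
  \<open>t\<^bsup>1/p\<^esup> l\<^bsup>A\<^esup>(t) f*(t)\<close> by a multiple of \<open>min(u\<^bsup>\<sigma>\<^esup>, u\<^bsup>-\<sigma>\<^esup>)\<close> with \<open>u = R\<^sup>n t\<close> and some \<open>\<sigma> > 0\<close>.\<close>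

section \<open>Smooth functions of one real variable\<close>

text \<open>Functions in the space need not be integrable, so the spectrum is accessible only
  through test functions, and vanishing off the support is known only locally. Products of
  one-variable functions are used throughout because their integrals and transforms factor, their
  partial derivatives are again products, and a product partition of unity turns local into global
  vanishing.

  The logarithms must not cost a power of \<open>R\<close>. With \<open>t = u / R ^ n\<close> one
  has \<open>ln t = ln u - n * ln R\<close>, so small \<open>t\<close> goes with large
  \<open>R\<close>: this is why the components of \<open>A\<close> and \<open>B\<close> are swapped.
  The mismatch is a factor \<open>exp (\<delta> * \<bar>ln u\<bar>)\<close> with
  \<open>\<delta>\<close> as small as desired, and strict inequalities pay for it:
  \<open>1 < q\<close> makes \<open>t powr (- 1 / q)\<close> integrable at 0 with room to spare, and
  \<open>q < p\<close> leaves the powers \<open>1 / p\<close> of \<open>u\<close> on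
  \<open>u \<le> 1\<close> and \<open>1 / p - 1 / q\<close> on \<open>u > 1\<close>, decaying at
  both ends. For \<open>q = 1\<close> that first room is missing, and there the norm itself is the
  integral of the rearrangement. Two-sided power decay has finite \<open>L_b\<close> norm with
  respect to \<open>dt / t\<close>, which is why \<open>b\<close> is arbitrary when
  \<open>q < p\<close>.\<close>

fun diff_order :: "nat \<Rightarrow> (real \<Rightarrow> complex) \<Rightarrow> bool" where
  "diff_order 0 g \<longleftrightarrow> True"
| "diff_order (Suc k) g \<longleftrightarrow> (\<exists>g'. (\<forall>x. (g has_vector_derivative g' x) (at x)) \<and> diff_order k g')"

definition smooth_real :: "(real \<Rightarrow> complex) \<Rightarrow> bool" where
  "smooth_real g \<longleftrightarrow> (\<forall>k. diff_order k g)"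

lemma diff_order_SucI:
  "(\<And>x. (g has_vector_derivative g' x) (at x)) \<Longrightarrow> diff_order k g' \<Longrightarrow> diff_order (Suc k) g"
  by auto

lemma diff_order_SucD: "diff_order (Suc k) g \<Longrightarrow> diff_order k g"
proof (induction k arbitrary: g)
  case (Suc k)
  then show ?case by (metis diff_order.simps(2))
qed simp

lemma diff_order_const: "diff_order k (\<lambda>x. c)"
proof (induction k arbitrary: c)
  case (Suc k)
  then show ?case by (auto intro!: exI[of _ "\<lambda>_. 0"])
qed simp

lemma diff_order_add:
  "diff_order k f \<Longrightarrow> diff_order k g \<Longrightarrow> diff_order k (\<lambda>x. f x + g x)"
proof (induction k arbitrary: f g)
  case (Suc k)
  then obtain f' g' where "\<forall>x. (f has_vector_derivative f' x) (at x)" "diff_order k f'"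
    "\<forall>x. (g has_vector_derivative g' x) (at x)" "diff_order k g'"
    by auto
  with Suc.IH[of f' g'] show ?case
    by (auto intro!: exI[of _ "\<lambda>x. f' x + g' x"] derivative_intros)
qed simp

lemma diff_order_mult:
  "diff_order k f \<Longrightarrow> diff_order k g \<Longrightarrow> diff_order k (\<lambda>x. f x * g x)"
proof (induction k arbitrary: f g)
  case (Suc k)
  then obtain f' g' where *: "\<forall>x. (f has_vector_derivative f' x) (at x)" "diff_order k f'"
    "\<forall>x. (g has_vector_derivative g' x) (at x)" "diff_order k g'"
    by auto
  have "diff_order k (\<lambda>x. f x * g' x + f' x * g x)"
    using * Suc.prems[THEN diff_order_SucD] by (intro diff_order_add Suc.IH) auto
  with * show ?case
    by (auto intro!: exI[of _ "\<lambda>x. f x * g' x + f' x * g x"] has_vector_derivative_mult)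
qed simp

lemma diff_order_affine:
  "diff_order k g \<Longrightarrow> diff_order k (\<lambda>x. g (a * x + c))"
proof (induction k arbitrary: g)
  case (Suc k)
  then obtain g' where *: "\<And>x. (g has_vector_derivative g' x) (at x)" "diff_order k g'"
    by auto
  have "((\<lambda>x. g (a * x + c)) has_vector_derivative of_real a * g' (a * x + c)) (at x)" for x
  proof -
    have "((\<lambda>x. a * x + c) has_vector_derivative a) (at x)"
      by (auto intro!: derivative_eq_intros simp: has_real_derivative_iff_has_vector_derivative[symmetric])
    from vector_diff_chain_at[OF this *(1)] show ?thesis
      by (simp add: o_def scaleR_conv_of_real)
  qed
  moreover have "diff_order k (\<lambda>x. of_real a * g' (a * x + c))"
    by (intro diff_order_mult diff_order_const Suc.IH *)
  ultimately show ?case by (rule diff_order_SucI)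
qed simp

lemma diff_order_cexp: "diff_order k (\<lambda>x. exp (c * of_real x))"
proof (induction k)
  case (Suc k)
  have "((\<lambda>x::real. exp (c * of_real x)) has_vector_derivative c * exp (c * of_real x)) (at x)" for x
    by (rule has_vector_derivative_real_field) (auto intro!: derivative_eq_intros)
  then show ?case
    using diff_order_mult[OF diff_order_const Suc.IH, of c] by (rule diff_order_SucI)
qed simp

lemma diff_order_inverse:
  assumes "\<And>x. g x \<noteq> 0"
  shows "diff_order k g \<Longrightarrow> diff_order k (\<lambda>x. inverse (g x))"
proof (induction k)
  case (Suc k)
  then obtain g' where *: "\<And>x. (g has_vector_derivative g' x) (at x)" "diff_order k g'"
    by auto
  have inv: "diff_order k (\<lambda>x. inverse (g x))"
    using Suc diff_order_SucD by blast
  have "((\<lambda>x. inverse (g x)) has_vector_derivative (-1) * (g' x * (inverse (g x) * inverse (g x)))) (at x)" for x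
    using field_vector_diff_chain_at[OF *(1) DERIV_inverse[OF assms[of x]]]
    by (simp add: o_def power2_eq_square power_Suc)
  moreover have "diff_order k (\<lambda>x. (-1) * (g' x * (inverse (g x) * inverse (g x))))"
    by (intro diff_order_mult diff_order_const * inv)
  ultimately show ?case by (rule diff_order_SucI)
qed simp

lemma smooth_real_const: "smooth_real (\<lambda>x. c)"
  by (simp add: smooth_real_def diff_order_const)

lemma smooth_real_add: "smooth_real f \<Longrightarrow> smooth_real g \<Longrightarrow> smooth_real (\<lambda>x. f x + g x)"
  by (simp add: smooth_real_def diff_order_add)

lemma smooth_real_mult: "smooth_real f \<Longrightarrow> smooth_real g \<Longrightarrow> smooth_real (\<lambda>x. f x * g x)"
  by (simp add: smooth_real_def diff_order_mult)

lemma smooth_real_affine: "smooth_real g \<Longrightarrow> smooth_real (\<lambda>x. g (a * x + c))"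
  by (simp add: smooth_real_def diff_order_affine)

lemma smooth_real_cexp: "smooth_real (\<lambda>x. exp (c * of_real x))"
  by (simp add: smooth_real_def diff_order_cexp)

lemma smooth_real_inverse: "smooth_real g \<Longrightarrow> (\<And>x. g x \<noteq> 0) \<Longrightarrow> smooth_real (\<lambda>x. inverse (g x))"
  by (simp add: smooth_real_def diff_order_inverse)

text \<open>Each order of differentiability comes with its own witness for the first derivative;
  uniqueness of derivatives identifies all of them with one \<open>g'\<close>.\<close>

lemma smooth_realE:
  assumes "smooth_real g"
  obtains g' where "\<And>x. (g has_vector_derivative g' x) (at x)" "smooth_real g'"
proof -
  from assms have "diff_order 1 g" by (simp only: smooth_real_def)
  then obtain g' where g': "\<And>x. (g has_vector_derivative g' x) (at x)" by auto
  have "diff_order k g'" for k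
  proof -
    from assms have "diff_order (Suc k) g" by (simp only: smooth_real_def)
    then obtain h where h: "\<And>x. (g has_vector_derivative h x) (at x)" "diff_order k h"
      by auto
    with g' have "h = g'"
      using vector_derivative_unique_at by blast
    with h show ?thesis by simp
  qed
  with g' that show ?thesis by (auto simp: smooth_real_def)
qed

lemma smooth_real_continuous: "smooth_real g \<Longrightarrow> continuous_on UNIV g"
  by (metis smooth_realE continuous_at_imp_continuous_on has_vector_derivative_continuous)

text \<open>The functions \<open>P(1/x) exp(-1/x)\<close>, extended by zero, are closed under differentiation.\<close>

definition flat_exp :: "real poly \<Rightarrow> real \<Rightarrow> real" where
  "flat_exp P x = (if x > 0 then poly P (1 / x) * exp (- 1 / x) else 0)"

text \<open>Substituting \<open>y = 1 / x\<close> on the right of 0 leaves a polynomial divided by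
  \<open>exp y\<close> at infinity.\<close>

lemma flat_exp_tendsto_0: "(flat_exp P \<longlongrightarrow> 0) (at 0)"
proof -
  have "((\<lambda>y. \<Sum>i\<le>degree P. coeff P i * (y ^ i / exp y)) \<longlongrightarrow> (\<Sum>i\<le>degree P. coeff P i * 0)) at_top"
    by (intro tendsto_intros tendsto_power_div_exp_0)
  then have "((\<lambda>y. poly P y * exp (- y)) \<longlongrightarrow> 0) at_top"
    by (simp add: poly_altdef sum_divide_distrib exp_minus field_simps)
  then have "((\<lambda>x. flat_exp P (inverse x)) \<longlongrightarrow> 0) at_top"
  proof (rule Lim_transform_eventually)
    show "\<forall>\<^sub>F x in at_top. poly P x * exp (- x) = flat_exp P (inverse x)"
      using eventually_gt_at_top[of 0] by eventually_elim (auto simp: flat_exp_def field_simps)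
  qed
  then have "(flat_exp P \<longlongrightarrow> 0) (at_right 0)"
    by (simp add: filterlim_at_right_to_top)
  moreover have "(flat_exp P \<longlongrightarrow> 0) (at_left 0)"
    by (rule tendsto_eventually) (auto simp: eventually_at_left_field flat_exp_def intro!: exI[of _ "-1"])
  ultimately show ?thesis by (rule filterlim_split_at[rotated])
qed

text \<open>With \<open>y = 1 / x\<close> one has d/dx = -y^2 d/dy, so P(y) exp(-y) has derivative
  y^2 (P - P')(y) exp(-y), and \<open>[:0,0,1:]\<close> is that y^2. At 0 the difference quotient is
  \<open>flat_exp\<close> of y P(y), which tends to 0.\<close>

lemma flat_exp_has_derivative:
  "(flat_exp P has_real_derivative flat_exp ([:0,0,1:] * (P - pderiv P)) x) (at x)"
proof -
  consider "x > 0" | "x < 0" | "x = 0" by linarith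
  then show ?thesis
  proof cases
    case 1
    have "((\<lambda>x. poly P (1 / x) * exp (- 1 / x)) has_real_derivative
        flat_exp ([:0,0,1:] * (P - pderiv P)) x) (at x)"
      using 1 by (auto intro!: derivative_eq_intros simp: flat_exp_def field_simps power2_eq_square)
    then show ?thesis
    proof (rule has_field_derivative_transform_within_open[of _ _ _ "{0<..}"])
      show "\<And>y. y \<in> {0<..} \<Longrightarrow> poly P (1 / y) * exp (- 1 / y) = flat_exp P y"
        by (simp add: flat_exp_def)
    qed (use 1 in auto)
  next
    case 2
    have "((\<lambda>x. 0) has_real_derivative 0) (at x)" by simp
    then have "(flat_exp P has_real_derivative 0) (at x)"
      by (rule has_field_derivative_transform_within_open[of _ _ _ "{..<0}"])
         (use 2 in \<open>auto simp: flat_exp_def\<close>)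
    then show ?thesis using 2 by (simp add: flat_exp_def)
  next
    case 3
    have "(\<lambda>h. flat_exp P h / h) = flat_exp ([:0,1:] * P)"
      by (auto simp: flat_exp_def fun_eq_iff)
    then have "(flat_exp P has_real_derivative 0) (at 0)"
      using flat_exp_tendsto_0[of "[:0,1:] * P"] by (simp add: DERIV_def) (simp add: flat_exp_def)
    then show ?thesis using 3 by (simp add: flat_exp_def)
  qed
qed

lemma smooth_real_flat_exp: "smooth_real (\<lambda>x. of_real (flat_exp P x))"
proof -
  have "diff_order k (\<lambda>x. of_real (flat_exp P x))" for k
  proof (induction k arbitrary: P)
    case (Suc k)
    have "((\<lambda>x. complex_of_real (flat_exp P x)) has_vector_derivative
        of_real (flat_exp ([:0,0,1:] * (P - pderiv P)) x)) (at x)" for x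
      by (rule has_vector_derivative_of_real) (rule flat_exp_has_derivative)
    then show ?case using Suc.IH by (rule diff_order_SucI)
  qed simp
  then show ?thesis by (simp add: smooth_real_def)
qed

section \<open>Smooth steps, the cutoff and lattice bumps, built from exp(-1/x)\<close>

definition smooth_step :: "real \<Rightarrow> real" where
  "smooth_step x = flat_exp 1 x / (flat_exp 1 x + flat_exp 1 (1 - x))"

lemma flat_exp_1_nonneg: "flat_exp 1 x \<ge> 0"
  by (simp add: flat_exp_def)

text \<open>\<open>x\<close> and \<open>1 - x\<close> are never both nonpositive.\<close>

lemma smooth_step_denom_pos: "flat_exp 1 x + flat_exp 1 (1 - x) > 0"
proof (cases "x > 0")
  case True
  then show ?thesis
    by (intro add_pos_nonneg flat_exp_1_nonneg) (simp add: flat_exp_def)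
next
  case False
  then show ?thesis
    by (intro add_nonneg_pos flat_exp_1_nonneg) (simp add: flat_exp_def)
qed

lemma smooth_step_eq_0: "x \<le> 0 \<Longrightarrow> smooth_step x = 0"
  by (simp add: smooth_step_def flat_exp_def)

lemma smooth_step_eq_1: "x \<ge> 1 \<Longrightarrow> smooth_step x = 1"
  using smooth_step_denom_pos[of x] by (simp add: smooth_step_def flat_exp_def)

lemma smooth_step_nonneg: "smooth_step x \<ge> 0"
  using smooth_step_denom_pos[of x] flat_exp_1_nonneg[of x] by (simp add: smooth_step_def)

lemma smooth_real_smooth_step: "smooth_real (\<lambda>x. of_real (smooth_step x))"
proof -
  have ne: "complex_of_real (flat_exp 1 x) + of_real (flat_exp 1 (-1 * x + 1)) \<noteq> 0" for x
    using smooth_step_denom_pos[of x] by (metis add.commute less_irrefl of_real_add of_real_eq_0_iff mult_minus1 uminus_add_conv_diff)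
  have "smooth_real (\<lambda>x. of_real (flat_exp 1 x) * inverse (complex_of_real (flat_exp 1 x) + of_real (flat_exp 1 (-1 * x + 1))))"
    by (intro smooth_real_mult smooth_real_flat_exp smooth_real_inverse smooth_real_add
        smooth_real_affine[OF smooth_real_flat_exp] ne)
  then show ?thesis
    by (simp add: smooth_step_def divide_inverse)
qed

text \<open>The plateau is [-2, 2], twice as long as the unit scale requires: after dilation by
  \<open>R\<close> the symbol is 1 on the ball of radius \<open>2 * R\<close>, an open neighbourhood
  of the closed ball containing the spectrum.\<close>

definition cutoff :: "real \<Rightarrow> real" where
  "cutoff x = smooth_step (3 + x) * smooth_step (3 - x)"

lemma cutoff_eq_1: "\<bar>x\<bar> \<le> 2 \<Longrightarrow> cutoff x = 1"
  by (simp add: cutoff_def smooth_step_eq_1)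

lemma cutoff_eq_0: "\<bar>x\<bar> \<ge> 3 \<Longrightarrow> cutoff x = 0"
  by (cases "x \<ge> 0") (simp_all add: cutoff_def smooth_step_eq_0)

lemma cutoff_nonneg: "cutoff x \<ge> 0"
  by (simp add: cutoff_def smooth_step_nonneg)

lemma smooth_real_cutoff: "smooth_real (\<lambda>x. of_real (cutoff x))"
  using smooth_real_mult[OF smooth_real_affine[OF smooth_real_smooth_step, of 1 3]
      smooth_real_affine[OF smooth_real_smooth_step, of "-1" 3]]
  by (simp add: cutoff_def add.commute)

text \<open>A difference of consecutive steps, so that sums of integer translates telescope.\<close>

definition lattice_bump :: "real \<Rightarrow> real" where
  "lattice_bump x = smooth_step (x + 1) - smooth_step x"

lemma lattice_bump_eq_0: "\<bar>x\<bar> \<ge> 1 \<Longrightarrow> lattice_bump x = 0"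
  by (cases "x \<ge> 0") (simp_all add: lattice_bump_def smooth_step_eq_0 smooth_step_eq_1)

lemma smooth_real_lattice_bump: "smooth_real (\<lambda>x. of_real (lattice_bump x))"
  using smooth_real_add[OF smooth_real_affine[OF smooth_real_smooth_step, of 1 1]
      smooth_real_mult[OF smooth_real_const[of "-1"] smooth_real_smooth_step]]
  by (simp add: lattice_bump_def)

text \<open>The telescoped sum is a step at \<open>x + N + 1\<close>, which is at least 1, minus a
  step at \<open>x - N\<close>, which is at most 0.\<close>

lemma sum_lattice_bump:
  assumes "\<bar>x\<bar> \<le> real N"
  shows "(\<Sum>j<2*N+1. lattice_bump (x + real N - real j)) = 1"
proof -
  have "(\<Sum>j<m. lattice_bump (x + real N - real j))
      = smooth_step (x + real N + 1) - smooth_step (x + real N + 1 - real m)" for m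
    by (induction m) (simp_all add: lattice_bump_def algebra_simps)
  then show ?thesis
    using assms by (simp add: smooth_step_eq_0 smooth_step_eq_1)
qed

section \<open>Fourier transforms of product functions\<close>

definition compact_smooth :: "(real \<Rightarrow> complex) \<Rightarrow> bool" where
  "compact_smooth g \<longleftrightarrow> smooth_real g \<and> (\<exists>L. \<forall>x. L \<le> \<bar>x\<bar> \<longrightarrow> g x = 0)"

definition fourier_real :: "(real \<Rightarrow> complex) \<Rightarrow> real \<Rightarrow> complex" where
  "fourier_real g x =
     (\<integral>\<xi>. exp (- 2 * complex_of_real pi * \<i> * complex_of_real (x * \<xi>)) * g \<xi> \<partial>lborel)"

lemma integrable_continuous_compact_support:
  fixes g :: "real \<Rightarrow> complex"
  assumes "continuous_on UNIV g" "\<And>x. L \<le> \<bar>x\<bar> \<Longrightarrow> g x = 0"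
  shows "integrable lborel g"
proof -
  have "set_integrable lborel {-L..L} g"
    by (intro borel_integrable_atLeastAtMost' continuous_on_subset[OF assms(1)]) auto
  moreover have "(\<lambda>x. indicator {-L..L} x *\<^sub>R g x) = g"
    using assms(2) by (auto simp: fun_eq_iff indicator_def)
  ultimately show ?thesis by (simp add: set_integrable_def)
qed

lemma integrable_fourier_character_mult:
  assumes "integrable lborel g"
  shows "integrable lborel (\<lambda>\<xi>. exp (- 2 * complex_of_real pi * \<i> * complex_of_real (x * \<xi>)) * g \<xi>)"
  by (rule Bochner_Integration.integrable_bound[OF assms])
     (use assms in \<open>auto simp: norm_mult norm_exp_eq_Re\<close>)

lemma compact_smooth_continuous: "compact_smooth g \<Longrightarrow> continuous_on UNIV g"
  by (simp add: compact_smooth_def smooth_real_continuous)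

lemma compact_smooth_borel[measurable_dest]: "compact_smooth g \<Longrightarrow> g \<in> borel_measurable borel"
  by (intro borel_measurable_continuous_onI compact_smooth_continuous)

lemma compact_smooth_integrable: "compact_smooth g \<Longrightarrow> integrable lborel g"
  using integrable_continuous_compact_support compact_smooth_continuous
  unfolding compact_smooth_def by metis

lemma norm_fourier_real_le:
  assumes "integrable lborel g"
  shows "norm (fourier_real g x) \<le> (\<integral>\<xi>. norm (g \<xi>) \<partial>lborel)"
  unfolding fourier_real_def
  by (rule order_trans[OF integral_norm_bound]) (simp add: norm_mult norm_exp_eq_Re)

lemma compact_smooth_deriv:
  assumes "compact_smooth g"
  obtains g' where "\<And>x. (g has_vector_derivative g' x) (at x)" "compact_smooth g'"
proof -
  from assms obtain L g' where L: "\<And>x. L \<le> \<bar>x\<bar> \<Longrightarrow> g x = 0"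
    and g': "\<And>x. (g has_vector_derivative g' x) (at x)" "smooth_real g'"
    unfolding compact_smooth_def by (metis smooth_realE)
  have "g' x = 0" if "L + 1 \<le> \<bar>x\<bar>" for x
  proof -
    have "((\<lambda>x. 0) has_vector_derivative 0) (at x)" by simp
    then have "(g has_vector_derivative 0) (at x)"
      by (rule has_vector_derivative_transform_within[where d = 1])
         (use that L in \<open>auto simp: dist_real_def\<close>)
    with g'(1) show ?thesis using vector_derivative_unique_at by blast
  qed
  with g' that show ?thesis unfolding compact_smooth_def by blast
qed

text \<open>Two integrations by parts bound x^2 times the transform of \<open>g\<close> by the
  integral of the second derivative. The majorant is integrable, which makes the kernel
  integrable.\<close>

lemma fourier_real_decay:
  assumes g: "compact_smooth g"
  shows "\<exists>C. \<forall>x. norm (fourier_real g x) \<le> C / (1 + x\<^sup>2)"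
proof -
  obtain g' where g': "\<And>x. (g has_vector_derivative g' x) (at x)" "compact_smooth g'"
    using compact_smooth_deriv[OF g] by blast
  obtain g'' where g'': "\<And>x. (g' has_vector_derivative g'' x) (at x)" "compact_smooth g''"
    using compact_smooth_deriv[OF g'(2)] by blast
  obtain L L' L'' where "\<And>x. L \<le> \<bar>x\<bar> \<Longrightarrow> g x = 0" "\<And>x. L' \<le> \<bar>x\<bar> \<Longrightarrow> g' x = 0" "\<And>x. L'' \<le> \<bar>x\<bar> \<Longrightarrow> g'' x = 0"
    using g g' g'' unfolding compact_smooth_def by blast
  then obtain K where K: "K > 0" "\<And>x. K \<le> \<bar>x\<bar> \<Longrightarrow> g x = 0 \<and> g' x = 0 \<and> g'' x = 0"
    using that[of "max 1 (max L (max L' L''))"] by auto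
  note int = compact_smooth_integrable[OF g] compact_smooth_integrable[OF g''(2)]
  have eq: "fourier_real g'' x = (2 * complex_of_real pi * \<i> * of_real x)\<^sup>2 * fourier_real g x" for x
  proof -
    define c where "c = 2 * complex_of_real pi * \<i> * of_real x"
    \<comment> \<open>\<open>F\<close> combines both integrations by parts: in its derivative the
      terms with \<open>g'\<close> cancel, leaving \<open>F'\<close>. Since \<open>F\<close>
      vanishes at both ends of the interval, the integral of \<open>F'\<close> is 0.\<close>
    define F where "F \<xi> = exp (- c * of_real \<xi>) * (g' \<xi> + c * g \<xi>)" for \<xi> :: real
    define F' where "F' \<xi> = exp (- c * of_real \<xi>) * g'' \<xi> - c\<^sup>2 * (exp (- c * of_real \<xi>) * g \<xi>)" for \<xi> :: real
    have e: "((\<lambda>\<xi>::real. exp (- c * of_real \<xi>)) has_vector_derivative - c * exp (- c * of_real \<xi>)) (at \<xi>)" for \<xi>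
      by (rule has_vector_derivative_real_field) (auto intro!: derivative_eq_intros)
    have "(F has_vector_derivative (exp (- c * of_real \<xi>) * (g'' \<xi> + c * g' \<xi>)
        + (- c * exp (- c * of_real \<xi>)) * (g' \<xi> + c * g \<xi>))) (at \<xi>)" for \<xi>
      unfolding F_def
      by (intro has_vector_derivative_mult e has_vector_derivative_add g''
          has_vector_derivative_mult_right g')
    then have F: "(F has_vector_derivative F' \<xi>) (at \<xi>)" for \<xi>
      by (simp add: F'_def algebra_simps power2_eq_square)
    have "has_bochner_integral lborel (\<lambda>\<xi>. indicator {-K..K} \<xi> *\<^sub>R F' \<xi>) (F K - F (-K))"
    proof (rule has_bochner_integral_FTC_Icc)
      show "continuous_on {-K..K} F'"
        unfolding F'_def
        by (intro continuous_intros continuous_on_subset[OF compact_smooth_continuous] g g'') auto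
    qed (use K F in \<open>auto intro: has_vector_derivative_at_within\<close>)
    moreover have "(\<lambda>\<xi>. indicator {-K..K} \<xi> *\<^sub>R F' \<xi>) = F'"
      using K(2) by (auto simp: fun_eq_iff F'_def indicator_def)
    moreover have "F K - F (-K) = 0"
      using K by (simp add: F_def)
    ultimately have "integral\<^sup>L lborel F' = 0"
      by (auto dest: has_bochner_integral_integral_eq)
    moreover have "F' = (\<lambda>\<xi>. exp (- 2 * complex_of_real pi * \<i> * complex_of_real (x * \<xi>)) * g'' \<xi>
        - c\<^sup>2 * (exp (- 2 * complex_of_real pi * \<i> * complex_of_real (x * \<xi>)) * g \<xi>))"
      by (simp add: fun_eq_iff F'_def c_def mult.assoc)
    ultimately have "fourier_real g'' x - c\<^sup>2 * fourier_real g x = 0"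
      using int[THEN integrable_fourier_character_mult, of x]
      unfolding fourier_real_def by (simp only: Bochner_Integration.integral_diff
          integral_mult_right_zero integrable_mult_right)
    then show ?thesis by (simp add: c_def)
  qed
  define C where "C = (\<integral>\<xi>. norm (g \<xi>) \<partial>lborel) + (\<integral>\<xi>. norm (g'' \<xi>) \<partial>lborel)"
  have "norm (fourier_real g x) \<le> C / (1 + x\<^sup>2)" for x
  proof -
    have "norm (fourier_real g'' x) = (2 * pi)\<^sup>2 * x\<^sup>2 * norm (fourier_real g x)"
      unfolding eq by (simp add: norm_mult norm_power power_mult_distrib)
    moreover have "1 * x\<^sup>2 * norm (fourier_real g x) \<le> (2 * pi)\<^sup>2 * x\<^sup>2 * norm (fourier_real g x)"
      using pi_gt3 by (intro mult_right_mono one_le_power) auto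
    ultimately have "(1 + x\<^sup>2) * norm (fourier_real g x) \<le> C"
      using norm_fourier_real_le[OF int(1), of x] norm_fourier_real_le[OF int(2), of x]
      unfolding C_def by (simp add: algebra_simps)
    then show ?thesis
      by (simp add: field_simps add_pos_nonneg)
  qed
  then show ?thesis by blast
qed

lemma borel_measurable_fourier_real[measurable]:
  assumes [measurable]: "g \<in> borel_measurable borel"
  shows "fourier_real g \<in> borel_measurable borel"
  unfolding fourier_real_def by measurable

lemma integrable_fourier_real:
  assumes g: "compact_smooth g"
  shows "integrable lborel (fourier_real g)"
proof -
  obtain C where C: "\<And>x. norm (fourier_real g x) \<le> C / (1 + x\<^sup>2)"
    using fourier_real_decay[OF g] by blast
  have "integrable lborel (\<lambda>x::real. inverse (1 + x\<^sup>2))"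
    using integrable_inverse_1_plus_square by (simp add: set_integrable_def)
  then have "integrable lborel (\<lambda>x. C * inverse (1 + x\<^sup>2))" by simp
  then show ?thesis
  proof (rule Bochner_Integration.integrable_bound)
    show "AE x in lborel. norm (fourier_real g x) \<le> norm (C * inverse (1 + x\<^sup>2))"
      by (intro AE_I2 order_trans[OF C]) (simp add: divide_inverse)
  qed (use g in measurable)
qed

text \<open>Dilating the symbol rescales the kernel, and multiplying by a character recentres it at
  \<open>y\<close>. Thus rescaled, translated kernels are themselves transforms of admissible test
  functions.\<close>

lemma fourier_real_scale_modulate:
  assumes "r > 0"
  shows "fourier_real (\<lambda>\<xi>. g (\<xi> / r) * exp (2 * complex_of_real pi * \<i> * of_real y * of_real \<xi>)) x
    = of_real r * fourier_real g (r * (x - y))"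
proof -
  have "fourier_real (\<lambda>\<xi>. g (\<xi> / r) * exp (2 * complex_of_real pi * \<i> * of_real y * of_real \<xi>)) x
    = (\<integral>\<xi>. exp (- 2 * complex_of_real pi * \<i> * complex_of_real ((x - y) * \<xi>)) * g (\<xi> / r) \<partial>lborel)"
    unfolding fourier_real_def
    by (intro Bochner_Integration.integral_cong) (auto simp: mult.left_commute[of _ "g _"] mult_exp_exp algebra_simps)
  also have "\<dots> = \<bar>r\<bar> *\<^sub>R (\<integral>\<xi>. exp (- 2 * complex_of_real pi * \<i> * complex_of_real ((x - y) * (0 + r * \<xi>))) * g ((0 + r * \<xi>) / r) \<partial>lborel)"
    using assms by (subst lborel_integral_real_affine[where c = r and t = 0]) auto
  also have "\<dots> = of_real r * fourier_real g (r * (x - y))"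
    using assms by (simp add: fourier_real_def scaleR_conv_of_real mult_ac)
  finally show ?thesis .
qed

section \<open>Products of one-variable functions over the coordinates\<close>

definition tensor :: "('a::euclidean_space \<Rightarrow> real \<Rightarrow> complex) \<Rightarrow> 'a \<Rightarrow> complex" where
  "tensor g x = (\<Prod>b\<in>Basis. g b (x \<bullet> b))"

lemma borel_measurable_tensor[measurable]:
  assumes [measurable]: "\<And>b. b \<in> Basis \<Longrightarrow> g b \<in> borel_measurable borel"
  shows "tensor g \<in> borel_measurable borel"
  unfolding tensor_def by measurable

text \<open>Lebesgue measure is the image of the product measure on coordinate tuples, where Fubini
  for finite products applies.\<close>

lemma
  fixes g :: "'a::euclidean_space \<Rightarrow> real \<Rightarrow> complex"
  assumes g: "\<And>b. b \<in> Basis \<Longrightarrow> integrable lborel (g b)"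
  shows integrable_tensor: "integrable lborel (tensor g)"
    and integral_tensor: "integral\<^sup>L lborel (tensor g) = (\<Prod>b\<in>Basis. integral\<^sup>L lborel (g b))"
proof -
  interpret product_sigma_finite "\<lambda>_::'a. lborel :: real measure" ..
  have [measurable]: "g b \<in> borel_measurable borel" if "b \<in> Basis" for b
    using g[OF that] by auto
  have eq: "tensor g (\<Sum>b\<in>Basis. f b *\<^sub>R b) = (\<Prod>b\<in>Basis. g b (f b))" for f
    unfolding tensor_def by (intro prod.cong refl) simp
  show "integrable lborel (tensor g)"
    by (subst lborel_eq, subst integrable_distr_eq) (auto simp: eq intro!: product_integrable_prod g)
  show "integral\<^sup>L lborel (tensor g) = (\<Prod>b\<in>Basis. integral\<^sup>L lborel (g b))"
    by (subst lborel_eq, subst integral_distr) (auto simp: eq intro!: product_integral_prod g)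
qed

lemma fourier_tensor:
  assumes g: "\<And>b. b \<in> Basis \<Longrightarrow> compact_smooth (g b)"
  shows "fourier (tensor g) = tensor (\<lambda>b. fourier_real (g b))"
proof
  fix x :: 'a
  define e where "e b \<xi> = exp (- 2 * complex_of_real pi * \<i> * complex_of_real ((x \<bullet> b) * \<xi>)) * g b \<xi>" for b \<xi>
  have [measurable]: "g b \<in> borel_measurable borel" if "b \<in> Basis" for b
    using g[OF that] by measurable
  have eq: "exp (- 2 * complex_of_real pi * \<i> * complex_of_real (\<xi> \<bullet> x)) * tensor g \<xi> = tensor e \<xi>" for \<xi>
  proof -
    have "\<xi> \<bullet> x = (\<Sum>b\<in>Basis. (x \<bullet> b) * (\<xi> \<bullet> b))"
      by (subst euclidean_inner) (simp add: mult.commute)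
    then have "exp (- 2 * complex_of_real pi * \<i> * complex_of_real (\<xi> \<bullet> x))
      = exp (\<Sum>b\<in>Basis. - 2 * complex_of_real pi * \<i> * complex_of_real ((x \<bullet> b) * (\<xi> \<bullet> b)))"
      by (simp add: sum_distrib_left)
    then show ?thesis
      by (simp add: tensor_def e_def exp_sum prod.distrib)
  qed
  have "fourier (tensor g) x = integral\<^sup>L lebesgue (tensor e)"
    unfolding fourier_def eq ..
  also have "\<dots> = integral\<^sup>L lborel (tensor e)"
    by (rule integral_completion) (auto simp: e_def[abs_def] intro!: borel_measurable_tensor)
  also have "\<dots> = (\<Prod>b\<in>Basis. integral\<^sup>L lborel (e b))"
    unfolding e_def by (intro integral_tensor integrable_fourier_character_mult compact_smooth_integrable g)
  also have "\<dots> = tensor (\<lambda>b. fourier_real (g b)) x"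
    by (simp add: tensor_def e_def[abs_def] fourier_real_def)
  finally show "fourier (tensor g) x = tensor (\<lambda>b. fourier_real (g b)) x" .
qed

text \<open>The class \<open>T\<close> is closed under partial derivatives, because differentiating
  a product along a basis vector \<open>e\<close> only replaces the factor at \<open>e\<close> by
  its derivative. Differences are the right class since the support argument tests with two products
  that agree near the spectrum.\<close>

lemma smooth_tensor_diff:
  fixes g h :: "'a::euclidean_space \<Rightarrow> real \<Rightarrow> complex"
  assumes "\<And>b. b \<in> Basis \<Longrightarrow> smooth_real (g b)" "\<And>b. b \<in> Basis \<Longrightarrow> smooth_real (h b)"
  shows "smooth (\<lambda>x. tensor g x - tensor h x)"
proof -
  define T where "T = {\<lambda>x. tensor g x - tensor h x | g h :: 'a \<Rightarrow> real \<Rightarrow> complex.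
    (\<forall>b\<in>Basis. smooth_real (g b)) \<and> (\<forall>b\<in>Basis. smooth_real (h b))}"
  have deriv: "\<exists>g'. (\<forall>b\<in>Basis. smooth_real (g' b)) \<and>
      (\<exists>D. \<forall>x. (tensor g has_derivative D x) (at x) \<and> D x e = tensor g' x)"
    if g: "\<forall>b\<in>Basis. smooth_real (g b)" and e: "e \<in> Basis" for g and e :: 'a
  proof -
    have "\<forall>b. \<exists>d. b \<in> Basis \<longrightarrow> (\<forall>x. (g b has_vector_derivative d x) (at x)) \<and> smooth_real d"
      using g smooth_realE by metis
    then obtain d where d: "\<And>b x. b \<in> Basis \<Longrightarrow> (g b has_vector_derivative d b x) (at x)"
      "\<And>b. b \<in> Basis \<Longrightarrow> smooth_real (d b)" by metis
    define D where "D x y = (\<Sum>i\<in>Basis. ((y \<bullet> i) *\<^sub>R d i (x \<bullet> i)) * (\<Prod>j\<in>Basis - {i}. g j (x \<bullet> j)))" for x y :: 'a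
    have "(tensor g has_derivative D x) (at x)" for x
      unfolding tensor_def D_def
    proof (rule has_derivative_prod)
      fix b :: 'a assume b: "b \<in> Basis"
      have "((\<lambda>x. x \<bullet> b) has_derivative (\<lambda>y. y \<bullet> b)) (at x)"
        by (auto intro!: derivative_eq_intros)
      from has_derivative_compose[OF this d(1)[OF b, unfolded has_vector_derivative_def]]
      show "((\<lambda>x. g b (x \<bullet> b)) has_derivative (\<lambda>y. (y \<bullet> b) *\<^sub>R d b (x \<bullet> b))) (at x)" .
    qed
    moreover have "D x e = tensor (g(e := d e)) x" for x
    proof -
      have "D x e = (\<Sum>i\<in>Basis. if i = e then d e (x \<bullet> e) * (\<Prod>j\<in>Basis - {e}. g j (x \<bullet> j)) else 0)"
        unfolding D_def using e by (intro sum.cong refl) (auto simp: inner_Basis)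
      also have "\<dots> = d e (x \<bullet> e) * (\<Prod>j\<in>Basis - {e}. g j (x \<bullet> j))"
        using e by (simp add: sum.delta)
      also have "\<dots> = tensor (g(e := d e)) x"
        unfolding tensor_def using e by (subst prod.remove[of _ e]) (auto intro!: prod.cong)
      finally show ?thesis .
    qed
    moreover have "\<forall>b\<in>Basis. smooth_real ((g(e := d e)) b)"
      using g d e by auto
    ultimately show ?thesis by blast
  qed
  have step: "\<exists>\<psi>\<in>T. \<exists>D. \<forall>x. (\<phi> has_derivative D x) (at x) \<and> D x e = \<psi> x"
    if "\<phi> \<in> T" and e: "e \<in> Basis" for \<phi> e
  proof -
    from that obtain g h where \<phi>: "\<phi> = (\<lambda>x. tensor g x - tensor h x)"
      and gh: "\<forall>b\<in>Basis. smooth_real (g b)" "\<forall>b\<in>Basis. smooth_real (h b)"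
      unfolding T_def by blast
    obtain g' D where g': "\<forall>b\<in>Basis. smooth_real (g' b)"
      "\<And>x. (tensor g has_derivative D x) (at x)" "\<And>x. D x e = tensor g' x"
      using deriv[OF gh(1) e] by blast
    obtain h' E where h': "\<forall>b\<in>Basis. smooth_real (h' b)"
      "\<And>x. (tensor h has_derivative E x) (at x)" "\<And>x. E x e = tensor h' x"
      using deriv[OF gh(2) e] by blast
    have "(\<lambda>x. tensor g' x - tensor h' x) \<in> T"
      unfolding T_def using g' h' by blast
    moreover have "(\<phi> has_derivative (\<lambda>y. D x y - E x y)) (at x)" for x
      unfolding \<phi> by (intro has_derivative_diff g' h')
    ultimately show ?thesis
      using g'(3) h'(3) by (intro bexI[of _ "\<lambda>x. tensor g' x - tensor h' x"] exI[of _ "\<lambda>x y. D x y - E x y"]) auto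
  qed
  have "partials es \<phi> \<in> T" if "\<phi> \<in> T" "set es \<subseteq> Basis" for es \<phi>
    using that(2)
  proof (induction es)
    case Nil
    then show ?case using that by simp
  next
    case (Cons e es)
    then obtain \<psi> D where \<psi>: "\<psi> \<in> T" "\<And>x. (partials es \<phi> has_derivative D x) (at x)" "\<And>x. D x e = \<psi> x"
      using step[of "partials es \<phi>" e] by auto
    have "partials (e # es) \<phi> = \<psi>"
      by (simp add: fun_eq_iff frechet_derivative_at[OF \<psi>(2), symmetric] \<psi>(3))
    with \<psi> show ?case by simp
  qed
  moreover have "(\<lambda>x. tensor g x - tensor h x) \<in> T"
    using assms unfolding T_def by blast
  \<comment> \<open>Applying \<open>step\<close> along any one basis vector already produces the
    total derivative.\<close>
  moreover have "\<phi> differentiable (at x)" if "\<phi> \<in> T" for \<phi> x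
    using step[OF that SOME_Basis] unfolding differentiable_def by blast
  ultimately show ?thesis
    unfolding smooth_def by blast
qed

section \<open>Non-vanishing of the integral of the kernel\<close>

lemma compact_smooth_cutoff: "compact_smooth (\<lambda>x. of_real (cutoff x))"
  unfolding compact_smooth_def using smooth_real_cutoff cutoff_eq_0 by (auto intro!: exI[of _ 3])

text \<open>The characteristic function of the standard normal law at
  \<open>- (2 * pi * \<xi> / s)\<close>, after the substitution x -> s x.\<close>

lemma integral_std_normal_fourier:
  assumes "s > 0"
  shows "(\<integral>x. exp (- 2 * complex_of_real pi * \<i> * complex_of_real (x * \<xi>)) * of_real (std_normal_density (s * x)) \<partial>lborel)
    = of_real (exp (- ((2 * pi * \<xi> / s)\<^sup>2) / 2) / s)"
proof -
  have "complex_of_real (exp (- ((2 * pi * \<xi> / s)\<^sup>2) / 2)) = char std_normal_distribution (- (2 * pi * \<xi> / s))"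
    by (simp add: char_std_normal_distribution)
  also have "\<dots> = (\<integral>x. of_real (std_normal_density x) * exp (\<i> * of_real (- (2 * pi * \<xi> / s) * x)) \<partial>lborel)"
    unfolding char_def by (subst integral_density) (auto simp: scaleR_conv_of_real)
  also have "\<dots> = \<bar>s\<bar> *\<^sub>R (\<integral>x. of_real (std_normal_density (0 + s * x)) * exp (\<i> * of_real (- (2 * pi * \<xi> / s) * (0 + s * x))) \<partial>lborel)"
    using assms by (intro lborel_integral_real_affine) auto
  also have "\<dots> = of_real s * (\<integral>x. exp (- 2 * complex_of_real pi * \<i> * complex_of_real (x * \<xi>)) * of_real (std_normal_density (s * x)) \<partial>lborel)"
    using assms by (simp add: scaleR_conv_of_real mult_ac)
  finally show ?thesis using assms by (simp add: field_simps)
qed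

lemma integrable_std_normal_scaled: "s \<noteq> 0 \<Longrightarrow> integrable lborel (\<lambda>x. std_normal_density (s * x))"
  using lborel_integrable_real_affine[of std_normal_density s 0] by simp

text \<open>Only non-vanishing is needed, so testing against wide Gaussians replaces Fourier inversion.\<close>

lemma integral_fourier_cutoff_nonzero:
  "(\<integral>x. fourier_real (\<lambda>\<xi>. of_real (cutoff \<xi>)) x \<partial>lborel) \<noteq> 0"
proof -
  define g where "g = (\<lambda>\<xi>. complex_of_real (cutoff \<xi>))"
  have g: "compact_smooth g" unfolding g_def by (rule compact_smooth_cutoff)
  have [measurable]: "g \<in> borel_measurable borel" using g by measurable
  note [measurable] = borel_measurable_fourier_real
  define E where "E u = exp (- ((2 * pi * u)\<^sup>2) / 2)" for u :: real
  have E_eq: "E u = sqrt (2 * pi) * std_normal_density (2 * pi * u)" for u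
    by (simp add: E_def std_normal_density_def real_sqrt_mult)
  have E_int: "integrable lborel E"
    unfolding E_eq[abs_def] by (intro integrable_mult_right integrable_std_normal_scaled) simp
  have [measurable]: "E \<in> borel_measurable borel" using E_int by auto
  \<comment> \<open>Fubini moves the Fourier transform from \<open>g\<close> to the Gaussian; the
    substitution \<open>\<xi> = s * u\<close> then absorbs the factor 1/s.\<close>
  have mult_formula: "(\<integral>x. fourier_real g x * of_real (std_normal_density (s * x)) \<partial>lborel)
      = (\<integral>u. g (s * u) * of_real (E u) \<partial>lborel)" if s: "s > 0" for s
  proof -
    define F where "F x \<xi> = exp (- 2 * complex_of_real pi * \<i> * complex_of_real (x * \<xi>)) * g \<xi>
        * of_real (std_normal_density (s * x))" for x \<xi>
    have "integrable (lborel \<Otimes>\<^sub>M lborel) (case_prod F)"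
    proof (rule lborel_pair.Fubini_integrable)
      have "(\<integral>y. norm (F x y) \<partial>lborel) = (\<integral>y. norm (g y) \<partial>lborel) * std_normal_density (s * x)" for x
        by (simp add: F_def norm_mult norm_exp_eq_Re)
      then show "integrable lborel (\<lambda>x. \<integral>y. norm (case_prod F (x, y)) \<partial>lborel)"
        using s by (simp add: integrable_std_normal_scaled)
      show "AE x in lborel. integrable lborel (\<lambda>y. case_prod F (x, y))"
        unfolding F_def prod.case
        by (rule AE_I2, rule integrable_mult_left, rule integrable_fourier_character_mult)
           (rule compact_smooth_integrable[OF g])
    qed (unfold F_def, measurable)
    then have "(\<integral>x. (\<integral>\<xi>. F x \<xi> \<partial>lborel) \<partial>lborel) = (\<integral>\<xi>. (\<integral>x. F x \<xi> \<partial>lborel) \<partial>lborel)"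
      by (rule lborel_pair.Fubini_integral[symmetric])
    moreover have "(\<integral>\<xi>. F x \<xi> \<partial>lborel) = fourier_real g x * of_real (std_normal_density (s * x))" for x
      unfolding F_def fourier_real_def by (rule integral_mult_left_zero)
    moreover have "(\<integral>x. F x \<xi> \<partial>lborel) = g \<xi> * of_real (E (\<xi> / s) / s)" for \<xi>
    proof -
      have "(\<integral>x. F x \<xi> \<partial>lborel) = g \<xi> * (\<integral>x. exp (- 2 * complex_of_real pi * \<i> * complex_of_real (x * \<xi>))
          * of_real (std_normal_density (s * x)) \<partial>lborel)"
        unfolding F_def by (subst integral_mult_right_zero[symmetric]) (simp only: mult_ac)
      then show ?thesis
        by (simp only: integral_std_normal_fourier[OF s] E_def times_divide_eq_right)
    qed
    moreover have "(\<integral>\<xi>. g \<xi> * of_real (E (\<xi> / s) / s) \<partial>lborel)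
        = \<bar>s\<bar> *\<^sub>R (\<integral>\<xi>. g (0 + s * \<xi>) * of_real (E ((0 + s * \<xi>) / s) / s) \<partial>lborel)"
      using s by (intro lborel_integral_real_affine) auto
    ultimately show ?thesis
      using s by (simp add: scaleR_conv_of_real)
  qed
  \<comment> \<open>As the scale tends to 0 the Gaussian flattens to its value at 0 on one side of
    \<open>mult_formula\<close>, while on the other side \<open>g (s * u)\<close> tends to
    \<open>g 0\<close>, which is 1. So the integral of the transform is a nonzero multiple of the
    integral of \<open>E\<close>.\<close>
  define s where "s k = inverse (real (Suc k))" for k
  have s0: "s \<longlonglongrightarrow> 0" unfolding s_def by (rule LIMSEQ_inverse_real_of_nat)
  have s_pos: "s k > 0" for k by (simp add: s_def)
  have "(\<lambda>k. \<integral>x. fourier_real g x * of_real (std_normal_density (s k * x)) \<partial>lborel)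
      \<longlonglongrightarrow> (\<integral>x. fourier_real g x * of_real (std_normal_density 0) \<partial>lborel)"
  proof (rule integral_dominated_convergence)
    show "integrable lborel (\<lambda>x. norm (fourier_real g x))"
      using integrable_fourier_real[OF g] by simp
    have "isCont std_normal_density 0"
      unfolding std_normal_density_def by (intro continuous_intros) auto
    then show "AE x in lborel. (\<lambda>k. fourier_real g x * of_real (std_normal_density (s k * x)))
        \<longlonglongrightarrow> fourier_real g x * of_real (std_normal_density 0)"
      by (intro AE_I2 tendsto_intros isCont_tendsto_compose[of 0 std_normal_density])
         (auto intro!: tendsto_eq_intros s0)
    have "std_normal_density x \<le> 1" for x
    proof -
      have "exp (- x\<^sup>2 / 2) \<le> sqrt (2 * pi)"
        by (rule order_trans[of _ 1]) (use pi_gt3 in auto)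
      then show ?thesis by (simp add: std_normal_density_def field_simps)
    qed
    then show "AE x in lborel. norm (fourier_real g x * of_real (std_normal_density (s k * x))) \<le> norm (fourier_real g x)" for k
      by (auto simp: norm_mult mult_left_le)
  qed auto
  moreover have "(\<lambda>k. \<integral>u. g (s k * u) * of_real (E u) \<partial>lborel) \<longlonglongrightarrow> (\<integral>u. g 0 * of_real (E u) \<partial>lborel)"
  proof (rule integral_dominated_convergence)
    have "cutoff x \<le> 1" for x
    proof -
      have "smooth_step y \<le> 1" for y
        using smooth_step_denom_pos[of y] flat_exp_1_nonneg[of "1 - y"] by (simp add: smooth_step_def)
      then show ?thesis
        unfolding cutoff_def by (intro mult_le_one smooth_step_nonneg) auto
    qed
    then have "norm (g x) \<le> 1" for x
      by (simp add: g_def cutoff_nonneg)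
    then show "AE u in lborel. norm (g (s k * u) * of_real (E u)) \<le> E u" for k
      by (auto simp: norm_mult E_def intro!: mult_left_le_one_le)
    have "isCont g 0"
      using compact_smooth_continuous[OF g] by (simp add: continuous_on_eq_continuous_at)
    then show "AE u in lborel. (\<lambda>k. g (s k * u) * of_real (E u)) \<longlonglongrightarrow> g 0 * of_real (E u)"
      by (intro AE_I2 tendsto_intros isCont_tendsto_compose[of 0 g])
         (auto intro!: tendsto_eq_intros s0)
  qed (use E_int in auto)
  ultimately have "(\<integral>x. fourier_real g x * of_real (std_normal_density 0) \<partial>lborel) = (\<integral>u. g 0 * of_real (E u) \<partial>lborel)"
    unfolding mult_formula[OF s_pos] by (rule LIMSEQ_unique)
  also have "\<dots> = of_real (integral\<^sup>L lborel E)"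
    by (simp add: g_def cutoff_eq_1)
  finally have "(\<integral>x. fourier_real g x * of_real (std_normal_density 0) \<partial>lborel) = of_real (integral\<^sup>L lborel E)" .
  moreover have "integral\<^sup>L lborel E \<noteq> 0"
  proof -
    have "1 = integral\<^sup>L lborel std_normal_density" by simp
    also have "\<dots> = \<bar>2 * pi\<bar> *\<^sub>R (\<integral>x. std_normal_density (0 + 2 * pi * x) \<partial>lborel)"
      by (intro lborel_integral_real_affine) simp
    finally show ?thesis unfolding E_eq[abs_def] by auto
  qed
  ultimately show ?thesis
    unfolding g_def by auto
qed

section \<open>Product test functions and the spectrum\<close>

text \<open>Above height \<open>s\<close> the full modulus is kept, without subtracting
  \<open>s\<close>. Integrability of this part places \<open>f\<close> in L^1 plus L^infinity,
  enough for pairing with integrable bounded kernels.\<close>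

definition large_part :: "real \<Rightarrow> ('a \<Rightarrow> complex) \<Rightarrow> 'a \<Rightarrow> real" where
  "large_part s f x = (if s < norm (f x) then norm (f x) else 0)"

lemma large_part_nonneg: "0 \<le> large_part s f x"
  by (simp add: large_part_def)

lemma norm_le_large_part: "0 \<le> s \<Longrightarrow> norm (f x) \<le> large_part s f x + s"
  by (simp add: large_part_def)

text \<open>The large part of \<open>f\<close> meets the supremum of the kernel and the remainder,
  at most \<open>s\<close>, meets its L^1 norm. For the kernel R^n H(R x) these are of order R^n and
  1 respectively, which fixes the shape of the final bound.\<close>

lemma
  fixes f k :: "'a::euclidean_space \<Rightarrow> complex"
  assumes [measurable]: "f \<in> borel_measurable borel" and s: "0 \<le> s"
    and f: "integrable lborel (large_part s f)" and k: "integrable lborel k"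
    and D: "\<And>x. norm (k x) \<le> D"
  shows integrable_mult_bounded: "integrable lborel (\<lambda>x. f x * k x)"
    and norm_integral_mult_le: "norm (\<integral>x. f x * k x \<partial>lborel)
      \<le> D * (\<integral>x. large_part s f x \<partial>lborel) + s * (\<integral>x. norm (k x) \<partial>lborel)"
proof -
  have [measurable]: "k \<in> borel_measurable borel" using k by auto
  have le: "norm (f x * k x) \<le> D * large_part s f x + s * norm (k x)" for x
  proof -
    have "norm (f x * k x) \<le> (large_part s f x + s) * norm (k x)"
      unfolding norm_mult by (intro mult_right_mono norm_le_large_part s) auto
    also have "\<dots> \<le> D * large_part s f x + s * norm (k x)"
      using mult_right_mono[OF D large_part_nonneg] by (simp add: algebra_simps)
    finally show ?thesis .
  qed
  have int: "integrable lborel (\<lambda>x. D * large_part s f x + s * norm (k x))"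
    using f k by auto
  show 1: "integrable lborel (\<lambda>x. f x * k x)"
    by (rule Bochner_Integration.integrable_bound[OF int])
       (auto intro!: AE_I2 order_trans[OF le])
  have "norm (\<integral>x. f x * k x \<partial>lborel) \<le> (\<integral>x. D * large_part s f x + s * norm (k x) \<partial>lborel)"
    by (rule Bochner_Integration.integral_norm_bound_integral[OF 1 int]) (rule le)
  also have "\<dots> = D * (\<integral>x. large_part s f x \<partial>lborel) + s * (\<integral>x. norm (k x) \<partial>lborel)"
    using f k by simp
  finally show "norm (\<integral>x. f x * k x \<partial>lborel)
      \<le> D * (\<integral>x. large_part s f x \<partial>lborel) + s * (\<integral>x. norm (k x) \<partial>lborel)" .
qed

lemma tensor_bounded:
  fixes g :: "'a::euclidean_space \<Rightarrow> real \<Rightarrow> complex"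
  assumes "\<And>b. b \<in> Basis \<Longrightarrow> \<exists>C. \<forall>x. norm (g b x) \<le> C"
  shows "\<exists>D. \<forall>x. norm (tensor g x) \<le> D"
proof -
  obtain C where C: "\<And>b x. b \<in> Basis \<Longrightarrow> norm (g b x) \<le> C b"
    using assms by metis
  have "norm (tensor g x) \<le> (\<Prod>b\<in>Basis. C b)" for x
    unfolding tensor_def prod_norm[symmetric] by (intro prod_mono) (auto intro: C)
  then show ?thesis by blast
qed

lemma fourier_real_bounded:
  assumes "compact_smooth g"
  shows "\<exists>C. \<forall>x. norm (fourier_real g x) \<le> C"
  using norm_fourier_real_le[OF compact_smooth_integrable[OF assms]] by blast

lemma fourier_tensor_diff:
  fixes g h :: "'a::euclidean_space \<Rightarrow> real \<Rightarrow> complex"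
  assumes g: "\<And>b. b \<in> Basis \<Longrightarrow> compact_smooth (g b)" and h: "\<And>b. b \<in> Basis \<Longrightarrow> compact_smooth (h b)"
  shows "fourier (\<lambda>x. tensor g x - tensor h x) x = fourier (tensor g) x - fourier (tensor h) x"
proof -
  have int: "integrable lebesgue (\<lambda>\<xi>. exp (- 2 * complex_of_real pi * \<i> * complex_of_real (\<xi> \<bullet> x)) * tensor k \<xi>)"
    if k: "\<And>b. b \<in> Basis \<Longrightarrow> compact_smooth (k b)" for k
  proof -
    have k_int: "integrable lborel (tensor k)"
      by (intro integrable_tensor compact_smooth_integrable k)
    then have "integrable lborel (\<lambda>\<xi>. exp (- 2 * complex_of_real pi * \<i> * complex_of_real (\<xi> \<bullet> x)) * tensor k \<xi>)"
      by (rule Bochner_Integration.integrable_bound)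
         (use k_int in \<open>auto simp: norm_mult norm_exp_eq_Re\<close>)
    then show ?thesis by (subst integrable_completion) auto
  qed
  show ?thesis
    unfolding fourier_def right_diff_distrib by (intro Bochner_Integration.integral_diff int g h)
qed

text \<open>Borel rather than Lebesgue measurability lets \<open>f\<close> enter Fubini's theorem on
  products; a general \<open>f\<close> is replaced by a Borel version only at the level of
  rearrangements.\<close>

locale l1_plus_bounded =
  fixes f :: "'a::euclidean_space \<Rightarrow> complex" and s :: real
  assumes borel [measurable]: "f \<in> borel_measurable borel" and s_nonneg: "0 \<le> s"
    and integrable_large_part: "integrable lborel (large_part s f)"
begin

lemma integrable_mult_fourier_tensor:
  assumes "\<And>b. b \<in> Basis \<Longrightarrow> compact_smooth (g b)"
  shows "integrable lborel (\<lambda>x. f x * tensor (\<lambda>b. fourier_real (g b)) x)"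
proof -
  obtain D where D: "\<And>x. norm (tensor (\<lambda>b. fourier_real (g b)) x) \<le> D"
    using tensor_bounded fourier_real_bounded assms by metis
  show ?thesis
    by (rule integrable_mult_bounded[OF borel s_nonneg integrable_large_part _ D])
       (intro integrable_tensor integrable_fourier_real assms)
qed

lemma fourier_distr_tensor:
  assumes g: "\<And>b. b \<in> Basis \<Longrightarrow> compact_smooth (g b)"
  shows "fourier_distr (distr_of f) (tensor g) = (\<integral>x. f x * tensor (\<lambda>b. fourier_real (g b)) x \<partial>lborel)"
proof -
  have "tensor (\<lambda>b. fourier_real (g b)) \<in> borel_measurable borel"
    using g by (intro borel_measurable_tensor borel_measurable_fourier_real compact_smooth_borel)
  moreover have "fourier (tensor g) = tensor (\<lambda>b. fourier_real (g b))"
    by (rule fourier_tensor) (rule g)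
  ultimately show ?thesis
    unfolding fourier_distr_def distr_of_def by (auto intro!: integral_completion)
qed

lemma fourier_distr_tensor_diff:
  assumes g: "\<And>b. b \<in> Basis \<Longrightarrow> compact_smooth (g b)" and h: "\<And>b. b \<in> Basis \<Longrightarrow> compact_smooth (h b)"
  shows "fourier_distr (distr_of f) (\<lambda>x. tensor g x - tensor h x)
    = fourier_distr (distr_of f) (tensor g) - fourier_distr (distr_of f) (tensor h)"
proof -
  have int: "integrable lebesgue (\<lambda>x. f x * fourier (tensor k) x)"
    if k: "\<And>b. b \<in> Basis \<Longrightarrow> compact_smooth (k b)" for k
  proof -
    have "fourier (tensor k) = tensor (\<lambda>b. fourier_real (k b))"
      by (rule fourier_tensor) (rule k)
    moreover have "integrable lborel (\<lambda>x. f x * tensor (\<lambda>b. fourier_real (k b)) x)"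
      by (rule integrable_mult_fourier_tensor) (rule k)
    ultimately show ?thesis by (subst integrable_completion) auto
  qed
  have "fourier (\<lambda>x. tensor g x - tensor h x) x = fourier (tensor g) x - fourier (tensor h) x" for x
    by (rule fourier_tensor_diff) (auto intro: g h)
  then show ?thesis
    unfolding fourier_distr_def distr_of_def right_diff_distrib
    by (simp add: right_diff_distrib int g h)
qed

text \<open>The partition of unity is inserted in every one-variable factor before transforming.
  Expanding the product of sums on the Fourier side gives one term for each choice \<open>k\<close>
  of a bump per coordinate.\<close>

lemma fourier_distr_tensor_partition:
  assumes g: "\<And>b. b \<in> Basis \<Longrightarrow> compact_smooth (g b)"
    and W: "\<And>j. smooth_real (W j)" and J: "finite J"
    and part: "\<And>b x. b \<in> Basis \<Longrightarrow> g b x \<noteq> 0 \<Longrightarrow> (\<Sum>j\<in>J. W j x) = 1"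
  shows "fourier_distr (distr_of f) (tensor g)
    = (\<Sum>k\<in>PiE Basis (\<lambda>_. J). fourier_distr (distr_of f) (tensor (\<lambda>b x. W (k b) x * g b x)))"
proof -
  have Wg: "compact_smooth (\<lambda>x. W j x * g b x)" if "b \<in> Basis" for b j
    using g[OF that] W[of j] unfolding compact_smooth_def
    by (auto intro!: smooth_real_mult)
  have eq1: "fourier_real (g b) x = (\<Sum>j\<in>J. fourier_real (\<lambda>x. W j x * g b x) x)" if b: "b \<in> Basis" for b x
  proof -
    have "g b \<xi> = (\<Sum>j\<in>J. W j \<xi> * g b \<xi>)" for \<xi>
      using part[OF b, of \<xi>] by (cases "g b \<xi> = 0") (simp_all add: sum_distrib_right[symmetric])
    then have "fourier_real (g b) x = fourier_real (\<lambda>\<xi>. \<Sum>j\<in>J. W j \<xi> * g b \<xi>) x"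
      by presburger
    also have "\<dots> = (\<Sum>j\<in>J. fourier_real (\<lambda>x. W j x * g b x) x)"
      unfolding fourier_real_def sum_distrib_left
      by (intro Bochner_Integration.integral_sum integrable_fourier_character_mult compact_smooth_integrable Wg b)
    finally show ?thesis .
  qed
  have eq: "tensor (\<lambda>b. fourier_real (g b)) x
      = (\<Sum>k\<in>PiE Basis (\<lambda>_. J). tensor (\<lambda>b. fourier_real (\<lambda>x. W (k b) x * g b x)) x)" for x
  proof -
    have "tensor (\<lambda>b. fourier_real (g b)) x = (\<Prod>b\<in>Basis. \<Sum>j\<in>J. fourier_real (\<lambda>x. W j x * g b x) (x \<bullet> b))"
      unfolding tensor_def by (intro prod.cong refl eq1)
    also have "\<dots> = (\<Sum>k\<in>PiE Basis (\<lambda>_. J). tensor (\<lambda>b. fourier_real (\<lambda>x. W (k b) x * g b x)) x)"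
      unfolding tensor_def by (rule prod_sum_PiE) (use J in auto)
    finally show ?thesis .
  qed
  have "fourier_distr (distr_of f) (tensor g)
      = (\<integral>x. (\<Sum>k\<in>PiE Basis (\<lambda>_. J). f x * tensor (\<lambda>b. fourier_real (\<lambda>x. W (k b) x * g b x)) x) \<partial>lborel)"
    by (simp add: fourier_distr_tensor[OF g] eq sum_distrib_left)
  also have "\<dots> = (\<Sum>k\<in>PiE Basis (\<lambda>_. J). \<integral>x. f x * tensor (\<lambda>b. fourier_real (\<lambda>x. W (k b) x * g b x)) x \<partial>lborel)"
    by (intro Bochner_Integration.integral_sum integrable_mult_fourier_tensor Wg)
  also have "\<dots> = (\<Sum>k\<in>PiE Basis (\<lambda>_. J). fourier_distr (distr_of f) (tensor (\<lambda>b x. W (k b) x * g b x)))"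
    by (intro sum.cong refl fourier_distr_tensor[symmetric] Wg)
  finally show ?thesis .
qed

text \<open>A lattice of small product bumps, fine enough for every cell meeting the region where
  \<open>g\<close> and \<open>h\<close> differ to lie in a single open set on which the distribution vanishes, keeps all
  test functions in the class of differences of two product functions.\<close>

lemma fourier_distr_tensor_cong:
  assumes supp: "distr_support (fourier_distr (distr_of f)) \<subseteq> cball 0 R" and R: "R < R'"
    and g: "\<And>b. b \<in> Basis \<Longrightarrow> compact_smooth (g b)" and h: "\<And>b. b \<in> Basis \<Longrightarrow> compact_smooth (h b)"
    and eq: "\<And>\<xi>. norm \<xi> < R' \<Longrightarrow> tensor g \<xi> = tensor h \<xi>"
  shows "fourier_distr (distr_of f) (tensor g) = fourier_distr (distr_of f) (tensor h)"
proof -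
  define L where "L = fourier_distr (distr_of f)"
  define \<U> where "\<U> = {U::'a set. open U \<and> (\<forall>\<phi>\<in>test_functions U. L \<phi> = 0)}"
  have cover: "- cball 0 R \<subseteq> \<Union>\<U>"
    using supp unfolding distr_support_def \<U>_def L_def by blast
  have "\<exists>\<rho>. \<forall>b x. b \<in> Basis \<longrightarrow> \<rho> \<le> \<bar>x\<bar> \<longrightarrow> k b x = 0"
    if k: "\<And>b. b \<in> Basis \<Longrightarrow> compact_smooth (k b)" for k :: "'a \<Rightarrow> real \<Rightarrow> complex"
  proof -
    obtain l where l: "\<And>b x. b \<in> Basis \<Longrightarrow> l b \<le> \<bar>x\<bar> \<Longrightarrow> k b x = 0"
      using k unfolding compact_smooth_def by metis
    have "l b \<le> (\<Sum>b\<in>Basis. \<bar>l b\<bar>)" if "b \<in> Basis" for b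
      by (rule order_trans[OF abs_ge_self]) (use that in \<open>auto intro!: member_le_sum\<close>)
    with l show ?thesis by (meson order_trans)
  qed
  from this[of g, OF g] this[of h, OF h] obtain \<rho>1 \<rho>2 where
    "\<And>b x. b \<in> Basis \<Longrightarrow> \<rho>1 \<le> \<bar>x\<bar> \<Longrightarrow> g b x = 0" "\<And>b x. b \<in> Basis \<Longrightarrow> \<rho>2 \<le> \<bar>x\<bar> \<Longrightarrow> h b x = 0"
    by blast
  then obtain \<rho> where \<rho>: "\<rho> > 0" "\<And>b x. b \<in> Basis \<Longrightarrow> \<rho> \<le> \<bar>x\<bar> \<Longrightarrow> g b x = 0 \<and> h b x = 0"
    using that[of "max 1 (max \<rho>1 \<rho>2)"] by auto
  \<comment> \<open>A compact set containing every point where the two products differ: they agree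
    on the ball of radius \<open>R'\<close>, and both vanish outside the box.\<close>
  define K where "K = {\<xi>::'a. R' \<le> norm \<xi>} \<inter> cbox (- \<rho> *\<^sub>R One) (\<rho> *\<^sub>R One)"
  have K: "compact K"
    unfolding K_def by (intro closed_Int_compact compact_cbox closed_Collect_le continuous_intros)
  have "K \<subseteq> \<Union>\<U>"
    using cover R unfolding K_def by (auto simp: subset_iff)
  \<comment> \<open>\<open>e\<close> is a Lebesgue number of the cover of \<open>K\<close> by open
    sets on which the distribution vanishes.\<close>
  then obtain e where e: "e > 0" "\<And>x. x \<in> K \<Longrightarrow> \<exists>U\<in>\<U>. ball x e \<subseteq> U"
    using Heine_Borel_lemma[OF K] unfolding \<U>_def by (metis (no_types, lifting) mem_Collect_eq)
  \<comment> \<open>The support of a bump at mesh \<open>\<delta>\<close> has length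
    \<open>2 * \<delta>\<close>, so two points of a cell differ by at most
    \<open>2 * \<delta> * DIM('a) = e / 2\<close> in the l^1 norm. The cell thus fits into a ball of
    radius \<open>e\<close> about any of its points.\<close>
  define \<delta> where "\<delta> = e / (4 * real DIM('a))"
  have \<delta>: "\<delta> > 0" using e by (simp add: \<delta>_def)
  obtain N where N: "\<rho> / \<delta> \<le> real N"
    using real_arch_simple by blast
  define J where "J = {..<2 * N + 1}"
  define W where "W j x = complex_of_real (lattice_bump (x / \<delta> + real N - real j))" for j :: nat and x
  have W: "smooth_real (W j)" for j
  proof -
    have "smooth_real (\<lambda>x. complex_of_real (lattice_bump ((1 / \<delta>) * x + (real N - real j))))"
      using smooth_real_affine[OF smooth_real_lattice_bump] .
    then show ?thesis by (simp add: W_def[abs_def] algebra_simps)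
  qed
  have sumW: "(\<Sum>j\<in>J. W j x) = 1" if "\<bar>x\<bar> \<le> \<rho>" for x
  proof -
    have "\<bar>x / \<delta>\<bar> \<le> real N"
      using that \<delta> N by (simp add: field_simps)
    from sum_lattice_bump[OF this] show ?thesis
      unfolding W_def J_def by (metis of_real_sum of_real_1)
  qed
  have part: "(\<Sum>j\<in>J. W j x) = 1" if "b \<in> Basis" "g b x \<noteq> 0 \<or> h b x \<noteq> 0" for b x
    using \<rho>(2)[OF that(1), of x] that(2) by (intro sumW) force
  have vanish: "L (tensor (\<lambda>b x. W (k b) x * g b x)) = L (tensor (\<lambda>b x. W (k b) x * h b x))" for k
  proof -
    define \<phi> where "\<phi> = (\<lambda>\<xi>. tensor (\<lambda>b x. W (k b) x * g b x) \<xi> - tensor (\<lambda>b x. W (k b) x * h b x) \<xi>)"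
    \<comment> \<open>The cell indexed by \<open>k\<close>, cut down to \<open>K\<close>. Being
      closed, it contains the closure of the set where \<open>\<phi>\<close> is nonzero.\<close>
    define Q where "Q = K \<inter> (\<Inter>b\<in>Basis. {\<xi>. \<bar>(\<xi> \<bullet> b) / \<delta> + real N - real (k b)\<bar> \<le> 1})"
    have Wg: "compact_smooth (\<lambda>x. W j x * g b x)" "compact_smooth (\<lambda>x. W j x * h b x)" if "b \<in> Basis" for b j
      using g[OF that] h[OF that] W[of j] unfolding compact_smooth_def
      by (auto intro!: smooth_real_mult)
    have \<phi>_eq: "\<phi> \<xi> = tensor (\<lambda>b. W (k b)) \<xi> * (tensor g \<xi> - tensor h \<xi>)" for \<xi>
      by (simp add: \<phi>_def tensor_def prod.distrib algebra_simps)
    have sub: "{\<xi>. \<phi> \<xi> \<noteq> 0} \<subseteq> Q"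
    proof
      fix \<xi> assume "\<xi> \<in> {\<xi>. \<phi> \<xi> \<noteq> 0}"
      then have nz: "tensor (\<lambda>b. W (k b)) \<xi> \<noteq> 0" "tensor g \<xi> \<noteq> tensor h \<xi>"
        by (auto simp: \<phi>_eq)
      have "R' \<le> norm \<xi>" using nz(2) eq by force
      moreover have "\<bar>(\<xi> \<bullet> b) / \<delta> + real N - real (k b)\<bar> \<le> 1" if "b \<in> Basis" for b
      proof (rule ccontr)
        assume "\<not> \<bar>(\<xi> \<bullet> b) / \<delta> + real N - real (k b)\<bar> \<le> 1"
        then have "W (k b) (\<xi> \<bullet> b) = 0" by (simp add: W_def lattice_bump_eq_0)
        with nz(1) that show False by (auto simp: tensor_def)
      qed
      moreover have "\<bar>\<xi> \<bullet> b\<bar> \<le> \<rho>" if b: "b \<in> Basis" for b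
      proof (rule ccontr)
        assume "\<not> \<bar>\<xi> \<bullet> b\<bar> \<le> \<rho>"
        then have "g b (\<xi> \<bullet> b) = 0" "h b (\<xi> \<bullet> b) = 0" using \<rho>(2)[OF b] by auto
        with b have "tensor g \<xi> = 0" "tensor h \<xi> = 0"
          unfolding tensor_def by (auto simp: prod_zero_iff)
        with nz(2) show False by simp
      qed
      ultimately show "\<xi> \<in> Q"
        unfolding Q_def K_def by (auto simp: mem_box abs_le_iff minus_le_iff)
    qed
    have Q: "compact Q"
      unfolding Q_def using K
      by (intro compact_Int_closed closed_INT ballI closed_Collect_le continuous_intros) (use \<delta> in auto)
    have clos: "closure {\<xi>. \<phi> \<xi> \<noteq> 0} \<subseteq> Q"
      using sub Q by (simp add: closure_minimal compact_imp_closed)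
    have "L \<phi> = 0"
    proof (cases "Q = {}")
      case True
      with sub have "\<phi> = (\<lambda>_. 0)" by auto
      then show ?thesis
        by (simp add: L_def fourier_distr_def distr_of_def fourier_def)
    next
      case False
      \<comment> \<open>Any point of the cell lies in \<open>K\<close>, so its
        \<open>e\<close>-ball, and with it the whole cell, sits inside a single vanishing set
        \<open>U\<close>.\<close>
      then obtain x where x: "x \<in> Q" by blast
      then obtain U where U: "U \<in> \<U>" "ball x e \<subseteq> U"
        using e(2)[of x] unfolding Q_def by blast
      have "Q \<subseteq> ball x e"
      proof
        fix y assume y: "y \<in> Q"
        have "\<bar>(x - y) \<bullet> b\<bar> \<le> 2 * \<delta>" if b: "b \<in> Basis" for b
        proof -
          have "\<bar>(x \<bullet> b) / \<delta> + real N - real (k b)\<bar> \<le> 1" "\<bar>(y \<bullet> b) / \<delta> + real N - real (k b)\<bar> \<le> 1"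
            using x y b unfolding Q_def by auto
          then have "\<bar>(x \<bullet> b) / \<delta> - (y \<bullet> b) / \<delta>\<bar> \<le> 2" by linarith
          then have "\<bar>((x - y) \<bullet> b) / \<delta>\<bar> \<le> 2" by (simp add: inner_diff_left diff_divide_distrib)
          then show ?thesis using \<delta> by (simp add: field_simps abs_divide)
        qed
        then have "norm (x - y) \<le> (\<Sum>b\<in>(Basis::'a set). 2 * \<delta>)"
          by (intro order_trans[OF norm_le_l1] sum_mono) auto
        also have "\<dots> < e" using e by (simp add: \<delta>_def)
        finally show "y \<in> ball x e" by (simp add: dist_norm)
      qed
      with clos U have "closure {\<xi>. \<phi> \<xi> \<noteq> 0} \<subseteq> U" by blast
      moreover have "compact (closure {\<xi>. \<phi> \<xi> \<noteq> 0})"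
        using bounded_subset[OF compact_imp_bounded[OF Q] sub] by (simp add: compact_closure)
      moreover have "smooth \<phi>"
        unfolding \<phi>_def using Wg by (intro smooth_tensor_diff) (auto simp: compact_smooth_def)
      ultimately have "\<phi> \<in> test_functions U"
        unfolding test_functions_def by blast
      with U show ?thesis unfolding \<U>_def by blast
    qed
    then show ?thesis
      unfolding \<phi>_def L_def using Wg by (subst (asm) fourier_distr_tensor_diff) auto
  qed
  have "L (tensor g) = (\<Sum>k\<in>PiE Basis (\<lambda>_. J). L (tensor (\<lambda>b x. W (k b) x * g b x)))"
    unfolding L_def using part by (intro fourier_distr_tensor_partition g W) (auto simp: J_def)
  also have "\<dots> = (\<Sum>k\<in>PiE Basis (\<lambda>_. J). L (tensor (\<lambda>b x. W (k b) x * h b x)))"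
    by (intro sum.cong refl vanish)
  also have "\<dots> = L (tensor h)"
    unfolding L_def using part by (intro fourier_distr_tensor_partition[symmetric] h W) (auto simp: J_def)
  finally show ?thesis unfolding L_def .
qed

end

text \<open>The kernel H of the overview, written directly as a product; by
  \<open>fourier_tensor\<close> it is the Fourier transform of the product cutoff.\<close>

definition cutoff_kernel :: "'a::euclidean_space \<Rightarrow> complex" where
  "cutoff_kernel = tensor (\<lambda>_. fourier_real (\<lambda>\<xi>. of_real (cutoff \<xi>)))"

text \<open>Both products have Fourier symbol \<open>1\<close> near the spectrum, so the smoothing of \<open>f\<close> at every
  scale \<open>r \<ge> R\<close> is the same function.\<close>

lemma (in l1_plus_bounded) reproducing_scale:
  assumes supp: "distr_support (fourier_distr (distr_of f)) \<subseteq> cball 0 R" and R: "0 < R" "R \<le> r"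
  shows "(\<integral>x. f x * (of_real r ^ DIM('a) * cutoff_kernel (r *\<^sub>R (x - y))) \<partial>lborel)
    = (\<integral>x. f x * (of_real R ^ DIM('a) * cutoff_kernel (R *\<^sub>R (x - y))) \<partial>lborel)"
proof -
  \<comment> \<open>The dilated cutoff times the character of \<open>y\<close>: the transform of
    \<open>tensor (g r)\<close> is r^n H(r (x - y)), so smoothing at the point \<open>y\<close>
    becomes a pairing with a test function.\<close>
  define g where "g r b \<xi> = complex_of_real (cutoff (\<xi> / r)) * exp (2 * complex_of_real pi * \<i> * of_real (y \<bullet> b) * of_real \<xi>)"
    for r and b :: 'a and \<xi>
  have g: "compact_smooth (g r b)" if "r > 0" for r b
    unfolding compact_smooth_def
  proof
    have "smooth_real (\<lambda>\<xi>. complex_of_real (cutoff ((1 / r) * \<xi> + 0)))"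
      by (rule smooth_real_affine[OF smooth_real_cutoff])
    then have "smooth_real (\<lambda>\<xi>. complex_of_real (cutoff ((1 / r) * \<xi> + 0)) * exp (2 * complex_of_real pi * \<i> * of_real (y \<bullet> b) * of_real \<xi>))"
      by (intro smooth_real_mult smooth_real_cexp)
    then show "smooth_real (g r b)"
      by (simp add: g_def[abs_def])
    have "g r b \<xi> = 0" if "3 * r \<le> \<bar>\<xi>\<bar>" for \<xi>
    proof -
      have "3 \<le> \<bar>\<xi> / r\<bar>" using that \<open>r > 0\<close> by (simp add: field_simps abs_divide)
      then show ?thesis by (simp add: g_def cutoff_eq_0)
    qed
    then show "\<exists>L. \<forall>x. L \<le> \<bar>x\<bar> \<longrightarrow> g r b x = 0" by blast
  qed
  have eq: "fourier_distr (distr_of f) (tensor (g r))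
      = (\<integral>x. f x * (of_real r ^ DIM('a) * cutoff_kernel (r *\<^sub>R (x - y))) \<partial>lborel)" if r: "r > 0" for r
  proof -
    have "fourier_real (g r b) x = of_real r * fourier_real (\<lambda>\<xi>. of_real (cutoff \<xi>)) (r * (x - y \<bullet> b))" for b x
      unfolding g_def[abs_def] by (rule fourier_real_scale_modulate[OF r])
    then have "tensor (\<lambda>b. fourier_real (g r b)) x = of_real r ^ DIM('a) * cutoff_kernel (r *\<^sub>R (x - y))" for x
      by (simp add: tensor_def cutoff_kernel_def prod.distrib inner_diff_left)
    then show ?thesis
      using fourier_distr_tensor[of "g r"] g[OF r] by simp
  qed
  \<comment> \<open>Each coordinate of a point in the ball of radius \<open>2 * R\<close> is at most
    \<open>2 * R \<le> 2 * r\<close>, inside the plateau of the cutoff at every scale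
    \<open>r \<ge> R\<close>.\<close>
  have one: "cutoff ((\<xi> \<bullet> b) / r) = 1" if "norm \<xi> < 2 * R" "b \<in> Basis" "R \<le> r" for \<xi> b :: 'a and r
  proof (rule cutoff_eq_1)
    have "\<bar>\<xi> \<bullet> b\<bar> \<le> 2 * r"
      using Basis_le_norm[OF that(2), of \<xi>] that by linarith
    then show "\<bar>(\<xi> \<bullet> b) / r\<bar> \<le> 2" using R(1) that by (simp add: field_simps abs_divide)
  qed
  have "fourier_distr (distr_of f) (tensor (g r)) = fourier_distr (distr_of f) (tensor (g R))"
  proof (rule fourier_distr_tensor_cong[OF supp])
    show "tensor (g r) \<xi> = tensor (g R) \<xi>" if "norm \<xi> < 2 * R" for \<xi>
      unfolding tensor_def g_def using one[OF that] R by (intro prod.cong refl) simp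
  qed (use R g in auto)
  then show ?thesis
    using R eq[of r] eq[of R] by simp
qed

section \<open>Approximate identities\<close>

lemma
  fixes F :: "'a::euclidean_space \<Rightarrow> 'b::{banach, second_countable_topology}"
  assumes [measurable]: "F \<in> borel_measurable borel" and c: "c > 0"
  shows lborel_integral_affine: "integral\<^sup>L lborel F = c ^ DIM('a) *\<^sub>R (\<integral>x. F (t + c *\<^sub>R x) \<partial>lborel)"
    and lborel_integrable_affine_iff: "integrable lborel (\<lambda>x. F (t + c *\<^sub>R x)) \<longleftrightarrow> integrable lborel F"
proof -
  have eq: "lborel = density (distr lborel borel (\<lambda>x. t + c *\<^sub>R x)) (\<lambda>_. ennreal (c ^ DIM('a)))"
    using lborel_affine[of c t] c by (simp add: ennreal_power)
  show "integral\<^sup>L lborel F = c ^ DIM('a) *\<^sub>R (\<integral>x. F (t + c *\<^sub>R x) \<partial>lborel)"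
    using c by (subst eq, subst integral_density) (auto simp: integral_distr)
  have "integrable lborel F \<longleftrightarrow> integrable (distr lborel borel (\<lambda>x. t + c *\<^sub>R x)) (\<lambda>x. c ^ DIM('a) *\<^sub>R F x)"
    using c by (subst eq, subst integrable_density) auto
  also have "\<dots> \<longleftrightarrow> integrable lborel (\<lambda>x. F (t + c *\<^sub>R x))"
  proof -
    have "integrable lborel (\<lambda>x. c ^ DIM('a) *\<^sub>R G x) \<longleftrightarrow> integrable lborel G" for G :: "'a \<Rightarrow> 'b"
    proof
      assume *: "integrable lborel (\<lambda>x. c ^ DIM('a) *\<^sub>R G x)"
      show "integrable lborel G"
        using integrable_scaleR_right[of "1 / c ^ DIM('a)", OF *] c by simp
    qed simp
    then show ?thesis
      by (subst integrable_distr_eq) measurable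
  qed
  finally show "integrable lborel (\<lambda>x. F (t + c *\<^sub>R x)) \<longleftrightarrow> integrable lborel F" ..
qed

text \<open>Lebesgue differentiation over cubes having \<open>x\<close> as a corner: off a
  negligible set their averages tend to \<open>f x\<close>.\<close>

lemma AE_bounded_if_cube_averages_bounded:
  fixes f :: "'a::euclidean_space \<Rightarrow> complex"
  assumes f: "\<And>a b. f integrable_on cbox a b"
    and avg: "\<And>x h. 0 < h \<Longrightarrow> norm (integral (cbox x (x + h *\<^sub>R One)) f) \<le> M * h ^ DIM('a)"
  shows "AE x in lborel. norm (f x) \<le> M"
proof -
  obtain N where N: "negligible N" "\<And>x e. \<lbrakk>x \<notin> N; 0 < e\<rbrakk> \<Longrightarrow>
      \<exists>d>0. \<forall>h. 0 < h \<and> h < d \<longrightarrow> norm (integral (cbox x (x + h *\<^sub>R One)) f /\<^sub>R h ^ DIM('a) - f x) < e"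
    using integrable_ccontinuous_explicit[OF f] by blast
  have "norm (f x) \<le> M" if x: "x \<notin> N" for x
  proof (rule field_le_epsilon)
    fix e :: real assume "e > 0"
    then obtain d where d: "d > 0" "\<And>h. 0 < h \<Longrightarrow> h < d \<Longrightarrow>
        norm (integral (cbox x (x + h *\<^sub>R One)) f /\<^sub>R h ^ DIM('a) - f x) < e"
      using N(2)[OF x] by blast
    define h where "h = d / 2"
    have h: "0 < h" "h < d" using d by (auto simp: h_def)
    have "norm (integral (cbox x (x + h *\<^sub>R One)) f /\<^sub>R h ^ DIM('a)) \<le> M"
      using avg[OF h(1), of x] h(1) by (simp add: field_simps)
    with d(2)[OF h] norm_triangle_sub[of "f x" "integral (cbox x (x + h *\<^sub>R One)) f /\<^sub>R h ^ DIM('a)"]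
    show "norm (f x) \<le> M + e"
      by (simp only: norm_minus_commute[of "f x"])
  qed
  moreover have "AE x in lborel. x \<notin> N"
    using N(1) AE_not_in[of N lebesgue] by (simp add: negligible_iff_null_sets AE_completion_iff)
  ultimately show ?thesis by auto
qed

context l1_plus_bounded
begin

text \<open>The bound does not depend on the translation \<open>z\<close>; it provides the
  domination when the scale tends to infinity.\<close>

lemma
  assumes [measurable]: "Q \<in> sets borel" and Q: "emeasure lborel Q < \<infinity>"
  shows integrable_indicator_translate: "integrable lborel (\<lambda>y. indicator Q y *\<^sub>R f (z + y))"
    and integral_norm_indicator_translate_le: "(\<integral>y. norm (indicator Q y *\<^sub>R f (z + y)) \<partial>lborel)
      \<le> (\<integral>y. large_part s f y \<partial>lborel) + s * measure lborel Q"
proof -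
  have [measurable]: "large_part s f \<in> borel_measurable borel"
    using integrable_large_part by auto
  have int: "integrable lborel (\<lambda>y. large_part s f (z + y))"
    using lborel_integrable_affine_iff[of "large_part s f" 1 z] integrable_large_part by simp
  have eq: "(\<integral>y. large_part s f (z + y) \<partial>lborel) = (\<integral>y. large_part s f y \<partial>lborel)"
    using lborel_integral_affine[of "large_part s f" 1 z] by simp
  have Qint: "integrable lborel (indicator Q :: 'a \<Rightarrow> real)"
    using Q by (intro integrable_real_indicator) auto
  have sum: "integrable lborel (\<lambda>y. large_part s f (z + y) + s * indicator Q y)"
    using int Qint by auto
  have le: "norm (indicator Q y *\<^sub>R f (z + y)) \<le> large_part s f (z + y) + s * indicator Q y" for y
    using norm_le_large_part[OF s_nonneg, of f "z + y"] large_part_nonneg[of s f "z + y"]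
    by (auto simp: indicator_def)
  show 1: "integrable lborel (\<lambda>y. indicator Q y *\<^sub>R f (z + y))"
    by (rule Bochner_Integration.integrable_bound[OF sum _ AE_I2[OF order_trans[OF le]]]) auto
  have "(\<integral>y. norm (indicator Q y *\<^sub>R f (z + y)) \<partial>lborel) \<le> (\<integral>y. large_part s f (z + y) + s * indicator Q y \<partial>lborel)"
    by (rule integral_mono[OF integrable_norm[OF 1] sum le])
  also have "\<dots> = (\<integral>y. large_part s f y \<partial>lborel) + s * measure lborel Q"
    using int Qint by (simp add: eq)
  finally show "(\<integral>y. norm (indicator Q y *\<^sub>R f (z + y)) \<partial>lborel)
      \<le> (\<integral>y. large_part s f y \<partial>lborel) + s * measure lborel Q" .
qed

text \<open>A change of variables translates the cube instead of \<open>f\<close>. The indicators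
  then converge off the faces of the cube, a null set, under domination by \<open>f\<close> on a
  fixed ball.\<close>

lemma tendsto_integral_cbox_translate:
  fixes z :: "nat \<Rightarrow> 'a"
  assumes z: "z \<longlonglongrightarrow> 0"
  shows "(\<lambda>k. \<integral>y. indicator (cbox a b) y *\<^sub>R f (z k + y) \<partial>lborel)
    \<longlonglongrightarrow> (\<integral>y. indicator (cbox a b) y *\<^sub>R f y \<partial>lborel)"
proof -
  have eq: "(\<integral>y. indicator (cbox a b) y *\<^sub>R f (w + y) \<partial>lborel) = (\<integral>u. indicator (cbox a b) (u - w) *\<^sub>R f u \<partial>lborel)" for w
    using lborel_integral_affine[of "\<lambda>u. indicator (cbox a b) (u - w) *\<^sub>R f u" 1 w] by simp
  obtain Z where Z: "\<And>k. norm (z k) \<le> Z"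
    using convergent_imp_Bseq[of z] z by (auto simp: convergent_def Bseq_def)
  obtain P where P: "\<And>x. x \<in> cbox a b \<Longrightarrow> norm x \<le> P"
    using bounded_cbox[of a b] by (auto simp: bounded_iff)
  have "(\<lambda>k. \<integral>u. indicator (cbox a b) (u - z k) *\<^sub>R f u \<partial>lborel) \<longlonglongrightarrow> (\<integral>u. indicator (cbox a b) u *\<^sub>R f u \<partial>lborel)"
  proof (rule integral_dominated_convergence)
    show "integrable lborel (\<lambda>u. norm (indicator (cball 0 (P + Z)) u *\<^sub>R f u))"
      using integrable_indicator_translate[of "cball 0 (P + Z)" 0] emeasure_compact_finite[of "cball 0 (P + Z)"]
      by (intro integrable_norm) auto
    show "AE u in lborel. norm (indicator (cbox a b) (u - z k) *\<^sub>R f u) \<le> norm (indicator (cball 0 (P + Z)) u *\<^sub>R f u)" for k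
    proof (intro AE_I2)
      fix u
      have "norm u \<le> P + Z" if "u - z k \<in> cbox a b"
        using norm_triangle_ineq[of "u - z k" "z k"] P[OF that] Z[of k] by simp
      then show "norm (indicator (cbox a b) (u - z k) *\<^sub>R f u) \<le> norm (indicator (cball 0 (P + Z)) u *\<^sub>R f u)"
        by (auto simp: indicator_def)
    qed
    have "AE u in lebesgue. u \<notin> cbox a b - box a b"
      using AE_not_in negligible_frontier_interval[of a b] by (simp only: negligible_iff_null_sets)
    then have "AE u in lborel. u \<notin> cbox a b - box a b"
      by (simp only: AE_completion_iff)
    then show "AE u in lborel. (\<lambda>k. indicator (cbox a b) (u - z k) *\<^sub>R f u) \<longlonglongrightarrow> indicator (cbox a b) u *\<^sub>R f u"
    proof eventually_elim
      case (elim u)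
      have lim: "(\<lambda>k. u - z k) \<longlonglongrightarrow> u"
        using tendsto_diff[OF tendsto_const z, of u] by simp
      have "\<forall>\<^sub>F k in sequentially. indicator (cbox a b) u = (indicator (cbox a b) (u - z k) :: real)"
      proof (cases "u \<in> box a b")
        case True
        with topological_tendstoD[OF lim open_box] have "\<forall>\<^sub>F k in sequentially. u - z k \<in> box a b" by blast
        then show ?thesis
          by eventually_elim (use True box_subset_cbox[of a b] in \<open>auto simp: indicator_def\<close>)
      next
        case False
        then have u: "u \<in> - cbox a b" using elim by auto
        have "open (- cbox a b)" using closed_cbox by blast
        from topological_tendstoD[OF lim this u] show ?thesis
          by eventually_elim (use u in auto)
      qed
      then show ?case
        by (intro tendsto_eventually) (auto elim!: eventually_mono)
    qed
  qed auto
  then show ?thesis by (simp add: eq)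
qed

text \<open>Instead of pointwise limits of the smoothings, their averages over a cube
  \<open>Q\<close> are used. Exchanging integrals puts the average on \<open>f\<close>, where the
  translate average \<open>J z\<close> is bounded and tends to \<open>J 0\<close> as
  \<open>z\<close> tends to 0. In the limit the integral of \<open>\<kappa> * f\<close> over
  \<open>Q\<close> is at most \<open>M\<close> times the volume of \<open>Q\<close>, and
  differentiation over cubes concludes.\<close>

lemma AE_bounded_if_approx_bounded:
  assumes H: "integrable lborel H" and R: "R > 0"
    and M: "\<And>r y. R \<le> r \<Longrightarrow> norm (\<integral>x. f x * (of_real r ^ DIM('a) * H (r *\<^sub>R (x - y))) \<partial>lborel) \<le> M"
  shows "AE x in lborel. norm (integral\<^sup>L lborel H * f x) \<le> M"
proof (rule AE_bounded_if_cube_averages_bounded)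
  define \<kappa> where "\<kappa> = integral\<^sup>L lborel H"
  have [measurable]: "H \<in> borel_measurable borel" using H by auto
  have M0: "0 \<le> M" using M[of R 0] norm_ge_zero order_trans by blast
  have cb: "emeasure lborel (cbox a b :: 'a set) < \<infinity>" for a b
    by (simp add: emeasure_lborel_cbox_eq)
  have set_int: "set_integrable lborel (cbox a b) f" for a b
    using integrable_indicator_translate[OF _ cb, of a b 0] by (simp add: set_integrable_def)
  have f_int: "f integrable_on cbox a b" for a b
    using set_borel_integral_eq_integral(1)[OF set_int] .
  then show "(\<lambda>x. \<kappa> * f x) integrable_on cbox a b" for a b
    by (intro integrable_on_mult_right)
  fix a :: 'a and h :: real assume h: "0 < h"
  define Q where "Q = cbox a (a + h *\<^sub>R One)"
  have [measurable]: "Q \<in> sets borel" by (simp add: Q_def)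
  have Q: "emeasure lborel Q < \<infinity>" unfolding Q_def by (rule cb)
  have mQ: "measure lborel Q = h ^ DIM('a)"
    using h unfolding Q_def by (subst measure_lborel_cbox) (auto simp: inner_simps)
  define B where "B = (\<integral>y. large_part s f y \<partial>lborel) + s * measure lborel Q"
  define J where "J z = (\<integral>y. indicator Q y *\<^sub>R f (z + y) \<partial>lborel)" for z
  have J_le: "norm (J z) \<le> B" for z
    unfolding J_def B_def
    by (rule order_trans[OF integral_norm_bound integral_norm_indicator_translate_le]) (use Q in auto)
  have [measurable]: "J \<in> borel_measurable borel"
    unfolding J_def by measurable
  have bound: "norm (\<integral>x. H x * J ((1 / r) *\<^sub>R x) \<partial>lborel) \<le> M * measure lborel Q" if r: "R \<le> r" for r
  proof -
    have r0: "r > 0" using r R by simp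
    \<comment> \<open>The integrand of the smoothing at \<open>y \<in> Q\<close> after substituting
      \<open>y + x / r\<close> for the variable, which removes the factor r^n and leaves
      \<open>H\<close> unscaled.\<close>
    define G where "G x y = indicator Q y *\<^sub>R (f (y + (1 / r) *\<^sub>R x) * H x)" for x y
    have G_eq: "G x y = H x * (indicator Q y *\<^sub>R f ((1 / r) *\<^sub>R x + y))" for x y
      by (simp add: G_def add.commute mult.commute)
    have "integrable (lborel \<Otimes>\<^sub>M lborel) (case_prod G)"
    proof (rule lborel_pair.Fubini_integrable)
      show "integrable lborel (\<lambda>x. \<integral>y. norm (case_prod G (x, y)) \<partial>lborel)"
      proof (rule Bochner_Integration.integrable_bound)
        show "integrable lborel (\<lambda>x. norm (H x) * B)" using H by auto
        have "(\<integral>y. norm (G x y) \<partial>lborel) \<le> norm (H x) * B" for x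
          unfolding G_eq norm_mult integral_mult_right_zero B_def
          by (intro mult_left_mono integral_norm_indicator_translate_le Q) auto
        then show "AE x in lborel. norm (\<integral>y. norm (case_prod G (x, y)) \<partial>lborel) \<le> norm (norm (H x) * B)"
          by (intro AE_I2) (auto intro!: order_trans[OF _ abs_ge_self])
        show "(\<lambda>x. \<integral>y. norm (case_prod G (x, y)) \<partial>lborel) \<in> borel_measurable lborel"
          unfolding G_def by measurable
      qed
      show "AE x in lborel. integrable lborel (\<lambda>y. case_prod G (x, y))"
        unfolding prod.case G_eq
        by (intro AE_I2 integrable_mult_right integrable_indicator_translate Q) auto
    qed (unfold G_def, measurable)
    note G_int = this
    have "(\<integral>x. (\<integral>y. G x y \<partial>lborel) \<partial>lborel) = (\<integral>y. (\<integral>x. G x y \<partial>lborel) \<partial>lborel)"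
      by (rule lborel_pair.Fubini_integral[OF G_int, symmetric])
    moreover have "(\<integral>y. G x y \<partial>lborel) = H x * J ((1 / r) *\<^sub>R x)" for x
      unfolding G_eq J_def by (rule integral_mult_right_zero)
    moreover have "norm (\<integral>y. (\<integral>x. G x y \<partial>lborel) \<partial>lborel) \<le> (\<integral>y. M * indicator Q y \<partial>lborel)"
    proof (rule Bochner_Integration.integral_norm_bound_integral[OF lborel_pair.integrable_snd[OF G_int]])
      show "integrable lborel (\<lambda>y. M * indicator Q y :: real)"
        using Q by (intro integrable_mult_right integrable_real_indicator) auto
      show "norm (\<integral>x. G x y \<partial>lborel) \<le> M * indicator Q y" for y
      proof -
        have "(\<integral>x. f x * (of_real r ^ DIM('a) * H (r *\<^sub>R (x - y))) \<partial>lborel)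
            = (1 / r) ^ DIM('a) *\<^sub>R (\<integral>x. f (y + (1 / r) *\<^sub>R x) * (of_real r ^ DIM('a) * H x) \<partial>lborel)"
          using r0 by (subst lborel_integral_affine[where c = "1 / r" and t = y]) auto
        also have "\<dots> = (1 / r) ^ DIM('a) *\<^sub>R (of_real r ^ DIM('a) * (\<integral>x. f (y + (1 / r) *\<^sub>R x) * H x \<partial>lborel))"
          by (subst integral_mult_right_zero[symmetric]) (simp only: mult_ac)
        also have "\<dots> = (\<integral>x. f (y + (1 / r) *\<^sub>R x) * H x \<partial>lborel)"
          using r0 by (simp add: scaleR_conv_of_real power_divide)
        finally have "norm (\<integral>x. f (y + (1 / r) *\<^sub>R x) * H x \<partial>lborel) \<le> M"
          using M[OF r, of y] by simp
        then show ?thesis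
          by (auto simp: G_def indicator_def)
      qed
    qed
    ultimately show ?thesis using Q by simp
  qed
  \<comment> \<open>The scales \<open>R + k\<close> all satisfy the hypothesis on \<open>r\<close>
    and tend to infinity.\<close>
  define z where "z k = 1 / (R + real k)" for k
  have z0: "z \<longlonglongrightarrow> 0"
    unfolding z_def by (intro tendsto_divide_0[OF tendsto_const] filterlim_at_top_imp_at_infinity
        filterlim_tendsto_add_at_top[OF tendsto_const] filterlim_real_sequentially)
  have "(\<lambda>k. \<integral>x. H x * J (z k *\<^sub>R x) \<partial>lborel) \<longlonglongrightarrow> (\<integral>x. H x * J 0 \<partial>lborel)"
  proof (rule integral_dominated_convergence)
    show "integrable lborel (\<lambda>x. norm (H x) * B)" using H by auto
    show "AE x in lborel. norm (H x * J (z k *\<^sub>R x)) \<le> norm (H x) * B" for k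
      unfolding norm_mult by (intro AE_I2 mult_left_mono J_le) auto
    have "(\<lambda>k. J (z k *\<^sub>R x)) \<longlonglongrightarrow> J 0" for x
      using tendsto_integral_cbox_translate[of "\<lambda>k. z k *\<^sub>R x" a "a + h *\<^sub>R One"] tendsto_scaleR[OF z0 tendsto_const, of x]
      unfolding J_def Q_def by simp
    then show "AE x in lborel. (\<lambda>k. H x * J (z k *\<^sub>R x)) \<longlonglongrightarrow> H x * J 0"
      by (intro AE_I2 tendsto_intros)
  qed auto
  then have "(\<lambda>k. norm (\<integral>x. H x * J (z k *\<^sub>R x) \<partial>lborel)) \<longlonglongrightarrow> norm (\<kappa> * J 0)"
    by (auto intro!: tendsto_norm simp: \<kappa>_def)
  then have "norm (\<kappa> * J 0) \<le> M * measure lborel Q"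
    by (rule LIMSEQ_le_const2) (use bound[of "R + real k" for k] R in \<open>auto simp: z_def\<close>)
  moreover have "J 0 = integral Q f"
    using set_borel_integral_eq_integral(2)[OF set_int] unfolding J_def Q_def by (simp add: set_lebesgue_integral_def)
  ultimately show "norm (integral (cbox a (a + h *\<^sub>R One)) (\<lambda>x. \<kappa> * f x)) \<le> M * h ^ DIM('a)"
    using f_int mQ unfolding Q_def by simp
qed

end

text \<open>All smoothings at scales \<open>r \<ge> R\<close> equal the one at scale
  \<open>R\<close>, which the splitting of \<open>f\<close> at height \<open>s\<close> bounds
  uniformly in \<open>y\<close>. The approximate identity transfers this bound to
  \<open>\<kappa> * f\<close>, and \<open>\<kappa>\<close>, a power of the one-dimensional integral,
  is nonzero.\<close>

lemma bandlimited_AE_bound: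
  "\<exists>C>0. \<forall>R>0. \<forall>s\<ge>0. \<forall>f::'a::euclidean_space \<Rightarrow> complex.
     f \<in> borel_measurable borel \<longrightarrow> integrable lborel (large_part s f) \<longrightarrow>
     distr_support (fourier_distr (distr_of f)) \<subseteq> cball 0 R \<longrightarrow>
     (AE x in lborel. norm (f x) \<le> C * (R ^ DIM('a) * (\<integral>x. large_part s f x \<partial>lborel) + s))"
proof -
  define H where "H = (cutoff_kernel :: 'a \<Rightarrow> complex)"
  define \<kappa> where "\<kappa> = integral\<^sup>L lborel H"
  have H: "integrable lborel H"
    unfolding H_def cutoff_kernel_def by (intro integrable_tensor integrable_fourier_real compact_smooth_cutoff)
  have [measurable]: "H \<in> borel_measurable borel" using H by auto
  have "\<kappa> = (\<integral>x. fourier_real (\<lambda>\<xi>. of_real (cutoff \<xi>)) x \<partial>lborel) ^ DIM('a)"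
    unfolding \<kappa>_def H_def cutoff_kernel_def
    by (subst integral_tensor) (auto intro!: integrable_fourier_real compact_smooth_cutoff)
  then have \<kappa>: "\<kappa> \<noteq> 0"
    using integral_fourier_cutoff_nonzero by simp
  obtain D where D: "\<And>x. norm (H x) \<le> D"
    unfolding H_def cutoff_kernel_def
    using tensor_bounded[of "\<lambda>_. fourier_real (\<lambda>\<xi>. of_real (cutoff \<xi>))"] fourier_real_bounded[OF compact_smooth_cutoff] by blast
  have D0: "0 \<le> D" using D[of 0] norm_ge_zero order_trans by blast
  define E where "E = (\<integral>x. norm (H x) \<partial>lborel)"
  have E0: "0 \<le> E" unfolding E_def by simp
  \<comment> \<open>\<open>D\<close> bounds the kernel and \<open>E\<close> is its L^1 norm; the
    added 1 makes the constant strictly positive.\<close>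
  define C where "C = (D + E + 1) / norm \<kappa>"
  have C: "C > 0" using \<kappa> D0 E0 by (simp add: C_def)
  moreover have "AE x in lborel. norm (f x) \<le> C * (R ^ DIM('a) * (\<integral>x. large_part s f x \<partial>lborel) + s)"
    if R: "R > 0" and s: "s \<ge> 0" and f: "f \<in> borel_measurable borel" "integrable lborel (large_part s f)"
      and supp: "distr_support (fourier_distr (distr_of f)) \<subseteq> cball 0 R" for R s and f :: "'a \<Rightarrow> complex"
  proof -
    interpret l1_plus_bounded f s by standard (use s f in auto)
    define I where "I = (\<integral>x. large_part s f x \<partial>lborel)"
    have I0: "0 \<le> I" unfolding I_def by (simp add: large_part_nonneg)
    have "AE x in lborel. norm (\<kappa> * f x) \<le> D * R ^ DIM('a) * I + s * E"
      unfolding \<kappa>_def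
    proof (rule AE_bounded_if_approx_bounded[OF H R])
      fix r y assume r: "R \<le> r"
      define k where "k x = of_real R ^ DIM('a) * H (R *\<^sub>R (x - y))" for x
      have eq: "(- R) *\<^sub>R y + R *\<^sub>R x = R *\<^sub>R (x - y)" for x
        by (simp add: algebra_simps)
      have k_int: "integrable lborel k"
        using lborel_integrable_affine_iff[of H R "(- R) *\<^sub>R y"] H R unfolding k_def by (simp only: eq) auto
      have k_le: "norm (k x) \<le> R ^ DIM('a) * D" for x
        using D R by (simp add: k_def norm_mult norm_power)
      have "(\<integral>x. norm (k x) \<partial>lborel) = E"
        using lborel_integral_affine[of "\<lambda>x. norm (H x)" R "(- R) *\<^sub>R y"] R
        unfolding k_def E_def by (simp only: eq) (simp add: norm_mult norm_power)
      moreover have "(\<integral>x. f x * (of_real r ^ DIM('a) * H (r *\<^sub>R (x - y))) \<partial>lborel) = (\<integral>x. f x * k x \<partial>lborel)"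
        unfolding k_def H_def by (rule reproducing_scale[OF supp R r])
      ultimately show "norm (\<integral>x. f x * (of_real r ^ DIM('a) * H (r *\<^sub>R (x - y))) \<partial>lborel) \<le> D * R ^ DIM('a) * I + s * E"
        using norm_integral_mult_le[OF borel s_nonneg integrable_large_part k_int k_le]
        by (simp add: I_def mult_ac)
    qed
    then show ?thesis
    proof eventually_elim
      case (elim x)
      have "D * (R ^ DIM('a) * I) \<le> (D + E + 1) * (R ^ DIM('a) * I)"
        using E0 I0 R by (intro mult_right_mono) auto
      moreover have "E * s \<le> (D + E + 1) * s"
        using D0 s by (intro mult_right_mono) auto
      moreover have "norm \<kappa> * norm (f x) \<le> D * (R ^ DIM('a) * I) + E * s"
        using elim by (simp add: norm_mult mult_ac)
      ultimately have "norm \<kappa> * norm (f x) \<le> (D + E + 1) * (R ^ DIM('a) * I + s)"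
        unfolding distrib_left by linarith
      then have "norm (f x) \<le> (D + E + 1) * (R ^ DIM('a) * I + s) / norm \<kappa>"
        using \<kappa> by (simp add: pos_le_divide_eq mult.commute)
      then show ?case by (simp add: C_def I_def)
    qed
  qed
  ultimately show ?thesis by blast
qed

section \<open>Rearrangements\<close>

lemma borel_measurable_antimono_real:
  fixes g :: "real \<Rightarrow> ennreal"
  assumes "\<And>x y. x \<le> y \<Longrightarrow> g y \<le> g x"
  shows "g \<in> borel_measurable borel"
proof (rule borel_measurableI_greater)
  fix a
  have "is_interval {x. a < g x}"
    unfolding is_interval_1 using assms by (auto intro: less_le_trans)
  then show "{x \<in> space borel. a < g x} \<in> sets borel"
    by (simp add: real_interval_borel_measurable)
qed

lemma rearrangement_antimono: "u \<le> t \<Longrightarrow> rearrangement f t \<le> rearrangement f u"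
  unfolding rearrangement_def by (rule Inf_superset_mono) (blast intro: order_trans ennreal_leI)

lemma borel_measurable_rearrangement[measurable]: "rearrangement f \<in> borel_measurable borel"
  by (rule borel_measurable_antimono_real) (rule rearrangement_antimono)

lemma rearrangement_cong_AE:
  assumes [measurable]: "f \<in> borel_measurable lebesgue" "g \<in> borel_measurable lebesgue"
    and "AE x in lebesgue. f x = g x"
  shows "rearrangement f = rearrangement g"
proof -
  have "emeasure lebesgue {x. s < norm (f x)} = emeasure lebesgue {x. s < norm (g x)}" for s
  proof (rule emeasure_eq_AE)
    show "AE x in lebesgue. x \<in> {x. s < norm (f x)} \<longleftrightarrow> x \<in> {x. s < norm (g x)}"
      using assms(3) by eventually_elim simp
    have "{x \<in> space lebesgue. s < norm (f x)} \<in> sets lebesgue" "{x \<in> space lebesgue. s < norm (g x)} \<in> sets lebesgue"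
      by measurable
    then show "{x. s < norm (f x)} \<in> sets lebesgue" "{x. s < norm (g x)} \<in> sets lebesgue"
      by simp_all
  qed
  then show ?thesis
    unfolding rearrangement_def by simp
qed

lemma rearrangement_le_if_AE_le:
  assumes "AE x in lebesgue. norm (f x) \<le> M" and [measurable]: "f \<in> borel_measurable lebesgue" and "0 \<le> M"
  shows "rearrangement f t \<le> ennreal M"
proof -
  have "{x \<in> space lebesgue. M < norm (f x)} \<in> sets lebesgue" by measurable
  then have "emeasure lebesgue {x. M < norm (f x)} = 0"
    using assms(1) by (subst emeasure_eq_AE[where B = "{}"]) (auto elim!: eventually_mono)
  then show ?thesis
    unfolding rearrangement_def using assms(3) by (intro Inf_lower) auto
qed

text \<open>Strictness yields an admissible level \<open>s'\<close> below \<open>s\<close> in the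
  infimum that defines the rearrangement, whether or not that infimum is attained.\<close>

lemma emeasure_le_if_rearrangement_less:
  assumes "rearrangement f t < ennreal s" and [measurable]: "f \<in> borel_measurable borel"
  shows "emeasure lborel {x. s < norm (f x)} \<le> ennreal t"
proof -
  obtain s' where s': "0 \<le> s'" "ennreal s' < ennreal s" "emeasure lebesgue {x. s' < norm (f x)} \<le> ennreal t"
    using assms(1) unfolding rearrangement_def Inf_less_iff by auto
  have "emeasure lborel {x. s < norm (f x)} \<le> emeasure lborel {x. s' < norm (f x)}"
    using s'(1,2) by (intro emeasure_mono) (auto simp: ennreal_less_iff)
  with s'(3) show ?thesis by simp
qed

lemma le_rearrangement_if_less_emeasure:
  assumes "ennreal u < emeasure lborel {x. s < norm (f x)}" and [measurable]: "f \<in> borel_measurable borel"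
  shows "ennreal s \<le> rearrangement f u"
  unfolding rearrangement_def
proof (rule Inf_greatest, clarify)
  fix s' assume s': "emeasure lebesgue {x. s' < norm (f x)} \<le> ennreal u"
  show "ennreal s \<le> ennreal s'"
  proof (rule ccontr)
    assume "\<not> ennreal s \<le> ennreal s'"
    then have "s' \<le> s" by (metis ennreal_leI linear)
    then have "emeasure lborel {x. s < norm (f x)} \<le> emeasure lborel {x. s' < norm (f x)}"
      by (intro emeasure_mono) auto
    with s' assms(1) show False by (simp add: not_le[symmetric])
  qed
qed

text \<open>Writes the minimum as the length of a set of \<open>u\<close>, so that the layer
  estimate can be read as a double integral over levels and positions.\<close>

lemma emeasure_interval_below_min:
  assumes "0 < a"
  shows "emeasure lborel {u. 0 < u \<and> u < a \<and> ennreal u < m} = min (ennreal a) m"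
proof (cases m)
  case (real r)
  have "{u. 0 < u \<and> u < a \<and> ennreal u < m} = {0<..<min a r}"
    using real by (auto simp: ennreal_less_iff)
  then show ?thesis
    using real assms by (simp add: min_def ennreal_le_iff)
next
  case top
  then have "{u. 0 < u \<and> u < a \<and> ennreal u < m} = {0<..<a}" by auto
  then show ?thesis using top assms by simp
qed

text \<open>The layer-cake formula on both sides: each layer \<open>{s < |f|}\<close> contributes at most
  the minimum of \<open>a\<close> and its measure, and so does the layer of the rearrangement on \<open>(0, a)\<close>.\<close>

lemma nn_integral_large_part_le:
  fixes f :: "'a::euclidean_space \<Rightarrow> complex"
  assumes [measurable]: "f \<in> borel_measurable borel" and s: "0 \<le> s" and a: "0 < a"
    and m: "emeasure lborel {x. s < norm (f x)} \<le> ennreal a"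
  shows "(\<integral>\<^sup>+x. ennreal (large_part s f x) \<partial>lborel)
    \<le> (\<integral>\<^sup>+u. indicator {0<..<a} u * rearrangement f u \<partial>lborel)"
proof -
  define \<mu> where "\<mu> r = emeasure lborel {x. r < norm (f x)}" for r
  have \<mu>_antimono: "r \<le> r' \<Longrightarrow> \<mu> r' \<le> \<mu> r" for r r'
    unfolding \<mu>_def by (intro emeasure_mono) auto
  have [measurable]: "\<mu> \<in> borel_measurable borel"
    by (rule borel_measurable_antimono_real) (rule \<mu>_antimono)
  have [measurable]: "large_part s f \<in> borel_measurable borel"
    unfolding large_part_def by measurable
  have "ennreal (large_part s f x) = (\<integral>\<^sup>+r. indicator {r. 0 \<le> r \<and> r < large_part s f x} r \<partial>lborel)" for x
  proof -
    have "{r. 0 \<le> r \<and> r < large_part s f x} = {0..<large_part s f x}" by auto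
    then show ?thesis using large_part_nonneg[of s f x] by simp
  qed
  then have "(\<integral>\<^sup>+x. ennreal (large_part s f x) \<partial>lborel)
      = (\<integral>\<^sup>+x. (\<integral>\<^sup>+r. indicator {r. 0 \<le> r \<and> r < large_part s f x} r \<partial>lborel) \<partial>lborel)"
    by simp
  also have "\<dots> = (\<integral>\<^sup>+r. (\<integral>\<^sup>+x. indicator {r. 0 \<le> r \<and> r < large_part s f x} r \<partial>lborel) \<partial>lborel)"
    by (rule lborel_pair.Fubini'[symmetric]) measurable
  also have "\<dots> \<le> (\<integral>\<^sup>+r. (\<integral>\<^sup>+u. indicator {0<..<a} u * indicator {r. 0 \<le> r \<and> ennreal u < \<mu> r} r \<partial>lborel) \<partial>lborel)"
  proof (rule nn_integral_mono)
    fix r :: real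
    show "(\<integral>\<^sup>+x. indicator {r. 0 \<le> r \<and> r < large_part s f x} r \<partial>lborel)
        \<le> (\<integral>\<^sup>+u. indicator {0<..<a} u * indicator {r. 0 \<le> r \<and> ennreal u < \<mu> r} r \<partial>lborel)"
    proof (cases "0 \<le> r")
      case True
      have "(\<integral>\<^sup>+x. indicator {r. 0 \<le> r \<and> r < large_part s f x} r \<partial>lborel)
          = (\<integral>\<^sup>+x. indicator {x. max r s < norm (f x)} x \<partial>lborel)"
        using True by (intro nn_integral_cong) (auto simp: indicator_def large_part_def)
      also have "\<dots> = \<mu> (max r s)" unfolding \<mu>_def by simp
      \<comment> \<open>Levels below \<open>s\<close> are all replaced by the layer at
        \<open>s\<close>, whose measure is at most \<open>a\<close> by hypothesis.\<close>
      also have "\<dots> \<le> min (ennreal a) (\<mu> r)"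
        using m \<mu>_antimono[of s "max r s"] \<mu>_antimono[of r "max r s"] unfolding \<mu>_def[of s]
        by (auto intro: order_trans)
      also have "\<dots> = emeasure lborel {u. 0 < u \<and> u < a \<and> ennreal u < \<mu> r}"
        by (rule emeasure_interval_below_min[OF a, symmetric])
      also have "\<dots> = (\<integral>\<^sup>+u. indicator {u. 0 < u \<and> u < a \<and> ennreal u < \<mu> r} u \<partial>lborel)"
        by simp
      also have "\<dots> = (\<integral>\<^sup>+u. indicator {0<..<a} u * indicator {r. 0 \<le> r \<and> ennreal u < \<mu> r} r \<partial>lborel)"
        using True by (intro nn_integral_cong) (auto simp: indicator_def)
      finally show ?thesis .
    qed simp
  qed
  also have "\<dots> = (\<integral>\<^sup>+u. (\<integral>\<^sup>+r. indicator {0<..<a} u * indicator {r. 0 \<le> r \<and> ennreal u < \<mu> r} r \<partial>lborel) \<partial>lborel)"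
    by (rule lborel_pair.Fubini') measurable
  also have "\<dots> \<le> (\<integral>\<^sup>+u. indicator {0<..<a} u * rearrangement f u \<partial>lborel)"
  proof (rule nn_integral_mono)
    fix u :: real
    have "(\<integral>\<^sup>+r. indicator {0<..<a} u * indicator {r. 0 \<le> r \<and> ennreal u < \<mu> r} r \<partial>lborel)
        = indicator {0<..<a} u * emeasure lborel {r. 0 \<le> r \<and> ennreal u < \<mu> r}"
      by (subst nn_integral_cmult) auto
    also have "\<dots> \<le> indicator {0<..<a} u * rearrangement f u"
    proof (rule mult_left_mono)
      \<comment> \<open>The levels whose layer has measure above \<open>u\<close> all lie in the
        interval from 0 to the rearrangement at \<open>u\<close>.\<close>
      show "emeasure lborel {r. 0 \<le> r \<and> ennreal u < \<mu> r} \<le> rearrangement f u"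
      proof (cases "rearrangement f u")
        case (real v)
        have "r \<le> v" if "0 \<le> r" "ennreal u < \<mu> r" for r
          using le_rearrangement_if_less_emeasure[of u r f] that real by (simp add: \<mu>_def)
        then have "emeasure lborel {r. 0 \<le> r \<and> ennreal u < \<mu> r} \<le> emeasure lborel {0..v}"
          by (intro emeasure_mono) auto
        then show ?thesis using real by simp
      qed simp
    qed simp
    finally show "(\<integral>\<^sup>+r. indicator {0<..<a} u * indicator {r. 0 \<le> r \<and> ennreal u < \<mu> r} r \<partial>lborel)
        \<le> indicator {0<..<a} u * rearrangement f u" .
  qed
  finally show ?thesis .
qed

section \<open>Passing to Borel representatives\<close>

lemma borel_measurable_smooth: "smooth \<phi> \<Longrightarrow> \<phi> \<in> borel_measurable borel"
proof -
  assume "smooth \<phi>"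
  then have "\<phi> differentiable (at x)" for x
    unfolding smooth_def by (metis empty_set empty_subsetI partials.simps(1))
  then have "continuous_on UNIV \<phi>"
    by (simp add: continuous_at_imp_continuous_on differentiable_imp_continuous_within)
  then show ?thesis by (rule borel_measurable_continuous_onI)
qed

lemma borel_measurable_fourier:
  assumes [measurable]: "\<phi> \<in> borel_measurable borel"
  shows "fourier \<phi> \<in> borel_measurable borel"
proof -
  have "fourier \<phi> = (\<lambda>\<xi>. \<integral>x. exp (- 2 * complex_of_real pi * \<i> * complex_of_real (x \<bullet> \<xi>)) * \<phi> x \<partial>lborel)"
    unfolding fourier_def by (intro ext integral_completion) measurable
  also have "\<dots> \<in> borel_measurable borel" by measurable
  finally show ?thesis .
qed

lemma distr_support_cong_AE:
  assumes [measurable]: "f \<in> borel_measurable lebesgue" "g \<in> borel_measurable lebesgue"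
    and "AE x in lebesgue. f x = g x"
  shows "distr_support (fourier_distr (distr_of f)) = distr_support (fourier_distr (distr_of g))"
proof -
  have "fourier_distr (distr_of f) \<phi> = fourier_distr (distr_of g) \<phi>" if "smooth \<phi>" for \<phi>
  proof -
    have "fourier \<phi> \<in> borel_measurable lborel"
      using borel_measurable_fourier[OF borel_measurable_smooth[OF that]] by simp
    then have [measurable]: "fourier \<phi> \<in> borel_measurable lebesgue"
      by (rule measurable_completion)
    show ?thesis
      unfolding fourier_distr_def distr_of_def
      by (rule integral_cong_AE) (use assms(3) in \<open>auto elim!: eventually_mono\<close>)
  qed
  then have "(\<forall>\<phi>\<in>test_functions U. fourier_distr (distr_of f) \<phi> = 0)
      \<longleftrightarrow> (\<forall>\<phi>\<in>test_functions U. fourier_distr (distr_of g) \<phi> = 0)" for U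
    by (auto simp: test_functions_def)
  then show ?thesis unfolding distr_support_def by simp
qed

lemma lebesgue_measurable_borel_version:
  fixes f :: "'a::euclidean_space \<Rightarrow> complex"
  assumes [measurable]: "f \<in> borel_measurable lebesgue"
  obtains g where "g \<in> borel_measurable borel" "AE x in lebesgue. f x = g x"
proof -
  have "(\<lambda>x. Re (f x)) \<in> borel_measurable lebesgue" "(\<lambda>x. Im (f x)) \<in> borel_measurable lebesgue"
    by measurable
  from this[THEN completion_ex_borel_measurable_real] obtain u v where
    [measurable]: "u \<in> borel_measurable borel" "v \<in> borel_measurable borel" and
    uv: "AE x in lborel. Re (f x) = u x" "AE x in lborel. Im (f x) = v x"
    by auto
  have "AE x in lborel. f x = Complex (u x) (v x)"
    using uv by eventually_elim (simp add: complex_eq_iff)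
  then have "AE x in lebesgue. f x = Complex (u x) (v x)"
    by (simp add: AE_completion_iff)
  moreover have "(\<lambda>x. Complex (u x) (v x)) \<in> borel_measurable borel"
    by (simp add: borel_measurable_complex_iff)
  ultimately show ?thesis using that by blast
qed

lemma rearrangement_times_le_integral:
  assumes "0 \<le> a"
  shows "ennreal a * rearrangement f a \<le> (\<integral>\<^sup>+u. indicator {0<..<a} u * rearrangement f u \<partial>lborel)"
proof -
  have "ennreal a * rearrangement f a = (\<integral>\<^sup>+u. rearrangement f a * indicator {0<..<a} u \<partial>lborel)"
    using assms by (subst nn_integral_cmult_indicator) (auto simp: mult.commute)
  also have "\<dots> \<le> (\<integral>\<^sup>+u. indicator {0<..<a} u * rearrangement f u \<partial>lborel)"
    by (intro nn_integral_mono) (auto simp: indicator_def intro: rearrangement_antimono)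
  finally show ?thesis .
qed

text \<open>With \<open>a = 1 / R ^ n\<close>, both the integral of the large part and
  \<open>a\<close> times the rearrangement at \<open>a\<close> are at most \<open>I\<close>. Each
  contributes one \<open>R ^ n * I\<close> to the almost everywhere bound, whence the factor
  2.\<close>

lemma bandlimited_rearrangement_bound:
  "\<exists>C>0. \<forall>R>0. \<forall>I\<ge>0. \<forall>f::'a::euclidean_space \<Rightarrow> complex. f \<in> borel_measurable lebesgue \<longrightarrow>
     distr_support (fourier_distr (distr_of f)) \<subseteq> cball 0 R \<longrightarrow>
     (\<integral>\<^sup>+u. indicator {0<..<1 / R ^ DIM('a)} u * rearrangement f u \<partial>lborel) \<le> ennreal I \<longrightarrow>
     (\<forall>t. rearrangement f t \<le> ennreal (C * R ^ DIM('a) * I))"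
proof -
  obtain C where C: "C > 0" and bound: "\<And>R s (f::'a \<Rightarrow> complex). R > 0 \<Longrightarrow> s \<ge> 0 \<Longrightarrow>
     f \<in> borel_measurable borel \<Longrightarrow> integrable lborel (large_part s f) \<Longrightarrow>
     distr_support (fourier_distr (distr_of f)) \<subseteq> cball 0 R \<Longrightarrow>
     (AE x in lborel. norm (f x) \<le> C * (R ^ DIM('a) * (\<integral>x. large_part s f x \<partial>lborel) + s))"
    using bandlimited_AE_bound[where 'a = 'a] by blast
  have "rearrangement f t \<le> ennreal (2 * C * R ^ DIM('a) * I)"
    if R: "R > 0" and I: "I \<ge> 0" and f: "f \<in> borel_measurable lebesgue"
      and supp: "distr_support (fourier_distr (distr_of f)) \<subseteq> cball 0 R"
      and I_le: "(\<integral>\<^sup>+u. indicator {0<..<1 / R ^ DIM('a)} u * rearrangement f u \<partial>lborel) \<le> ennreal I"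
    for R I t and f :: "'a \<Rightarrow> complex"
  proof -
    obtain g where [measurable]: "g \<in> borel_measurable borel" and ae: "AE x in lebesgue. f x = g x"
      using lebesgue_measurable_borel_version[OF f] by blast
    have g: "g \<in> borel_measurable lebesgue"
      by (intro measurable_completion) simp
    have fg: "rearrangement f = rearrangement g"
      by (rule rearrangement_cong_AE[OF f g ae])
    have supp_g: "distr_support (fourier_distr (distr_of g)) \<subseteq> cball 0 R"
      using supp distr_support_cong_AE[OF f g ae] by simp
    define a where "a = 1 / R ^ DIM('a)"
    have a: "a > 0" using R by (simp add: a_def)
    have I_le': "(\<integral>\<^sup>+u. indicator {0<..<a} u * rearrangement g u \<partial>lborel) \<le> ennreal I"
      using I_le by (simp add: a_def fg)
    have "rearrangement g t \<le> ennreal (2 * C * R ^ DIM('a) * I)"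
    proof (rule ennreal_le_epsilon)
      fix e :: real assume e: "e > 0"
      \<comment> \<open>\<open>R ^ n * I\<close> bounds the rearrangement at \<open>a\<close>; the
        surplus \<open>e / C\<close> makes the comparison strict and the height positive, and
        contributes exactly \<open>e\<close> to the final bound.\<close>
      define s where "s = R ^ DIM('a) * I + e / C"
      have s: "s > 0" using R I e C by (simp add: s_def add_nonneg_pos)
      have "ennreal a * rearrangement g a \<le> ennreal I"
        using order_trans[OF rearrangement_times_le_integral I_le'] a by simp
      then have "ennreal (1 / a) * (ennreal a * rearrangement g a) \<le> ennreal (1 / a) * ennreal I"
        by (intro mult_left_mono) auto
      moreover have "ennreal (1 / a) * (ennreal a * rearrangement g a) = rearrangement g a"
        using a by (simp add: mult.assoc[symmetric] ennreal_mult[symmetric])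
      ultimately have "rearrangement g a \<le> ennreal (R ^ DIM('a) * I)"
        using a I R by (simp add: ennreal_mult[symmetric] a_def)
      also have "\<dots> < ennreal s"
        using R I e C by (intro ennreal_lessI s) (simp add: s_def)
      finally have "emeasure lborel {x. s < norm (g x)} \<le> ennreal a"
        by (rule emeasure_le_if_rearrangement_less) simp
      then have le: "(\<integral>\<^sup>+x. ennreal (large_part s g x) \<partial>lborel) \<le> ennreal I"
        using order_trans[OF nn_integral_large_part_le I_le'] s a by simp
      have [measurable]: "large_part s g \<in> borel_measurable borel"
        unfolding large_part_def by measurable
      have int: "integrable lborel (large_part s g)"
        by (rule integrableI_bounded)
           (use le in \<open>auto simp: large_part_nonneg intro: le_less_trans\<close>)
      have "ennreal (\<integral>x. large_part s g x \<partial>lborel) \<le> ennreal I"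
        using le by (subst nn_integral_eq_integral[OF int, symmetric]) (auto simp: large_part_nonneg)
      then have int_le: "(\<integral>x. large_part s g x \<partial>lborel) \<le> I"
        using I by (simp add: ennreal_le_iff)
      have "AE x in lborel. norm (g x) \<le> C * (R ^ DIM('a) * (\<integral>x. large_part s g x \<partial>lborel) + s)"
        by (rule bound[OF R _ _ int supp_g]) (use s in auto)
      then have "AE x in lborel. norm (g x) \<le> 2 * C * R ^ DIM('a) * I + e"
      proof eventually_elim
        case (elim x)
        have "C * (R ^ DIM('a) * (\<integral>x. large_part s g x \<partial>lborel) + s) \<le> C * (R ^ DIM('a) * I + s)"
          using C R int_le by (intro mult_left_mono add_right_mono) auto
        also have "\<dots> = 2 * C * R ^ DIM('a) * I + e"
          using C by (simp add: s_def field_simps)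
        finally show ?case using elim by simp
      qed
      then have "AE x in lebesgue. norm (g x) \<le> 2 * C * R ^ DIM('a) * I + e"
        by (simp add: AE_completion_iff)
      then have "rearrangement g t \<le> ennreal (2 * C * R ^ DIM('a) * I + e)"
        by (rule rearrangement_le_if_AE_le[OF _ g]) (use C R I e in auto)
      then show "rearrangement g t \<le> ennreal (2 * C * R ^ DIM('a) * I) + ennreal e"
        using C R I e by (simp add: ennreal_plus)
    qed
    then show ?thesis by (simp add: fg)
  qed
  then show ?thesis
    using C by (intro exI[of _ "2 * C"]) auto
qed

section \<open>Broken logarithms and Lorentz--Zygmund norms\<close>

lemma broken_log_pos: "0 < broken_log A t"
proof -
  have "0 < 1 + \<bar>ln t\<bar>" by linarith
  then have "0 < (1 + \<bar>ln t\<bar>) powr a" for a by (metis less_irrefl powr_gt_zero)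
  then show ?thesis unfolding broken_log_def by presburger
qed

lemma broken_log_diff: "broken_log (A - B) t = broken_log A t * broken_log (- B) t"
  by (simp add: broken_log_def powr_diff powr_minus divide_inverse)

lemma broken_log_uminus: "broken_log (- B) t = inverse (broken_log B t)"
  by (simp add: broken_log_def powr_minus)

lemma broken_log_zero: "broken_log (0, 0) t = 1"
proof -
  have "0 \<noteq> 1 + \<bar>ln t\<bar>" by linarith
  then show ?thesis unfolding broken_log_def by (metis fst_conv snd_conv powr_zero_eq_one)
qed

lemma broken_log_swap_inverse:
  assumes "s > 0"
  shows "broken_log (prod.swap B) (1 / s) = broken_log B s"
proof (cases "s = 1")
  case False
  with assms show ?thesis
    by (auto simp: broken_log_def ln_div field_simps)
qed (simp add: broken_log_def)

section \<open>Comparison of logarithmic weights at different scales\<close>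

lemma powr_le_powr_comparable:
  fixes X Y W :: real
  assumes "1 \<le> X" "1 \<le> Y" "1 \<le> W" "X \<le> W * Y" "Y \<le> W * X"
  shows "X powr a \<le> W powr \<bar>a\<bar> * Y powr a"
proof (cases "a \<ge> 0")
  case True
  then have "X powr a \<le> (W * Y) powr a"
    using assms by (intro powr_mono2) auto
  with True assms show ?thesis by (simp add: powr_mult)
next
  case False
  then have "Y powr (- a) \<le> (W * X) powr (- a)"
    using assms by (intro powr_mono2) auto
  then have "Y powr (- a) \<le> W powr (- a) * X powr (- a)"
    using assms by (simp add: powr_mult)
  with False assms show ?thesis
    by (simp add: powr_minus field_simps)
qed

text \<open>When both bases lie between 1 and \<open>W\<close>, even mismatched exponents cost only
  a power of \<open>W\<close>. This serves the case where \<open>t\<close> and \<open>R\<close> lie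
  on the same side of 1.\<close>

lemma powr_le_powr_bounded:
  fixes X Y W :: real
  assumes "1 \<le> X" "1 \<le> Y" "X \<le> W" "Y \<le> W"
  shows "X powr a \<le> W powr (\<bar>a\<bar> + \<bar>b\<bar>) * Y powr b"
proof -
  have "X powr a \<le> W powr \<bar>a\<bar>"
    using assms by (intro order_trans[OF powr_mono[of a "\<bar>a\<bar>"] powr_mono2]) auto
  moreover have "1 \<le> W powr \<bar>b\<bar> * Y powr b"
    using powr_le_powr_comparable[of 1 Y W b] mult_mono[of 1 W 1 Y] assms by simp
  ultimately have "X powr a * 1 \<le> W powr \<bar>a\<bar> * (W powr \<bar>b\<bar> * Y powr b)"
    using assms by (intro mult_mono) auto
  then show ?thesis by (simp add: powr_add mult.assoc)
qed

text \<open>\<open>1 + y\<close> is at most \<open>k * exp (c * y)\<close> for any small rate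
  \<open>c\<close>, and raising to the power \<open>M\<close> gives the rate
  \<open>c * M \<le> \<delta>\<close>. Dividing by \<open>M + 1\<close> in \<open>c\<close> covers
  \<open>M = 0\<close> as well.\<close>

lemma one_plus_powr_le_exp:
  fixes M \<delta> :: real
  assumes "M \<ge> 0" "\<delta> > 0"
  shows "\<exists>K>0. \<forall>y\<ge>0. (1 + y) powr M \<le> K * exp (\<delta> * y)"
proof -
  define c where "c = \<delta> / (M + 1)"
  have c: "c > 0" "c * M \<le> \<delta>"
    using assms by (auto simp: c_def field_simps)
  define k where "k = max 1 (1 / c)"
  have k: "k \<ge> 1" "k * c \<ge> 1"
    using c by (auto simp: k_def max_def field_simps)
  have "(1 + y) powr M \<le> k powr M * exp (\<delta> * y)" if y: "y \<ge> 0" for y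
  proof -
    have "1 + y \<le> k + (k * c) * y"
      using k mult_right_mono[OF k(2) y] by simp
    also have "\<dots> = k * (1 + c * y)" by (simp add: algebra_simps)
    also have "\<dots> \<le> k * exp (c * y)"
      using k by (intro mult_left_mono exp_ge_add_one_self) auto
    finally have "(1 + y) powr M \<le> (k * exp (c * y)) powr M"
      using y assms by (intro powr_mono2) auto
    also have "\<dots> = k powr M * exp (c * M * y)"
      using k by (simp add: powr_mult exp_powr_real mult_ac)
    also have "\<dots> \<le> k powr M * exp (\<delta> * y)"
      using c y by (intro mult_left_mono) (auto intro: mult_right_mono)
    finally show ?thesis .
  qed
  moreover have "k powr M > 0" using k by simp
  ultimately show ?thesis by blast
qed

text \<open>For \<open>t = u / R ^ n\<close>, the quantities \<open>1 + \<bar>ln t\<bar>\<close> and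
  \<open>1 + \<bar>ln R\<bar>\<close> are comparable up to
  \<open>W = n * (1 + \<bar>ln u\<bar>)\<close>, and a power of \<open>W\<close> is absorbed by the
  exponential. If \<open>t\<close> and \<open>R\<close> lie on opposite sides of 1, the swap makes
  the exponents match.\<close>

lemma broken_log_scale:
  fixes \<delta> :: real
  assumes \<delta>: "\<delta> > 0" and n: "n \<ge> 1"
  shows "\<exists>K>0. \<forall>R>0. \<forall>u>0. broken_log A (u / R ^ n)
    \<le> K * broken_log (prod.swap A) R * exp (\<delta> * \<bar>ln u\<bar>)"
proof -
  define \<alpha> \<beta> where "\<alpha> = fst A" and "\<beta> = snd A"
  define M where "M = \<bar>\<alpha>\<bar> + \<bar>\<beta>\<bar>"
  obtain K where K: "K > 0" "\<And>y. y \<ge> 0 \<Longrightarrow> (1 + y) powr M \<le> K * exp (\<delta> * y)"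
    using one_plus_powr_le_exp[of M \<delta>] \<delta> by (auto simp: M_def)
  have "broken_log A (u / R ^ n) \<le> (real n powr M * K) * broken_log (prod.swap A) R * exp (\<delta> * \<bar>ln u\<bar>)"
    if R: "R > 0" and u: "u > 0" for R u :: real
  proof -
    define t where "t = u / R ^ n"
    define X where "X = 1 + \<bar>ln t\<bar>"
    define Y where "Y = 1 + \<bar>ln R\<bar>"
    define W where "W = real n * (1 + \<bar>ln u\<bar>)"
    have t: "t > 0" using R u by (simp add: t_def)
    have ln_t: "ln t = ln u - real n * ln R"
      using R u by (simp add: t_def ln_div ln_realpow)
    have n1: "real n \<ge> 1" using n by simp
    have ge: "X \<ge> 1" "Y \<ge> 1" by (simp_all add: X_def Y_def)
    have nR: "\<bar>ln R\<bar> \<le> real n * \<bar>ln R\<bar>"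
      using mult_right_mono[OF n1, of "\<bar>ln R\<bar>"] by simp
    have nu: "\<bar>ln u\<bar> \<le> real n * \<bar>ln u\<bar>"
      using mult_right_mono[OF n1, of "\<bar>ln u\<bar>"] by simp
    have W_ge: "1 + \<bar>ln u\<bar> \<le> W"
      using n1 nu by (simp add: W_def algebra_simps)
    then have W1: "W \<ge> 1" by linarith
    have XW: "X \<le> W * Y"
    proof -
      have "\<bar>ln t\<bar> \<le> \<bar>ln u\<bar> + real n * \<bar>ln R\<bar>"
        unfolding ln_t using abs_triangle_ineq4[of "ln u" "real n * ln R"] by (simp add: abs_mult)
      moreover have "W * Y = W + real n * \<bar>ln R\<bar> + real n * (\<bar>ln u\<bar> * \<bar>ln R\<bar>)"
        by (simp add: W_def Y_def algebra_simps)
      moreover have "0 \<le> real n * (\<bar>ln u\<bar> * \<bar>ln R\<bar>)" by simp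
      ultimately show ?thesis using W_ge unfolding X_def by linarith
    qed
    have YW: "Y \<le> W * X"
    proof -
      have "real n * \<bar>ln R\<bar> = \<bar>ln u - ln t\<bar>"
        unfolding ln_t by (simp add: abs_mult)
      then have "\<bar>ln R\<bar> \<le> \<bar>ln u\<bar> + \<bar>ln t\<bar>" using nR by linarith
      moreover have "W * X = W + W * \<bar>ln t\<bar>" by (simp add: X_def algebra_simps)
      moreover have "1 * \<bar>ln t\<bar> \<le> W * \<bar>ln t\<bar>" using W1 by (intro mult_right_mono) auto
      ultimately show ?thesis using W_ge unfolding Y_def by linarith
    qed
    have mono: "W powr \<bar>a\<bar> * y \<le> W powr M * y" if "\<bar>a\<bar> \<le> M" "0 \<le> y" for a y
      using that W1 by (intro mult_right_mono powr_mono) auto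
    have X_def': "broken_log A t = X powr (if t \<le> 1 then \<alpha> else \<beta>)"
      by (simp add: broken_log_def X_def \<alpha>_def \<beta>_def)
    have Y_def': "broken_log (prod.swap A) R = Y powr (if R \<le> 1 then \<beta> else \<alpha>)"
      by (simp add: broken_log_def Y_def \<alpha>_def \<beta>_def)
    have main: "broken_log A t \<le> W powr M * broken_log (prod.swap A) R"
    proof -
      consider "t \<le> 1" "R > 1" | "t > 1" "R \<le> 1" | "t \<le> 1 \<and> R \<le> 1 \<or> t > 1 \<and> R > 1"
        by linarith
      then show ?thesis
      proof cases
        case 1
        then show ?thesis
          unfolding X_def' Y_def' using powr_le_powr_comparable[OF ge W1 XW YW, of \<alpha>] mono[of \<alpha> "Y powr \<alpha>"]
          by (simp add: M_def)
      next
        case 2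
        then show ?thesis
          unfolding X_def' Y_def' using powr_le_powr_comparable[OF ge W1 XW YW, of \<beta>] mono[of \<beta> "Y powr \<beta>"]
          by (simp add: M_def)
      next
        case 3
        \<comment> \<open>Here the exponents do not match, but \<open>ln t\<close> and
          \<open>ln R\<close> have the same sign, so nothing cancels in \<open>ln u\<close> and both
          logarithms are controlled by \<open>\<bar>ln u\<bar>\<close>.\<close>
        have eq: "\<bar>ln u\<bar> = \<bar>ln t\<bar> + real n * \<bar>ln R\<bar>"
        proof -
          have u_eq: "ln u = ln t + real n * ln R" by (simp add: ln_t)
          from 3 show ?thesis
          proof
            assume "t \<le> 1 \<and> R \<le> 1"
            then have "ln t \<le> 0" "ln R \<le> 0" using t R by auto
            moreover from this have "real n * ln R \<le> 0" by (simp add: mult_nonneg_nonpos)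
            ultimately show ?thesis by (simp add: u_eq)
          next
            assume "t > 1 \<and> R > 1"
            then have "ln t > 0" "ln R > 0" by auto
            moreover from this have "real n * ln R \<ge> 0" by simp
            ultimately show ?thesis by (simp add: u_eq)
          qed
        qed
        have XY: "X \<le> W" "Y \<le> W"
          using eq W_ge nR unfolding X_def Y_def by linarith+
        show ?thesis
          unfolding X_def' Y_def' M_def
          using 3 powr_le_powr_bounded[OF ge XY, of \<alpha> \<beta>] powr_le_powr_bounded[OF ge XY, of \<beta> \<alpha>]
          by (auto simp: add.commute)
      qed
    qed
    have "W powr M = real n powr M * (1 + \<bar>ln u\<bar>) powr M"
      by (simp add: W_def powr_mult)
    also have "\<dots> \<le> real n powr M * (K * exp (\<delta> * \<bar>ln u\<bar>))"
      by (intro mult_left_mono K) auto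
    finally have "W powr M * broken_log (prod.swap A) R \<le> real n powr M * (K * exp (\<delta> * \<bar>ln u\<bar>)) * broken_log (prod.swap A) R"
      by (intro mult_right_mono less_imp_le[OF broken_log_pos])
    with main show ?thesis by (simp add: t_def mult_ac)
  qed
  moreover have "real n powr M * K > 0" using K n by simp
  ultimately show ?thesis by blast
qed

lemma exp_abs_ln:
  fixes u :: real
  assumes "u > 0"
  shows "u \<le> 1 \<Longrightarrow> exp (\<delta> * \<bar>ln u\<bar>) = u powr (- \<delta>)" "1 \<le> u \<Longrightarrow> exp (\<delta> * \<bar>ln u\<bar>) = u powr \<delta>"
  using assms by (auto simp: powr_def abs_of_nonpos abs_of_nonneg)

section \<open>Extended-valued powers and the weak-type bound\<close>

lemma recip_ennreal: "x > 0 \<Longrightarrow> recip (ennreal x) = 1 / x"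
  unfolding recip_def by (simp add: divide_ennreal[of 1 x, simplified])

lemma recip_top: "recip \<top> = 0"
  by (simp add: recip_def)

lemma epowr_mono:
  assumes "x \<le> y" "a > 0"
  shows "epowr x a \<le> epowr y a"
proof (cases y)
  case (real r)
  then obtain r' where "x = ennreal r'" "0 \<le> r'" "r' \<le> r"
    using assms(1) by (cases x) (auto simp: top_unique)
  with real assms show ?thesis by (auto simp: epowr_def intro!: ennreal_leI powr_mono2)
qed (simp add: epowr_def)

lemma epowr_mult:
  assumes "y > 0" "a > 0"
  shows "epowr (x * ennreal y) a = epowr x a * ennreal (y powr a)"
proof (cases x)
  case (real r)
  then show ?thesis
    using assms by (simp add: epowr_def ennreal_mult[symmetric] powr_mult ennreal_mult_eq_top_iff)
next
  case top
  then show ?thesis using assms by (simp add: epowr_def ennreal_top_mult)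
qed

lemma epowr_epowr_inverse:
  assumes "a > 0"
  shows "epowr (epowr x a) (1 / a) = x"
  using assms by (cases x) (simp_all add: epowr_def powr_powr)

lemma AE_lebesgue_on_Ioi_iff: "(AE t in lebesgue_on {0<..}. P t) \<longleftrightarrow> (AE t in lborel. 0 < t \<longrightarrow> P (t::real))"
proof -
  have "(AE t in lebesgue_on {0<..}. P t) \<longleftrightarrow> (AE t in lebesgue. t \<in> {0<..} \<longrightarrow> P t)"
    by (rule AE_restrict_space_iff) auto
  then show ?thesis by (simp add: AE_completion_iff)
qed

lemma nn_integral_lebesgue_on_Ioi:
  assumes [measurable]: "g \<in> borel_measurable borel"
  shows "(\<integral>\<^sup>+t. g t \<partial>lebesgue_on {0<..}) = (\<integral>\<^sup>+t. g t * indicator {0<..} (t::real) \<partial>lborel)"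
proof -
  have "(\<integral>\<^sup>+t. g t \<partial>lebesgue_on {0<..}) = (\<integral>\<^sup>+t. g t * indicator {0<..} t \<partial>lebesgue)"
    by (rule nn_integral_restrict_space) auto
  also have "\<dots> = (\<integral>\<^sup>+t. g t * indicator {0<..} t \<partial>lborel)"
    by (rule nn_integral_completion)
  finally show ?thesis .
qed

lemma borel_measurable_broken_log[measurable]: "broken_log A \<in> borel_measurable borel"
  unfolding broken_log_def by measurable

lemma borel_measurable_epowr[measurable]: "(\<lambda>x. epowr x a) \<in> borel_measurable borel"
  unfolding epowr_def by measurable

lemma ennreal_le_if_mult_le:
  assumes "w > 0" "ennreal w * x \<le> y"
  shows "x \<le> ennreal (1 / w) * y"
proof -
  have "x = ennreal (1 / w) * (ennreal w * x)"
    using assms(1) by (simp add: mult.assoc[symmetric] ennreal_mult[symmetric])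
  also have "\<dots> \<le> ennreal (1 / w) * y"
    using assms(2) by (intro mult_left_mono) auto
  finally show ?thesis .
qed

text \<open>The logarithmic part is \<open>broken_log_scale\<close> with n = 1,
  \<open>R = 1 / s\<close> and \<open>u = t / s\<close>; there the exponential loss equals
  \<open>t / s\<close>, at most 2, and the two swaps cancel.\<close>

lemma weight_comparable:
  fixes e :: real
  shows "\<exists>k>0. \<forall>t>0. \<forall>s\<in>{t/2..t}. k * (t powr e * broken_log B t) \<le> s powr e * broken_log B s"
proof -
  obtain K where K: "K > 0" "\<And>R u. R > 0 \<Longrightarrow> u > 0 \<Longrightarrow>
      broken_log B (u / R ^ 1) \<le> K * broken_log (prod.swap B) R * exp (1 * \<bar>ln u\<bar>)"
    using broken_log_scale[of 1 1 B] by auto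
  have le: "t powr e * broken_log B t \<le> (2 powr \<bar>e\<bar> * K * 2) * (s powr e * broken_log B s)"
    if t: "t > 0" and s: "s \<in> {t/2..t}" for t s
  proof -
    have s0: "s > 0" using t s by auto
    define v where "v = t / s"
    have v: "1 \<le> v" "v \<le> 2" using s s0 by (auto simp: v_def field_simps)
    have "v powr e \<le> 2 powr \<bar>e\<bar>"
      using v by (intro order_trans[OF powr_mono[of e "\<bar>e\<bar>"] powr_mono2]) auto
    then have "t powr e \<le> 2 powr \<bar>e\<bar> * s powr e"
      using s0 t by (simp add: v_def powr_divide field_simps)
    moreover have "broken_log B t \<le> K * broken_log B s * 2"
    proof -
      have "broken_log B t \<le> K * broken_log (prod.swap B) (1 / s) * exp (1 * \<bar>ln v\<bar>)"
        using K(2)[of "1 / s" v] s0 v by (simp add: v_def)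
      also have "\<dots> = K * broken_log B s * v"
        using broken_log_swap_inverse[OF s0] exp_abs_ln(2)[of v 1] v by simp
      also have "\<dots> \<le> K * broken_log B s * 2"
        using v K less_imp_le[OF broken_log_pos, of B s] by (intro mult_left_mono) auto
      finally show ?thesis .
    qed
    ultimately have "t powr e * broken_log B t \<le> (2 powr \<bar>e\<bar> * s powr e) * (K * broken_log B s * 2)"
      using less_imp_le[OF broken_log_pos, of B t] by (intro mult_mono) auto
    then show ?thesis by (simp add: mult_ac)
  qed
  define L where "L = 2 powr \<bar>e\<bar> * K * 2"
  have "L > 0" using K by (simp add: L_def)
  then have "(1 / L) * (t powr e * broken_log B t) \<le> s powr e * broken_log B s" if "t > 0" "s \<in> {t/2..t}" for t s
    using le[OF that, folded L_def] by (simp add: field_simps)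
  then show ?thesis
    using \<open>L > 0\<close> by (intro exI[of _ "1 / L"]) auto
qed

text \<open>For finite \<open>c\<close> the norm is at least its part over \<open>[t/2, t]\<close>,
  where the rearrangement is no smaller than at \<open>t\<close> and the weight is comparable to its
  value at \<open>t\<close>. The interval's length supplies \<open>t powr (1 / c)\<close>, turning
  the exponent 1/q - 1/c into 1/q. For infinite \<open>c\<close> the bound is read off the essential
  supremum, hence only almost everywhere.\<close>

lemma rearrangement_weak_bound:
  fixes q c :: ennreal
  assumes c: "0 < c"
  shows "\<exists>K>0. \<forall>f::'a::euclidean_space \<Rightarrow> complex. AE t in lborel. 0 < t \<longrightarrow>
    rearrangement f t \<le> ennreal (K * t powr (- recip q) * broken_log (- B) t) * LZ_norm q c B f"
proof (cases "c = \<infinity>")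
  case True
  have "AE t in lborel. 0 < t \<longrightarrow> rearrangement f t
      \<le> ennreal (1 * t powr (- recip q) * broken_log (- B) t) * LZ_norm q c B f" for f :: "'a \<Rightarrow> complex"
  proof -
    have "AE t in lebesgue_on {0<..}. ennreal (t powr (recip q - recip c) * broken_log B t) * rearrangement f t \<le> LZ_norm q c B f"
      using True unfolding LZ_norm_def Lb_norm_def by (simp add: esssup_AE)
    then have "AE t in lborel. 0 < t \<longrightarrow> ennreal (t powr (recip q - recip c) * broken_log B t) * rearrangement f t \<le> LZ_norm q c B f"
      by (simp only: AE_lebesgue_on_Ioi_iff)
    then show ?thesis
    proof eventually_elim
      case (elim t)
      show ?case
      proof
        assume t: "0 < t"
        have w: "t powr recip q * broken_log B t > 0" using t broken_log_pos[of B t] by simp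
        have "ennreal (t powr recip q * broken_log B t) * rearrangement f t \<le> LZ_norm q c B f"
          using elim t True by (simp add: recip_top)
        from ennreal_le_if_mult_le[OF w this]
        show "rearrangement f t \<le> ennreal (1 * t powr (- recip q) * broken_log (- B) t) * LZ_norm q c B f"
          by (simp add: powr_minus broken_log_uminus divide_inverse)
      qed
    qed
  qed
  then show ?thesis by (intro exI[of _ 1]) auto
next
  case False
  then obtain c' where c': "c = ennreal c'" "c' > 0"
    using c by (cases c) auto
  define e where "e = recip q - recip c"
  obtain k where k: "k > 0" "\<And>t s. t > 0 \<Longrightarrow> s \<in> {t/2..t} \<Longrightarrow>
      k * (t powr e * broken_log B t) \<le> s powr e * broken_log B s"
    using weight_comparable[of e B] by blast
  define K where "K = 2 powr (1 / c') / k"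
  have "rearrangement f t \<le> ennreal (K * t powr (- recip q) * broken_log (- B) t) * LZ_norm q c B f"
    if t: "t > 0" for f :: "'a \<Rightarrow> complex" and t
  proof -
    define w where "w = k * (t powr e * broken_log B t)"
    have w: "w > 0" using k t broken_log_pos[of B t] by (simp add: w_def)
    define m where "m = ennreal w * rearrangement f t"
    define g where "g s = ennreal (s powr e * broken_log B s) * rearrangement f s" for s
    have [measurable]: "g \<in> borel_measurable borel" unfolding g_def by measurable
    have "epowr m c' * ennreal (t / 2) = (\<integral>\<^sup>+s. epowr m c' * indicator {t/2..t} s \<partial>lborel)"
      using t by (simp add: nn_integral_cmult_indicator)
    also have "\<dots> \<le> (\<integral>\<^sup>+s. epowr (g s) c' * indicator {0<..} s \<partial>lborel)"
    proof (rule nn_integral_mono)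
      fix s :: real
      show "epowr m c' * indicator {t/2..t} s \<le> epowr (g s) c' * indicator {0<..} s"
      proof (cases "s \<in> {t/2..t}")
        case True
        have "m \<le> g s"
          unfolding m_def g_def w_def
          by (rule mult_mono[OF ennreal_leI[OF k(2)[OF t True]] rearrangement_antimono]) (use True in auto)
        then show ?thesis using True t c' by (auto intro: epowr_mono)
      qed simp
    qed
    also have "\<dots> = (\<integral>\<^sup>+s. epowr (g s) c' \<partial>lebesgue_on {0<..})"
      by (rule nn_integral_lebesgue_on_Ioi[symmetric]) measurable
    finally have "epowr (epowr m c' * ennreal (t / 2)) (1 / c') \<le> epowr (\<integral>\<^sup>+s. epowr (g s) c' \<partial>lebesgue_on {0<..}) (1 / c')"
      using c' by (intro epowr_mono) auto
    also have "\<dots> = LZ_norm q c B f"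
      using c' False recip_ennreal[of c'] unfolding LZ_norm_def Lb_norm_def g_def e_def by simp
    also have "epowr (epowr m c' * ennreal (t / 2)) (1 / c') = m * ennreal ((t / 2) powr (1 / c'))"
      using t c' by (subst epowr_mult) (auto simp: epowr_epowr_inverse)
    also have "\<dots> = ennreal (w * (t / 2) powr (1 / c')) * rearrangement f t"
      using w by (simp add: m_def ennreal_mult mult_ac)
    finally have "ennreal (w * (t / 2) powr (1 / c')) * rearrangement f t \<le> LZ_norm q c B f" .
    then have "rearrangement f t \<le> ennreal (1 / (w * (t / 2) powr (1 / c'))) * LZ_norm q c B f"
      using w t by (intro ennreal_le_if_mult_le) auto
    also have "1 / (w * (t / 2) powr (1 / c')) = K * t powr (- recip q) * broken_log (- B) t"
    proof -
      have "t powr e * t powr (1 / c') = t powr recip q"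
        using c' by (simp add: powr_add[symmetric] e_def recip_ennreal)
      then have eq: "w * (t / 2) powr (1 / c') = k / 2 powr (1 / c') * t powr recip q * broken_log B t"
        using t by (simp add: w_def powr_divide mult_ac)
      show ?thesis
        unfolding eq by (simp add: K_def powr_minus broken_log_uminus field_simps)
    qed
    finally show ?thesis .
  qed
  moreover have "K > 0" using k by (simp add: K_def)
  ultimately show ?thesis by (intro exI[of _ K]) auto
qed

section \<open>Power integrals and the resulting norm estimates\<close>

lemma nn_integral_powr_from_0:
  assumes "e > -1" "0 \<le> a"
  shows "(\<integral>\<^sup>+t. ennreal (t powr e) * indicator {0..a} t \<partial>lborel) = ennreal (a powr (e + 1) / (e + 1))"
  by (rule nn_integral_has_integral_lebesgue'[OF _ has_integral_powr_from_0]) (use assms in auto)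

lemma nn_integral_powr_to_inf:
  assumes "e < -1" "0 < a"
  shows "(\<integral>\<^sup>+t. ennreal (t powr e) * indicator {a..} t \<partial>lborel) = ennreal (- (a powr (e + 1)) / (e + 1))"
  by (rule nn_integral_has_integral_lebesgue'[OF _ has_integral_powr_to_inf]) (use assms in auto)

text \<open>The exponential is \<open>(t / a) powr s\<close> below \<open>a\<close> and
  \<open>(t / a) powr (- s)\<close> above it; each half contributes 1/s, whatever the centre
  \<open>a\<close>.\<close>

lemma nn_integral_two_sided_power:
  assumes s: "s > 0" and a: "a > 0"
  shows "(\<integral>\<^sup>+t. ennreal (t powr (-1) * exp (- s * \<bar>ln (t / a)\<bar>)) * indicator {0<..} t \<partial>lborel) \<le> ennreal (2 / s)"
proof -
  have "(\<integral>\<^sup>+t. ennreal (t powr (-1) * exp (- s * \<bar>ln (t / a)\<bar>)) * indicator {0<..} t \<partial>lborel)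
      \<le> (\<integral>\<^sup>+t. ennreal (a powr (- s)) * (ennreal (t powr (s - 1)) * indicator {0..a} t)
          + ennreal (a powr s) * (ennreal (t powr (- s - 1)) * indicator {a..} t) \<partial>lborel)"
  proof (rule nn_integral_mono)
    fix t :: real
    show "ennreal (t powr (-1) * exp (- s * \<bar>ln (t / a)\<bar>)) * indicator {0<..} t
      \<le> ennreal (a powr (- s)) * (ennreal (t powr (s - 1)) * indicator {0..a} t)
          + ennreal (a powr s) * (ennreal (t powr (- s - 1)) * indicator {a..} t)"
    proof (cases "t > 0")
      case True
      show ?thesis
      proof (cases "t \<le> a")
        case le: True
        have "exp (- s * \<bar>ln (t / a)\<bar>) = (t / a) powr s"
          using exp_abs_ln(1)[of "t / a" "- s"] le True a by simp
        then have "t powr (-1) * exp (- s * \<bar>ln (t / a)\<bar>) = a powr (- s) * t powr (s - 1)"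
          using True a by (simp add: powr_divide powr_diff powr_minus field_simps)
        then show ?thesis
          using True le by (simp add: ennreal_mult)
      next
        case False
        have "exp (- s * \<bar>ln (t / a)\<bar>) = (t / a) powr (- s)"
          using exp_abs_ln(2)[of "t / a" "- s"] False True a by simp
        then have "t powr (-1) * exp (- s * \<bar>ln (t / a)\<bar>) = a powr s * t powr (- s - 1)"
          using True a by (simp add: powr_divide powr_diff powr_minus field_simps)
        then show ?thesis
          using True False by (simp add: ennreal_mult)
      qed
    qed simp
  qed
  also have "\<dots> = ennreal (a powr (- s)) * ennreal (a powr s / s) + ennreal (a powr s) * ennreal (a powr (- s) / s)"
    using s a nn_integral_powr_from_0[of "s - 1" a] nn_integral_powr_to_inf[of "- s - 1" a]
    by (subst nn_integral_add) (auto simp: nn_integral_cmult)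
  also have "\<dots> = ennreal (2 / s)"
    using s a by (simp add: ennreal_mult[symmetric] ennreal_plus[symmetric] powr_minus del: ennreal_plus)
  finally show ?thesis .
qed

text \<open>For \<open>q = 1\<close> the norm is the integral of the rearrangement over the
  half-line, and both the power of \<open>R\<close> and the logarithm are 1. For
  \<open>q > 1\<close> the weak-type bound is integrated up to \<open>1 / R ^ n\<close>.\<close>

lemma rearrangement_integral_bound:
  fixes q c :: ennreal
  assumes "(q = 1 \<and> c = 1 \<and> B = (0, 0)) \<or> (1 < q \<and> q < \<infinity> \<and> 0 < c)" and n: "n \<ge> 1"
  shows "\<exists>K>0. \<forall>R>0. \<forall>f::'a::euclidean_space \<Rightarrow> complex.
    (\<integral>\<^sup>+t. indicator {0<..<1 / R ^ n} t * rearrangement f t \<partial>lborel)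
      \<le> ennreal (K * R powr (real n * (recip q - 1)) * broken_log (- prod.swap B) R) * LZ_norm q c B f"
  using assms(1)
proof
  assume *: "q = 1 \<and> c = 1 \<and> B = (0, 0)"
  have r1: "recip 1 = 1" using recip_ennreal[of 1] by simp
  have norm_eq: "LZ_norm q c B f = (\<integral>\<^sup>+t. rearrangement f t * indicator {0<..} t \<partial>lborel)" for f :: "'a \<Rightarrow> complex"
  proof -
    have e1: "epowr x 1 = x" for x
      using epowr_epowr_inverse[of 1 x] by (cases x) (auto simp: epowr_def)
    have "LZ_norm q c B f = (\<integral>\<^sup>+t. ennreal (t powr 0) * rearrangement f t \<partial>lebesgue_on {0<..})"
      using * r1 by (simp add: LZ_norm_def Lb_norm_def e1 broken_log_zero)
    also have "\<dots> = (\<integral>\<^sup>+t. (ennreal (t powr 0) * rearrangement f t) * indicator {0<..} t \<partial>lborel)"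
      by (rule nn_integral_lebesgue_on_Ioi) measurable
    also have "\<dots> = (\<integral>\<^sup>+t. rearrangement f t * indicator {0<..} t \<partial>lborel)"
      by (intro nn_integral_cong) (auto simp: indicator_def)
    finally show ?thesis .
  qed
  have "(\<integral>\<^sup>+t. indicator {0<..<1 / R ^ n} t * rearrangement f t \<partial>lborel)
      \<le> ennreal (1 * R powr (real n * (recip q - 1)) * broken_log (- prod.swap B) R) * LZ_norm q c B f"
    if "R > 0" for R and f :: "'a \<Rightarrow> complex"
  proof -
    have "- prod.swap B = (0, 0)" using * by simp
    then have "broken_log (- prod.swap B) R = 1" by (simp only: broken_log_zero)
    then have "ennreal (1 * R powr (real n * (recip q - 1)) * broken_log (- prod.swap B) R) = 1"
      using * r1 that by simp
    moreover have "(\<integral>\<^sup>+t. indicator {0<..<1 / R ^ n} t * rearrangement f t \<partial>lborel) \<le> LZ_norm q c B f"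
      unfolding norm_eq by (intro nn_integral_mono) (auto simp: indicator_def)
    ultimately show ?thesis by simp
  qed
  then show ?thesis by (intro exI[of _ 1]) auto
next
  assume *: "1 < q \<and> q < \<infinity> \<and> 0 < c"
  then obtain q' where q': "q = ennreal q'" "q' > 1"
    by (cases q) (auto simp: ennreal_less_iff[of 1, simplified])
  define \<rho> where "\<rho> = recip q"
  have \<rho>: "0 < \<rho>" "\<rho> < 1" using q' by (auto simp: \<rho>_def recip_ennreal)
  \<comment> \<open>Half of the room between \<open>- \<rho>\<close> and -1 is spent on the
    logarithm. Integration then returns \<open>a powr \<delta>\<close>, which with the
    \<open>a powr \<delta>\<close> stored in \<open>D\<close> gives
    \<open>a powr (1 - \<rho>)\<close>.\<close>
  define \<delta> where "\<delta> = (1 - \<rho>) / 2"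
  have \<delta>: "\<delta> > 0" "- \<rho> - \<delta> > - 1" using \<rho> by (auto simp: \<delta>_def field_simps)
  obtain K where K: "K > 0" "\<And>f::'a \<Rightarrow> complex. AE t in lborel. 0 < t \<longrightarrow>
      rearrangement f t \<le> ennreal (K * t powr (- \<rho>) * broken_log (- B) t) * LZ_norm q c B f"
    using rearrangement_weak_bound[of c q B] * unfolding \<rho>_def by blast
  obtain L where L: "L > 0" "\<And>R u. R > 0 \<Longrightarrow> u > 0 \<Longrightarrow>
      broken_log (- B) (u / R ^ n) \<le> L * broken_log (prod.swap (- B)) R * exp (\<delta> * \<bar>ln u\<bar>)"
    using broken_log_scale[OF \<delta>(1) n, of "- B"] by blast
  have swap: "prod.swap (- B) = - prod.swap B" by (cases B) simp
  have "(\<integral>\<^sup>+t. indicator {0<..<1 / R ^ n} t * rearrangement f t \<partial>lborel)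
      \<le> ennreal ((K * L / \<delta>) * R powr (real n * (\<rho> - 1)) * broken_log (- prod.swap B) R) * LZ_norm q c B f"
    if R: "R > 0" for R and f :: "'a \<Rightarrow> complex"
  proof -
    define a where "a = 1 / R ^ n"
    have a: "a > 0" using R by (simp add: a_def)
    define D where "D = K * L * broken_log (- prod.swap B) R * a powr \<delta>"
    have D: "D > 0" using K L a broken_log_pos[of "- prod.swap B" R] by (simp add: D_def)
    have "(\<integral>\<^sup>+t. indicator {0<..<a} t * rearrangement f t \<partial>lborel)
        \<le> (\<integral>\<^sup>+t. (ennreal D * LZ_norm q c B f) * (ennreal (t powr (- \<rho> - \<delta>)) * indicator {0..a} t) \<partial>lborel)"
    proof (rule nn_integral_mono_AE)
      show "AE t in lborel. indicator {0<..<a} t * rearrangement f t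
          \<le> (ennreal D * LZ_norm q c B f) * (ennreal (t powr (- \<rho> - \<delta>)) * indicator {0..a} t)"
        using K(2)[of f]
      proof eventually_elim
        case (elim t)
        show ?case
        proof (cases "t \<in> {0<..<a}")
          case True
          define u where "u = t / a"
          have u: "0 < u" "u \<le> 1" "u / R ^ n = t"
            using True a R by (auto simp: u_def a_def field_simps)
          have "broken_log (- B) t \<le> L * broken_log (- prod.swap B) R * u powr (- \<delta>)"
            using L(2)[OF R u(1)] exp_abs_ln(1)[OF u(1,2)] by (simp add: u(3) swap)
          then have "K * t powr (- \<rho>) * broken_log (- B) t
              \<le> K * t powr (- \<rho>) * (L * broken_log (- prod.swap B) R * u powr (- \<delta>))"
            using K by (intro mult_left_mono) auto
          also have "\<dots> = D * t powr (- \<rho> - \<delta>)"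
            using True a by (simp add: D_def u_def powr_divide powr_diff powr_minus field_simps)
          finally have "ennreal (K * t powr (- \<rho>) * broken_log (- B) t) * LZ_norm q c B f
              \<le> ennreal (D * t powr (- \<rho> - \<delta>)) * LZ_norm q c B f"
            by (intro mult_right_mono ennreal_leI) auto
          then show ?thesis
            using elim True D by (auto simp: ennreal_mult mult_ac)
        qed simp
      qed
    qed
    also have "\<dots> = (ennreal D * LZ_norm q c B f) * ennreal (a powr (- \<rho> - \<delta> + 1) / (- \<rho> - \<delta> + 1))"
      using nn_integral_powr_from_0[OF \<delta>(2), of a] a by (subst nn_integral_cmult) auto
    also have "- \<rho> - \<delta> + 1 = \<delta>" by (simp add: \<delta>_def field_simps)
    also have "(ennreal D * LZ_norm q c B f) * ennreal (a powr \<delta> / \<delta>) = ennreal (D * (a powr \<delta> / \<delta>)) * LZ_norm q c B f"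
      using D \<delta> by (subst ennreal_mult) (auto simp: mult_ac)
    also have "D * (a powr \<delta> / \<delta>) = (K * L / \<delta>) * R powr (real n * (\<rho> - 1)) * broken_log (- prod.swap B) R"
    proof -
      have "a powr \<delta> * a powr \<delta> = a powr (1 - \<rho>)"
        by (simp add: powr_add[symmetric] \<delta>_def)
      also have "\<dots> = R powr (real n * (\<rho> - 1))"
      proof -
        have "a = R powr (- real n)"
          using R by (simp add: a_def powr_minus powr_realpow inverse_eq_divide)
        then show ?thesis by (simp add: powr_powr algebra_simps)
      qed
      finally show ?thesis by (simp add: D_def)
    qed
    finally show ?thesis by (simp add: a_def)
  qed
  moreover have "K * L / \<delta> > 0" using K L \<delta> by simp
  ultimately show ?thesis unfolding \<rho>_def by blast
qed

text \<open>The factor \<open>R ^ n\<close> of the smoothing estimate times R^(n (1/q - 1)) of the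
  integral bound is R^(n/q). This is the endpoint \<open>p = \<infinity>\<close>, and for finite
  \<open>p\<close> it controls small \<open>t\<close>.\<close>

lemma bandlimited_sup_bound:
  fixes q c :: ennreal
  assumes qc: "(q = 1 \<and> c = 1 \<and> B = (0, 0)) \<or> (1 < q \<and> q < \<infinity> \<and> 0 < c)"
  shows "\<exists>C>0. \<forall>R>0. \<forall>f\<in>(LZ_bandlimited R q c B :: ('a::euclidean_space \<Rightarrow> complex) set). \<forall>t.
    rearrangement f t \<le> ennreal (C * R powr (real DIM('a) * recip q) * broken_log (- prod.swap B) R) * LZ_norm q c B f"
proof -
  have n: "DIM('a) \<ge> 1" by (simp add: Suc_leI)
  obtain K where K: "K > 0" "\<And>R (f::'a \<Rightarrow> complex). R > 0 \<Longrightarrow>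
      (\<integral>\<^sup>+t. indicator {0<..<1 / R ^ DIM('a)} t * rearrangement f t \<partial>lborel)
      \<le> ennreal (K * R powr (real DIM('a) * (recip q - 1)) * broken_log (- prod.swap B) R) * LZ_norm q c B f"
    using rearrangement_integral_bound[OF qc n, where 'a = 'a] by blast
  obtain C where C: "C > 0" "\<And>R I (f::'a \<Rightarrow> complex). R > 0 \<Longrightarrow> I \<ge> 0 \<Longrightarrow> f \<in> borel_measurable lebesgue \<Longrightarrow>
     distr_support (fourier_distr (distr_of f)) \<subseteq> cball 0 R \<Longrightarrow>
     (\<integral>\<^sup>+u. indicator {0<..<1 / R ^ DIM('a)} u * rearrangement f u \<partial>lborel) \<le> ennreal I \<Longrightarrow>
     (\<forall>t. rearrangement f t \<le> ennreal (C * R ^ DIM('a) * I))"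
    using bandlimited_rearrangement_bound[where 'a = 'a] by blast
  have "rearrangement f t \<le> ennreal ((C * K) * R powr (real DIM('a) * recip q) * broken_log (- prod.swap B) R) * LZ_norm q c B f"
    if R: "R > 0" and f: "f \<in> LZ_bandlimited R q c B" for R t and f :: "'a \<Rightarrow> complex"
  proof -
    have f_meas: "f \<in> borel_measurable lebesgue" and fin: "LZ_norm q c B f < \<infinity>"
      and supp: "distr_support (fourier_distr (distr_of f)) \<subseteq> cball 0 R"
      using f by (auto simp: LZ_bandlimited_def LZ_space_def)
    obtain N where N: "LZ_norm q c B f = ennreal N" "N \<ge> 0"
      using fin by (cases "LZ_norm q c B f") auto
    define I where "I = K * R powr (real DIM('a) * (recip q - 1)) * broken_log (- prod.swap B) R * N"
    have l: "0 \<le> broken_log (- prod.swap B) R" using broken_log_pos less_imp_le by blast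
    have I: "I \<ge> 0" using K N l by (simp add: I_def)
    have "(\<integral>\<^sup>+t. indicator {0<..<1 / R ^ DIM('a)} t * rearrangement f t \<partial>lborel) \<le> ennreal I"
      using K(2)[OF R, of f] K(1) N l by (simp add: I_def ennreal_mult)
    then have "rearrangement f t \<le> ennreal (C * R ^ DIM('a) * I)"
      using C(2)[OF R I f_meas supp] by blast
    also have "C * R ^ DIM('a) * I = (C * K) * R powr (real DIM('a) * recip q) * broken_log (- prod.swap B) R * N"
    proof -
      have "R powr real DIM('a) * R powr (real DIM('a) * (recip q - 1)) = R powr (real DIM('a) * recip q)"
        unfolding powr_add[symmetric] by (simp add: algebra_simps)
      then have "R ^ DIM('a) * R powr (real DIM('a) * (recip q - 1)) = R powr (real DIM('a) * recip q)"
        using R by (simp add: powr_realpow)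
      then show ?thesis by (simp add: I_def mult_ac)
    qed
    finally show ?thesis
      using N K C l by (simp add: ennreal_mult)
  qed
  moreover have "C * K > 0" using C K by simp
  ultimately show ?thesis by blast
qed

text \<open>The exponent \<open>- recip b\<close> turns the \<open>L_b\<close> norm into one with
  respect to dt/t, which is invariant under dilation. The constant is therefore independent of the
  centre \<open>a\<close>, later \<open>1 / R ^ n\<close>, and so of \<open>R\<close>.\<close>

lemma Lb_norm_le_two_sided_power:
  fixes \<sigma> :: real
  assumes b: "0 < b" and \<sigma>: "0 < \<sigma>"
  shows "\<exists>Z>0. \<forall>a>0. \<forall>Y. \<forall>h \<in> borel_measurable borel. \<forall>\<pi>.
    (AE t in lborel. 0 < t \<longrightarrow> ennreal (t powr \<pi>) * h t \<le> ennreal (exp (- \<sigma> * \<bar>ln (t / a)\<bar>)) * Y) \<longrightarrow>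
    Lb_norm b (\<lambda>t. ennreal (t powr (\<pi> - recip b)) * h t) \<le> ennreal Z * Y"
proof (cases "b = \<infinity>")
  case True
  have "Lb_norm b (\<lambda>t. ennreal (t powr (\<pi> - recip b)) * h t) \<le> ennreal 1 * Y"
    if [measurable]: "h \<in> borel_measurable borel"
      and le: "AE t in lborel. 0 < t \<longrightarrow> ennreal (t powr \<pi>) * h t \<le> ennreal (exp (- \<sigma> * \<bar>ln (t / a)\<bar>)) * Y"
    for h a Y \<pi>
  proof -
    have "(\<lambda>t. ennreal (t powr \<pi>) * h t) \<in> borel_measurable lborel" by simp
    then have meas: "(\<lambda>t. ennreal (t powr \<pi>) * h t) \<in> borel_measurable (lebesgue_on {0<..})"
      by (intro measurable_restrict_space1 measurable_completion)
    have "AE t in lborel. 0 < t \<longrightarrow> ennreal (t powr \<pi>) * h t \<le> Y"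
      using le
    proof eventually_elim
      case (elim t)
      have "ennreal (exp (- \<sigma> * \<bar>ln (t / a)\<bar>)) * Y \<le> 1 * Y"
        using \<sigma> by (intro mult_right_mono) (auto simp: ennreal_le_1)
      with elim show ?case by auto
    qed
    then have "esssup (lebesgue_on {0<..}) (\<lambda>t. ennreal (t powr \<pi>) * h t) \<le> Y"
      by (intro esssup_I[OF meas]) (simp only: AE_lebesgue_on_Ioi_iff)
    then show ?thesis
      using True by (simp add: Lb_norm_def recip_top)
  qed
  then show ?thesis by (intro exI[of _ 1]) auto
next
  case False
  then obtain \<beta> where \<beta>: "b = ennreal \<beta>" "\<beta> > 0"
    using b by (cases b) auto
  \<comment> \<open>Raising to the power \<open>\<beta>\<close> multiplies the decay rate by
    \<open>\<beta>\<close>.\<close>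
  define S where "S = \<sigma> * \<beta>"
  have S: "S > 0" using \<sigma> \<beta> by (simp add: S_def)
  define Z where "Z = (2 / S) powr (1 / \<beta>)"
  have "Lb_norm b (\<lambda>t. ennreal (t powr (\<pi> - recip b)) * h t) \<le> ennreal Z * Y"
    if a: "a > 0" and [measurable]: "h \<in> borel_measurable borel"
      and le: "AE t in lborel. 0 < t \<longrightarrow> ennreal (t powr \<pi>) * h t \<le> ennreal (exp (- \<sigma> * \<bar>ln (t / a)\<bar>)) * Y"
    for h a Y \<pi>
  proof -
    define g where "g t = ennreal (t powr (\<pi> - recip b)) * h t" for t
    have [measurable]: "g \<in> borel_measurable borel" unfolding g_def by measurable
    have "(\<integral>\<^sup>+t. epowr (g t) \<beta> \<partial>lebesgue_on {0<..}) = (\<integral>\<^sup>+t. epowr (g t) \<beta> * indicator {0<..} t \<partial>lborel)"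
      by (rule nn_integral_lebesgue_on_Ioi) measurable
    also have "\<dots> \<le> (\<integral>\<^sup>+t. epowr Y \<beta> * (ennreal (t powr (-1) * exp (- S * \<bar>ln (t / a)\<bar>)) * indicator {0<..} t) \<partial>lborel)"
    proof (rule nn_integral_mono_AE)
      show "AE t in lborel. epowr (g t) \<beta> * indicator {0<..} t
          \<le> epowr Y \<beta> * (ennreal (t powr (-1) * exp (- S * \<bar>ln (t / a)\<bar>)) * indicator {0<..} t)"
        using le
      proof eventually_elim
        case (elim t)
        show ?case
        proof (cases "t > 0")
          case True
          define y where "y = t powr (- (1 / \<beta>)) * exp (- \<sigma> * \<bar>ln (t / a)\<bar>)"
          have y: "y > 0" using True by (simp add: y_def)
          have "g t = ennreal (t powr (- (1 / \<beta>))) * (ennreal (t powr \<pi>) * h t)"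
            using \<beta> True by (simp add: g_def recip_ennreal mult.assoc[symmetric] ennreal_mult[symmetric] powr_add[symmetric])
          also have "\<dots> \<le> ennreal (t powr (- (1 / \<beta>))) * (ennreal (exp (- \<sigma> * \<bar>ln (t / a)\<bar>)) * Y)"
            using elim True by (intro mult_left_mono) auto
          also have "\<dots> = Y * ennreal y"
            by (simp add: y_def ennreal_mult mult_ac)
          finally have "epowr (g t) \<beta> \<le> epowr (Y * ennreal y) \<beta>"
            using \<beta> by (intro epowr_mono) auto
          also have "\<dots> = epowr Y \<beta> * ennreal (y powr \<beta>)"
            by (rule epowr_mult[OF y \<beta>(2)])
          also have "y powr \<beta> = t powr (-1) * exp (- S * \<bar>ln (t / a)\<bar>)"
            using \<beta> True by (simp add: y_def powr_mult powr_powr exp_powr_real S_def mult_ac)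
          finally show ?thesis using True by simp
        qed simp
      qed
    qed
    also have "\<dots> = epowr Y \<beta> * (\<integral>\<^sup>+t. ennreal (t powr (-1) * exp (- S * \<bar>ln (t / a)\<bar>)) * indicator {0<..} t \<partial>lborel)"
      by (rule nn_integral_cmult) measurable
    also have "\<dots> \<le> epowr Y \<beta> * ennreal (2 / S)"
      by (intro mult_left_mono nn_integral_two_sided_power S a) auto
    finally have "epowr (\<integral>\<^sup>+t. epowr (g t) \<beta> \<partial>lebesgue_on {0<..}) (1 / \<beta>) \<le> epowr (epowr Y \<beta> * ennreal (2 / S)) (1 / \<beta>)"
      using \<beta> by (intro epowr_mono) auto
    also have "\<dots> = Y * ennreal Z"
      using S \<beta> by (subst epowr_mult) (auto simp: epowr_epowr_inverse Z_def)
    finally show ?thesis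
      using \<beta> False recip_ennreal[of \<beta>] by (simp add: Lb_norm_def g_def mult.commute)
  qed
  moreover have "Z > 0" using S by (simp add: Z_def)
  ultimately show ?thesis by (intro exI[of _ Z]) auto
qed

text \<open>In the variable \<open>u = t * R ^ n\<close>, the supremum bound gives the power
  \<open>\<pi>\<close> of \<open>u\<close> for \<open>u \<le> 1\<close>, and the weak-type bound
  gives \<open>\<pi> - \<rho>\<close> for \<open>u > 1\<close>. These have opposite signs, so a
  small loss from the logarithms still leaves decay on both sides.\<close>

lemma bandlimited_two_sided_bound:
  fixes q c p :: ennreal
  assumes qc: "(q = 1 \<and> c = 1 \<and> B = (0, 0)) \<or> (1 < q \<and> q < \<infinity> \<and> 0 < c)"
    and p: "0 < recip p" "recip p < recip q"
  shows "\<exists>\<sigma>>0. \<exists>K>0. \<forall>R>0. \<forall>f\<in>(LZ_bandlimited R q c B :: ('a::euclidean_space \<Rightarrow> complex) set).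
    AE t in lborel. 0 < t \<longrightarrow> ennreal (t powr recip p) * (ennreal (broken_log A t) * rearrangement f t)
      \<le> ennreal (exp (- \<sigma> * \<bar>ln (t / (1 / R ^ DIM('a)))\<bar>))
        * (ennreal (K * R powr (real DIM('a) * (recip q - recip p)) * broken_log (prod.swap A - prod.swap B) R)
            * LZ_norm q c B f)"
proof -
  define n where "n = DIM('a)"
  have n: "n \<ge> 1" by (simp add: n_def Suc_leI)
  define \<pi> \<rho> where "\<pi> = recip p" and "\<rho> = recip q"
  have \<pi>: "0 < \<pi>" "\<pi> < \<rho>" using p by (auto simp: \<pi>_def \<rho>_def)
  \<comment> \<open>For \<open>u \<le> 1\<close> only the weight of \<open>A\<close> loses
    \<open>\<delta>\<close>; for \<open>u > 1\<close> the weight of \<open>B\<close> loses another.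
    With \<open>\<delta>\<close> more left over as decay rate, a quarter of the smaller gap
    suffices.\<close>
  define \<delta> where "\<delta> = min \<pi> (\<rho> - \<pi>) / 4"
  have \<delta>: "\<delta> > 0" "4 * \<delta> \<le> \<pi>" "4 * \<delta> \<le> \<rho> - \<pi>" using \<pi> by (auto simp: \<delta>_def)
  have c: "0 < c" using qc by auto
  obtain K1 where K1: "K1 > 0" "\<And>R (f::'a \<Rightarrow> complex) t. R > 0 \<Longrightarrow> f \<in> LZ_bandlimited R q c B \<Longrightarrow>
      rearrangement f t \<le> ennreal (K1 * R powr (real n * \<rho>) * broken_log (- prod.swap B) R) * LZ_norm q c B f"
    using bandlimited_sup_bound[OF qc, where 'a = 'a] unfolding n_def \<rho>_def by blast
  obtain K2 where K2: "K2 > 0" "\<And>f::'a \<Rightarrow> complex. AE t in lborel. 0 < t \<longrightarrow>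
      rearrangement f t \<le> ennreal (K2 * t powr (- \<rho>) * broken_log (- B) t) * LZ_norm q c B f"
    using rearrangement_weak_bound[OF c, of q B, where 'a = 'a] unfolding \<rho>_def by blast
  obtain L1 where L1: "L1 > 0" "\<And>R u. R > 0 \<Longrightarrow> u > 0 \<Longrightarrow>
      broken_log A (u / R ^ n) \<le> L1 * broken_log (prod.swap A) R * exp (\<delta> * \<bar>ln u\<bar>)"
    using broken_log_scale[OF \<delta>(1) n, of A] by blast
  obtain L2 where L2: "L2 > 0" "\<And>R u. R > 0 \<Longrightarrow> u > 0 \<Longrightarrow>
      broken_log (- B) (u / R ^ n) \<le> L2 * broken_log (prod.swap (- B)) R * exp (\<delta> * \<bar>ln u\<bar>)"
    using broken_log_scale[OF \<delta>(1) n, of "- B"] by blast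
  have swap: "prod.swap (- B) = - prod.swap B" by (cases B) simp
  define K where "K = L1 * (K1 + K2 * L2)"
  have K: "K > 0" using K1 K2 L1 L2 by (simp add: K_def add_pos_pos)
  have "AE t in lborel. 0 < t \<longrightarrow> ennreal (t powr \<pi>) * (ennreal (broken_log A t) * rearrangement f t)
      \<le> ennreal (exp (- \<delta> * \<bar>ln (t / (1 / R ^ n))\<bar>))
        * (ennreal (K * R powr (real n * (\<rho> - \<pi>)) * broken_log (prod.swap A - prod.swap B) R) * LZ_norm q c B f)"
    if R: "R > 0" and f: "f \<in> LZ_bandlimited R q c B" for R and f :: "'a \<Rightarrow> complex"
    using K2(2)[of f]
  proof eventually_elim
    case (elim t)
    show ?case
    proof
      assume t: "0 < t"
      define u where "u = t * R ^ n"
      have u: "u > 0" "u / R ^ n = t" "t / (1 / R ^ n) = u" using t R by (auto simp: u_def)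
      define X where "X = R powr (real n * \<rho>) * broken_log (- prod.swap B) R"
      have X: "X > 0" using R broken_log_pos by (simp add: X_def)
      have t_powr: "t powr r = u powr r * R powr (- (real n * r))" for r
      proof -
        have "u powr r = t powr r * R powr (real n * r)"
          using t R by (simp add: u_def powr_mult powr_realpow[symmetric] powr_powr)
        then show ?thesis using R by (simp add: powr_minus)
      qed
      have lA: "broken_log A t \<le> L1 * broken_log (prod.swap A) R * exp (\<delta> * \<bar>ln u\<bar>)"
        using L1(2)[OF R u(1)] u(2) by simp
      \<comment> \<open>The profile of the rearrangement in units of \<open>X\<close>: flat where
        the supremum bound is used, and the weak-type bound including its logarithmic loss
        elsewhere.\<close>
      define v where "v = (if u \<le> 1 then 1 else u powr (- \<rho>) * exp (\<delta> * \<bar>ln u\<bar>))"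
      have v: "v \<ge> 0" by (simp add: v_def)
      have re: "rearrangement f t \<le> ennreal ((K1 + K2 * L2) * X * v) * LZ_norm q c B f"
      proof (cases "u \<le> 1")
        case True
        have "K1 * X \<le> (K1 + K2 * L2) * X * v"
          using True K1 K2 L2 X by (simp add: v_def)
        then have "ennreal (K1 * X) * LZ_norm q c B f \<le> ennreal ((K1 + K2 * L2) * X * v) * LZ_norm q c B f"
          by (intro mult_right_mono ennreal_leI) auto
        with K1(2)[OF R f, of t] show ?thesis by (simp add: X_def mult.assoc)
      next
        case False
        have "K2 * t powr (- \<rho>) * broken_log (- B) t
            \<le> K2 * t powr (- \<rho>) * (L2 * broken_log (- prod.swap B) R * exp (\<delta> * \<bar>ln u\<bar>))"
          using L2(2)[OF R u(1)] u(2) K2 by (intro mult_left_mono) (auto simp: swap)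
        also have "\<dots> = K2 * L2 * X * v"
          using False by (simp add: t_powr[of "- \<rho>"] X_def v_def mult_ac)
        also have "\<dots> \<le> (K1 + K2 * L2) * X * v"
          using K1 X v by (intro mult_right_mono) auto
        finally have "ennreal (K2 * t powr (- \<rho>) * broken_log (- B) t) * LZ_norm q c B f
            \<le> ennreal ((K1 + K2 * L2) * X * v) * LZ_norm q c B f"
          by (intro mult_right_mono ennreal_leI) auto
        with elim t show ?thesis by auto
      qed
      have decay: "u powr \<pi> * exp (\<delta> * \<bar>ln u\<bar>) * v \<le> exp (- \<delta> * \<bar>ln u\<bar>)"
      proof (cases "u \<le> 1")
        case True
        have "u powr \<pi> * exp (\<delta> * \<bar>ln u\<bar>) * v = u powr (\<pi> - \<delta>)"
          using True exp_abs_ln(1)[OF u(1) True, of \<delta>] u(1) by (simp add: v_def powr_add[symmetric])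
        also have "\<dots> \<le> u powr \<delta>"
          using True u(1) \<delta> by (intro powr_mono') auto
        also have "\<dots> = exp (- \<delta> * \<bar>ln u\<bar>)"
          using exp_abs_ln(1)[OF u(1) True, of "- \<delta>"] by simp
        finally show ?thesis .
      next
        case False
        have "u powr \<pi> * exp (\<delta> * \<bar>ln u\<bar>) * v = u powr (2 * \<delta> + (\<pi> - \<rho>))"
          using False exp_abs_ln(2)[of u \<delta>] u(1) by (simp add: v_def powr_add[symmetric])
        also have "\<dots> \<le> u powr (- \<delta>)"
          using False \<delta> by (intro powr_mono) auto
        also have "\<dots> = exp (- \<delta> * \<bar>ln u\<bar>)"
          using exp_abs_ln(2)[of u "- \<delta>"] False by simp
        finally show ?thesis .
      qed
      have "t powr \<pi> * broken_log A t * ((K1 + K2 * L2) * X * v)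
          \<le> t powr \<pi> * (L1 * broken_log (prod.swap A) R * exp (\<delta> * \<bar>ln u\<bar>)) * ((K1 + K2 * L2) * X * v)"
        using lA K1 K2 L2 X v by (intro mult_right_mono mult_left_mono) auto
      also have "\<dots> = (u powr \<pi> * exp (\<delta> * \<bar>ln u\<bar>) * v) * (K * R powr (- (real n * \<pi>)) * broken_log (prod.swap A) R * X)"
        by (simp add: t_powr[of \<pi>] K_def mult_ac)
      also have "\<dots> \<le> exp (- \<delta> * \<bar>ln u\<bar>) * (K * R powr (- (real n * \<pi>)) * broken_log (prod.swap A) R * X)"
        using K X broken_log_pos[of "prod.swap A" R] by (intro mult_right_mono decay) auto
      also have "K * R powr (- (real n * \<pi>)) * broken_log (prod.swap A) R * X
          = K * R powr (real n * (\<rho> - \<pi>)) * broken_log (prod.swap A - prod.swap B) R"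
      proof -
        have "R powr (- (real n * \<pi>)) * R powr (real n * \<rho>) = R powr (real n * (\<rho> - \<pi>))"
          unfolding powr_add[symmetric] by (simp add: algebra_simps)
        then show ?thesis unfolding broken_log_diff X_def by (simp add: mult_ac)
      qed
      finally have main: "t powr \<pi> * broken_log A t * ((K1 + K2 * L2) * X * v)
        \<le> exp (- \<delta> * \<bar>ln u\<bar>) * (K * R powr (real n * (\<rho> - \<pi>)) * broken_log (prod.swap A - prod.swap B) R)" .
      have "ennreal (t powr \<pi>) * (ennreal (broken_log A t) * rearrangement f t)
          \<le> ennreal (t powr \<pi>) * (ennreal (broken_log A t) * (ennreal ((K1 + K2 * L2) * X * v) * LZ_norm q c B f))"
        by (intro mult_left_mono re) auto
      also have "\<dots> = ennreal (t powr \<pi> * broken_log A t * ((K1 + K2 * L2) * X * v)) * LZ_norm q c B f"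
        using broken_log_pos[of A t] K1 K2 L2 X v by (simp add: ennreal_mult mult.assoc)
      also have "\<dots> \<le> ennreal (exp (- \<delta> * \<bar>ln u\<bar>) * (K * R powr (real n * (\<rho> - \<pi>)) * broken_log (prod.swap A - prod.swap B) R)) * LZ_norm q c B f"
        by (intro mult_right_mono ennreal_leI main) auto
      also have "\<dots> = ennreal (exp (- \<delta> * \<bar>ln u\<bar>)) * (ennreal (K * R powr (real n * (\<rho> - \<pi>)) * broken_log (prod.swap A - prod.swap B) R) * LZ_norm q c B f)"
        using K broken_log_pos[of "prod.swap A - prod.swap B" R] by (subst ennreal_mult) (auto simp: mult.assoc)
      finally show "ennreal (t powr \<pi>) * (ennreal (broken_log A t) * rearrangement f t)
          \<le> ennreal (exp (- \<delta> * \<bar>ln (t / (1 / R ^ n))\<bar>))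
            * (ennreal (K * R powr (real n * (\<rho> - \<pi>)) * broken_log (prod.swap A - prod.swap B) R) * LZ_norm q c B f)"
        unfolding u(3) .
    qed
  qed
  with \<delta>(1) K show ?thesis
    unfolding n_def \<pi>_def \<rho>_def by blast
qed

theorem theorem11:
  fixes q c p b :: ennreal and A B :: "real \<times> real"
  assumes "(q = 1 \<and> c = 1 \<and> B = (0, 0)) \<or> (1 < q \<and> q < \<infinity> \<and> 0 < c)"
    and "(q < p \<and> p < \<infinity> \<and> 0 < b) \<or> (p = \<infinity> \<and> b = \<infinity> \<and> A = (0, 0))"
  shows "\<exists>C>0. \<forall>R>0. \<forall>f \<in> (LZ_bandlimited R q c B :: (real ^ 'n \<Rightarrow> complex) set).
    LZ_norm p b A f
      \<le> ennreal (C * R powr (real CARD('n) * (recip q - recip p))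
                   * broken_log (prod.swap A - prod.swap B) R) * LZ_norm q c B f"
  using assms(2)
proof
  assume *: "q < p \<and> p < \<infinity> \<and> 0 < b"
  obtain q' where q': "q = ennreal q'" "q' > 0"
    using assms(1) * by (cases q) (auto simp: less_top[symmetric])
  obtain p' where p': "p = ennreal p'" "p' > q'"
    using * q' by (cases p) (auto simp: ennreal_less_iff)
  have "0 < recip p" "recip p < recip q"
    using p' q' by (auto simp: recip_ennreal frac_less2)
  from bandlimited_two_sided_bound[OF assms(1) this, of A, where 'a = "real ^ 'n"]
  obtain \<sigma> K where \<sigma>: "\<sigma> > 0" and K: "K > 0" and bound:
    "\<And>R (f :: real ^ 'n \<Rightarrow> complex). R > 0 \<Longrightarrow> f \<in> LZ_bandlimited R q c B \<Longrightarrow>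
      AE t in lborel. 0 < t \<longrightarrow> ennreal (t powr recip p) * (ennreal (broken_log A t) * rearrangement f t)
      \<le> ennreal (exp (- \<sigma> * \<bar>ln (t / (1 / R ^ CARD('n)))\<bar>))
        * (ennreal (K * R powr (real CARD('n) * (recip q - recip p)) * broken_log (prod.swap A - prod.swap B) R)
            * LZ_norm q c B f)"
    by auto
  obtain Z where Z: "Z > 0" and Lb: "\<And>a Y h \<pi>. a > 0 \<Longrightarrow> h \<in> borel_measurable borel \<Longrightarrow>
    (AE t in lborel. 0 < t \<longrightarrow> ennreal (t powr \<pi>) * h t \<le> ennreal (exp (- \<sigma> * \<bar>ln (t / a)\<bar>)) * Y) \<Longrightarrow>
    Lb_norm b (\<lambda>t. ennreal (t powr (\<pi> - recip b)) * h t) \<le> ennreal Z * Y"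
    using Lb_norm_le_two_sided_power[of b \<sigma>] * \<sigma> by blast
  have "LZ_norm p b A f \<le> ennreal ((Z * K) * R powr (real CARD('n) * (recip q - recip p))
      * broken_log (prod.swap A - prod.swap B) R) * LZ_norm q c B f"
    if R: "R > 0" and f: "f \<in> LZ_bandlimited R q c B" for R and f :: "real ^ 'n \<Rightarrow> complex"
  proof -
    let ?Y = "ennreal (K * R powr (real CARD('n) * (recip q - recip p)) * broken_log (prod.swap A - prod.swap B) R)
            * LZ_norm q c B f"
    \<comment> \<open>Here \<open>h\<close> is the logarithmic weight times the rearrangement,
      \<open>\<pi>\<close> is \<open>recip p\<close>, and the decay is centred at
      \<open>1 / R ^ n\<close>.\<close>
    have "Lb_norm b (\<lambda>t. ennreal (t powr (recip p - recip b)) * (ennreal (broken_log A t) * rearrangement f t)) \<le> ennreal Z * ?Y"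
      using R by (intro Lb[OF _ _ bound[OF R f]]) auto
    also have "(\<lambda>t. ennreal (t powr (recip p - recip b)) * (ennreal (broken_log A t) * rearrangement f t))
        = (\<lambda>t. ennreal (t powr (recip p - recip b) * broken_log A t) * rearrangement f t)"
      using less_imp_le[OF broken_log_pos, of A] by (simp add: ennreal_mult mult.assoc)
    also have "ennreal Z * ?Y = ennreal ((Z * K) * R powr (real CARD('n) * (recip q - recip p))
      * broken_log (prod.swap A - prod.swap B) R) * LZ_norm q c B f"
      using Z K less_imp_le[OF broken_log_pos, of "prod.swap A - prod.swap B" R] by (simp add: ennreal_mult mult.assoc)
    finally show ?thesis unfolding LZ_norm_def .
  qed
  moreover have "Z * K > 0" using Z K by simp
  ultimately show ?thesis by blast
next
  assume *: "p = \<infinity> \<and> b = \<infinity> \<and> A = (0, 0)"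
  obtain C where C: "C > 0" and bound: "\<And>R (f :: real ^ 'n \<Rightarrow> complex) t. R > 0 \<Longrightarrow> f \<in> LZ_bandlimited R q c B \<Longrightarrow>
    rearrangement f t \<le> ennreal (C * R powr (real CARD('n) * recip q) * broken_log (- prod.swap B) R) * LZ_norm q c B f"
    using bandlimited_sup_bound[OF assms(1), where 'a = "real ^ 'n"] by auto
  have "LZ_norm p b A f \<le> ennreal (C * R powr (real CARD('n) * (recip q - recip p))
      * broken_log (prod.swap A - prod.swap B) R) * LZ_norm q c B f"
    if R: "R > 0" and f: "f \<in> LZ_bandlimited R q c B" for R and f :: "real ^ 'n \<Rightarrow> complex"
  proof -
    have swap: "prod.swap A - prod.swap B = - prod.swap B" using * by (cases B) simp
    have eq: "C * R powr (real CARD('n) * (recip q - recip p)) * broken_log (prod.swap A - prod.swap B) R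
        = C * R powr (real CARD('n) * recip q) * broken_log (- prod.swap B) R"
      unfolding swap using * by (simp add: recip_top)
    have "(\<lambda>t. ennreal (t powr 0) * rearrangement f t) \<in> borel_measurable lborel" by measurable
    then have meas: "(\<lambda>t. ennreal (t powr 0) * rearrangement f t) \<in> borel_measurable (lebesgue_on {0<..})"
      by (intro measurable_restrict_space1 measurable_completion)
    \<comment> \<open>At this endpoint the weight is identically 1, so the norm is the essential
      supremum of the rearrangement, which the pointwise bound controls at every
      \<open>t\<close>.\<close>
    have "LZ_norm p b A f = esssup (lebesgue_on {0<..}) (\<lambda>t. ennreal (t powr 0) * rearrangement f t)"
      using * by (simp add: LZ_norm_def Lb_norm_def recip_top broken_log_zero)
    also have "\<dots> \<le> ennreal (C * R powr (real CARD('n) * recip q) * broken_log (- prod.swap B) R) * LZ_norm q c B f"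
      by (rule esssup_I[OF meas]) (use bound[OF R f] in \<open>auto simp: AE_lebesgue_on_Ioi_iff\<close>)
    finally show ?thesis unfolding eq .
  qed
  with C show ?thesis by blast
qed

end
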